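(* Let $G\in\mathcal F_{11}$. Then either $G$ is complete, or $G$ is bipartite, or $G$ admits a balanced skew partition.
   Context: Graphs are finite and simple; Berge: all holes (induced cycles of length $\ge4$) and antiholes (induced subgraphs whose complement is a hole) are even. Paths are induced subgraphs that are paths; antipaths induced subgraphs whose complement is a path; length counts edges. $X$ is anticonnected if $\overline G|X$ is connected; $X$ complete to $Y$ means all edges between them present; a vertex is $Y$-complete if adjacent to all of $Y$; an edge is $Y$-complete if both ends are. Prism: two vertex-disjoint triangles $\{a_1,a_2,a_3\},\{b_1,b_2,b_3\}$ and paths $P_i$ from $a_i$ to $b_i$ with the only edges between $V(P_i),V(P_j)$ ($i\ne j$) being $a_ia_j,b_ib_j$; long if some $P_i$ has length $>1$. Double diamond: vertices $a_1..a_4,b_1..b_4$, every two $a_i$ adjacent except $a_3a_4$, every two $b_i$ adjacent except $b_3b_4$, edges $a_ib_i$, no others. Wheel: pair $(C,Y)$ with $C$ a hole of length $\ge6$, $Y\subseteq V(G)\setminus V(C)$ nonempty anticonnected, and two disjoint $Y$-complete edges in $C$; a segment is a maximal subpath of $C$ all of whose vertices are $Y$-complete; the wheel is odd if some segment has odd length. Pseudowheel: triple $(X,Y,P)$ with $X,Y$ disjoint nonempty anticonnected, $X$ complete to $Y$, $P=p_1\hbox{-}\cdots\hbox{-}p_n$ a path in $G\setminus(X\cup Y)$, $n\ge5$, $p_1,p_n$ the only $X$-complete vertices of $P$, $p_1$ and at least one other vertex of $P$ $Y$-complete, $p_2,p_n$ not $Y$-complete. Classes: $\mathcal F_5$ =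 Berge graphs $G$ such that for every bipartite subdivision $H$ of $K_4$ neither $G$ nor $\overline G$ has an induced subgraph isomorphic to $L(H)$, and neither has an induced long prism; $\mathcal F_6$ = members of $\mathcal F_5$ with no induced double diamond; $\mathcal F_7$ = members $G$ of $\mathcal F_6$ such that neither $G$ nor $\overline G$ contains an odd wheel; $\mathcal F_8$ = members of $\mathcal F_7$ such that neither $G$ nor $\overline G$ contains a pseudowheel; $\mathcal F_9$ = members of $\mathcal F_8$ such that neither $G$ nor $\overline G$ contains a wheel; $\mathcal F_{10}$ = members $G$ of $\mathcal F_9$ such that for every hole $C$ of $G$ of length $\ge6$ no vertex of $G\setminus V(C)$ is adjacent to three consecutive vertices of $C$, and the same holds in $\overline G$; $\mathcal F_{11}$ = members of $\mathcal F_{10}$ in which every antihole has length $4$. Skew partition: partition $(A,B)$ of $V(G)$ with $G|A$ disconnected and $\overline G|B$ disconnected; balanced if there is no odd path between nonadjacent vertices of $B$ with interior in $A$ and no odd antipath between adjacent vertices of $A$ with interior in $B$. *)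

theory Defs
  imports Main
begin

definition graph :: "'a set \<Rightarrow> ('a \<Rightarrow> 'a \<Rightarrow> bool) \<Rightarrow> bool" where
  "graph V E \<longleftrightarrow> finite V \<and> (\<forall>x y. E x y \<longrightarrow> x \<in> V \<and> y \<in> V \<and> x \<noteq> y \<and> E y x)"

definition cE :: "'a set \<Rightarrow> ('a \<Rightarrow> 'a \<Rightarrow> bool) \<Rightarrow> 'a \<Rightarrow> 'a \<Rightarrow> bool" where
  "cE V E x y \<longleftrightarrow> x \<in> V \<and> y \<in> V \<and> x \<noteq> y \<and> \<not> E x y"

text \<open>Induced path p_0 - ... - p_{n-1} (list of vertices); its length is n-1.
  An antipath is a path of the complement.\<close>
definition is_path :: "'a set \<Rightarrow> ('a \<Rightarrow> 'a \<Rightarrow> bool) \<Rightarrow> 'a list \<Rightarrow> bool" where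
  "is_path V E ps \<longleftrightarrow> ps \<noteq> [] \<and> distinct ps \<and> set ps \<subseteq> V \<and>
     (\<forall>i j. i < length ps \<longrightarrow> j < length ps \<longrightarrow>
        (E (ps ! i) (ps ! j) \<longleftrightarrow> (j = i + 1 \<or> i = j + 1)))"

definition is_hole :: "'a set \<Rightarrow> ('a \<Rightarrow> 'a \<Rightarrow> bool) \<Rightarrow> 'a list \<Rightarrow> bool" where
  "is_hole V E cs \<longleftrightarrow> length cs \<ge> 4 \<and> distinct cs \<and> set cs \<subseteq> V \<and>
     (\<forall>i j. i < length cs \<longrightarrow> j < length cs \<longrightarrow>
        (E (cs ! i) (cs ! j) \<longleftrightarrow>
           (j = (i + 1) mod length cs \<or> i = (j + 1) mod length cs)))"

definition berge :: "'a set \<Rightarrow> ('a \<Rightarrow> 'a \<Rightarrow> bool) \<Rightarrow> bool" where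
  "berge V E \<longleftrightarrow> (\<forall>cs. is_hole V E cs \<longrightarrow> even (length cs)) \<and>
                  (\<forall>cs. is_hole V (cE V E) cs \<longrightarrow> even (length cs))"

definition bipartite :: "'b set \<Rightarrow> ('b \<Rightarrow> 'b \<Rightarrow> bool) \<Rightarrow> bool" where
  "bipartite V E \<longleftrightarrow> (\<exists>S. \<forall>u v. E u v \<longrightarrow> (u \<in> S \<longleftrightarrow> v \<notin> S))"

definition complete_graph :: "'a set \<Rightarrow> ('a \<Rightarrow> 'a \<Rightarrow> bool) \<Rightarrow> bool" where
  "complete_graph V E \<longleftrightarrow> (\<forall>u\<in>V. \<forall>v\<in>V. u \<noteq> v \<longrightarrow> E u v)"

definition subdivision_K4 :: "nat set \<Rightarrow> (nat \<Rightarrow> nat \<Rightarrow> bool) \<Rightarrow> bool" where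
  "subdivision_K4 Vh Eh \<longleftrightarrow>
    (\<exists>(b :: nat \<Rightarrow> nat) (P :: nat \<Rightarrow> nat \<Rightarrow> nat list).
       inj_on b {..<4} \<and>
       (\<forall>i j. i < j \<and> j < 4 \<longrightarrow>
          distinct (P i j) \<and> length (P i j) \<ge> 2 \<and> hd (P i j) = b i \<and> last (P i j) = b j \<and>
          set (P i j) \<inter> b ` {..<4} = {b i, b j}) \<and>
       (\<forall>i j i' j'. i < j \<and> j < 4 \<and> i' < j' \<and> j' < 4 \<and> (i, j) \<noteq> (i', j') \<longrightarrow>
          set (P i j) \<inter> set (P i' j') \<subseteq> b ` {..<4}) \<and>
       Vh = (\<Union>i<4. \<Union>j<4. if i < j then set (P i j) else {}) \<and>
       (\<forall>u v. Eh u v \<longleftrightarrow>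
          (\<exists>i j k. i < j \<and> j < 4 \<and> Suc k < length (P i j) \<and>
                   {u, v} = {P i j ! k, P i j ! Suc k})))"

definition has_induced_line_graph ::
    "'a set \<Rightarrow> ('a \<Rightarrow> 'a \<Rightarrow> bool) \<Rightarrow> nat set \<Rightarrow> (nat \<Rightarrow> nat \<Rightarrow> bool) \<Rightarrow> bool" where
  "has_induced_line_graph V E Vh Eh \<longleftrightarrow>
    (let LV = {{u, v} | u v. Eh u v} in
     \<exists>X f. X \<subseteq> V \<and> bij_betw f LV X \<and>
       (\<forall>e1\<in>LV. \<forall>e2\<in>LV. E (f e1) (f e2) \<longleftrightarrow> e1 \<noteq> e2 \<and> e1 \<inter> e2 \<noteq> {}))"

definition has_long_prism :: "'a set \<Rightarrow> ('a \<Rightarrow> 'a \<Rightarrow> bool) \<Rightarrow> bool" where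
  "has_long_prism V E \<longleftrightarrow>
    (\<exists>(a :: nat \<Rightarrow> 'a) (b :: nat \<Rightarrow> 'a) (P :: nat \<Rightarrow> 'a list).
       (\<forall>i<3. \<forall>j<3. i \<noteq> j \<longrightarrow> E (a i) (a j) \<and> E (b i) (b j)) \<and>
       a ` {..<3} \<inter> b ` {..<3} = {} \<and>
       (\<forall>i<3. is_path V E (P i) \<and> hd (P i) = a i \<and> last (P i) = b i) \<and>
       (\<forall>i<3. \<forall>j<3. i \<noteq> j \<longrightarrow> set (P i) \<inter> set (P j) = {} \<and>
          (\<forall>u\<in>set (P i). \<forall>v\<in>set (P j).
              E u v \<longleftrightarrow> (u = a i \<and> v = a j) \<or> (u = b i \<and> v = b j))) \<and>
       (\<exists>i<3. length (P i) > 2))"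

text \<open>G contains an induced double diamond (a 0..a 3 stand for a_1..a_4).\<close>
definition has_double_diamond :: "'a set \<Rightarrow> ('a \<Rightarrow> 'a \<Rightarrow> bool) \<Rightarrow> bool" where
  "has_double_diamond V E \<longleftrightarrow>
    (\<exists>(a :: nat \<Rightarrow> 'a) (b :: nat \<Rightarrow> 'a).
       a ` {..<4} \<subseteq> V \<and> b ` {..<4} \<subseteq> V \<and>
       inj_on a {..<4} \<and> inj_on b {..<4} \<and> a ` {..<4} \<inter> b ` {..<4} = {} \<and>
       (\<forall>i<4. \<forall>j<4. E (a i) (a j) \<longleftrightarrow> i \<noteq> j \<and> {i, j} \<noteq> {2, 3}) \<and>
       (\<forall>i<4. \<forall>j<4. E (b i) (b j) \<longleftrightarrow> i \<noteq> j \<and> {i, j} \<noteq> {2, 3}) \<and>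
       (\<forall>i<4. \<forall>j<4. E (a i) (b j) \<longleftrightarrow> i = j))"

definition anticonnected :: "'a set \<Rightarrow> ('a \<Rightarrow> 'a \<Rightarrow> bool) \<Rightarrow> 'a set \<Rightarrow> bool" where
  "anticonnected V E X \<longleftrightarrow>
    (\<forall>S. S \<subseteq> X \<longrightarrow> S \<noteq> {} \<longrightarrow> S \<noteq> X \<longrightarrow> (\<exists>u\<in>S. \<exists>v\<in>X - S. \<not> E u v))"

definition connected_set :: "'a set \<Rightarrow> ('a \<Rightarrow> 'a \<Rightarrow> bool) \<Rightarrow> 'a set \<Rightarrow> bool" where
  "connected_set V E X \<longleftrightarrow>
    (\<forall>S. S \<subseteq> X \<longrightarrow> S \<noteq> {} \<longrightarrow> S \<noteq> X \<longrightarrow> (\<exists>u\<in>S. \<exists>v\<in>X - S. E u v))"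

definition Ycomplete :: "('a \<Rightarrow> 'a \<Rightarrow> bool) \<Rightarrow> 'a set \<Rightarrow> 'a \<Rightarrow> bool" where
  "Ycomplete E Y v \<longleftrightarrow> (\<forall>y\<in>Y. E v y)"

definition is_wheel :: "'a set \<Rightarrow> ('a \<Rightarrow> 'a \<Rightarrow> bool) \<Rightarrow> 'a list \<Rightarrow> 'a set \<Rightarrow> bool" where
  "is_wheel V E cs Y \<longleftrightarrow>
    is_hole V E cs \<and> length cs \<ge> 6 \<and> Y \<subseteq> V - set cs \<and> Y \<noteq> {} \<and> anticonnected V E Y \<and>
    (\<exists>i<length cs. \<exists>j<length cs.
       {cs ! i, cs ! ((i + 1) mod length cs)} \<inter> {cs ! j, cs ! ((j + 1) mod length cs)} = {} \<and>
       Ycomplete E Y (cs ! i) \<and> Ycomplete E Y (cs ! ((i + 1) mod length cs)) \<and>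
       Ycomplete E Y (cs ! j) \<and> Ycomplete E Y (cs ! ((j + 1) mod length cs)))"

text \<open>A segment is a maximal subpath c_i - ... - c_{i+l} (indices mod k, l < k) of C
  all of whose vertices are Y-complete; the wheel is odd if some segment has odd length l.\<close>
definition is_odd_wheel :: "'a set \<Rightarrow> ('a \<Rightarrow> 'a \<Rightarrow> bool) \<Rightarrow> 'a list \<Rightarrow> 'a set \<Rightarrow> bool" where
  "is_odd_wheel V E cs Y \<longleftrightarrow> is_wheel V E cs Y \<and>
    (let k = length cs in
     \<exists>i<k. \<exists>l<k.
       (\<forall>t\<le>l. Ycomplete E Y (cs ! ((i + t) mod k))) \<and>
       (l = k - 1 \<or> (\<not> Ycomplete E Y (cs ! ((i + k - 1) mod k)) \<and>
                      \<not> Ycomplete E Y (cs ! ((i + l + 1) mod k)))) \<and>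
       odd l)"

definition has_odd_wheel :: "'a set \<Rightarrow> ('a \<Rightarrow> 'a \<Rightarrow> bool) \<Rightarrow> bool" where
  "has_odd_wheel V E \<longleftrightarrow> (\<exists>cs Y. is_odd_wheel V E cs Y)"

definition has_wheel :: "'a set \<Rightarrow> ('a \<Rightarrow> 'a \<Rightarrow> bool) \<Rightarrow> bool" where
  "has_wheel V E \<longleftrightarrow> (\<exists>cs Y. is_wheel V E cs Y)"

definition is_pseudowheel :: "'a set \<Rightarrow> ('a \<Rightarrow> 'a \<Rightarrow> bool) \<Rightarrow> 'a set \<Rightarrow> 'a set \<Rightarrow> 'a list \<Rightarrow> bool" where
  "is_pseudowheel V E X Y P \<longleftrightarrow>
    X \<subseteq> V \<and> Y \<subseteq> V \<and> X \<inter> Y = {} \<and> X \<noteq> {} \<and> Y \<noteq> {} \<and>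
    anticonnected V E X \<and> anticonnected V E Y \<and> (\<forall>x\<in>X. \<forall>y\<in>Y. E x y) \<and>
    is_path V E P \<and> set P \<inter> (X \<union> Y) = {} \<and> length P \<ge> 5 \<and>
    (\<forall>t<length P. Ycomplete E X (P ! t) \<longleftrightarrow> (t = 0 \<or> t = length P - 1)) \<and>
    Ycomplete E Y (P ! 0) \<and> (\<exists>t. 0 < t \<and> t < length P \<and> Ycomplete E Y (P ! t)) \<and>
    \<not> Ycomplete E Y (P ! 1) \<and> \<not> Ycomplete E Y (P ! (length P - 1))"

definition has_pseudowheel :: "'a set \<Rightarrow> ('a \<Rightarrow> 'a \<Rightarrow> bool) \<Rightarrow> bool" where
  "has_pseudowheel V E \<longleftrightarrow> (\<exists>X Y P. is_pseudowheel V E X Y P)"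

definition F5 :: "'a set \<Rightarrow> ('a \<Rightarrow> 'a \<Rightarrow> bool) \<Rightarrow> bool" where
  "F5 V E \<longleftrightarrow> berge V E \<and>
    (\<forall>(Vh :: nat set) Eh. bipartite Vh Eh \<and> subdivision_K4 Vh Eh \<longrightarrow>
        \<not> has_induced_line_graph V E Vh Eh \<and> \<not> has_induced_line_graph V (cE V E) Vh Eh) \<and>
    \<not> has_long_prism V E \<and> \<not> has_long_prism V (cE V E)"

definition F6 :: "'a set \<Rightarrow> ('a \<Rightarrow> 'a \<Rightarrow> bool) \<Rightarrow> bool" where
  "F6 V E \<longleftrightarrow> F5 V E \<and> \<not> has_double_diamond V E"

definition F7 :: "'a set \<Rightarrow> ('a \<Rightarrow> 'a \<Rightarrow> bool) \<Rightarrow> bool" where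
  "F7 V E \<longleftrightarrow> F6 V E \<and> \<not> has_odd_wheel V E \<and> \<not> has_odd_wheel V (cE V E)"

definition F8 :: "'a set \<Rightarrow> ('a \<Rightarrow> 'a \<Rightarrow> bool) \<Rightarrow> bool" where
  "F8 V E \<longleftrightarrow> F7 V E \<and> \<not> has_pseudowheel V E \<and> \<not> has_pseudowheel V (cE V E)"

definition F9 :: "'a set \<Rightarrow> ('a \<Rightarrow> 'a \<Rightarrow> bool) \<Rightarrow> bool" where
  "F9 V E \<longleftrightarrow> F8 V E \<and> \<not> has_wheel V E \<and> \<not> has_wheel V (cE V E)"

definition no_three_consecutive :: "'a set \<Rightarrow> ('a \<Rightarrow> 'a \<Rightarrow> bool) \<Rightarrow> bool" where
  "no_three_consecutive V E \<longleftrightarrow>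
    (\<forall>cs v. is_hole V E cs \<and> length cs \<ge> 6 \<and> v \<in> V - set cs \<longrightarrow>
       \<not> (\<exists>i<length cs. E v (cs ! i) \<and> E v (cs ! ((i + 1) mod length cs)) \<and>
                          E v (cs ! ((i + 2) mod length cs))))"

definition F10 :: "'a set \<Rightarrow> ('a \<Rightarrow> 'a \<Rightarrow> bool) \<Rightarrow> bool" where
  "F10 V E \<longleftrightarrow> F9 V E \<and> no_three_consecutive V E \<and> no_three_consecutive V (cE V E)"

definition F11 :: "'a set \<Rightarrow> ('a \<Rightarrow> 'a \<Rightarrow> bool) \<Rightarrow> bool" where
  "F11 V E \<longleftrightarrow> F10 V E \<and> (\<forall>cs. is_hole V (cE V E) cs \<longrightarrow> length cs = 4)"

definition skew_partition :: "'a set \<Rightarrow> ('a \<Rightarrow> 'a \<Rightarrow> bool) \<Rightarrow> 'a set \<Rightarrow> 'a set \<Rightarrow> bool" where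
  "skew_partition V E A B \<longleftrightarrow> A \<union> B = V \<and> A \<inter> B = {} \<and>
     \<not> connected_set V E A \<and> \<not> connected_set V (cE V E) B \<and> A \<noteq> {} \<and> B \<noteq> {}"

definition balanced_skew_partition :: "'a set \<Rightarrow> ('a \<Rightarrow> 'a \<Rightarrow> bool) \<Rightarrow> 'a set \<Rightarrow> 'a set \<Rightarrow> bool" where
  "balanced_skew_partition V E A B \<longleftrightarrow> skew_partition V E A B \<and>
     \<not> (\<exists>ps. is_path V E ps \<and> odd (length ps - 1) \<and> hd ps \<in> B \<and> last ps \<in> B \<and>
            \<not> E (hd ps) (last ps) \<and> set (butlast (tl ps)) \<subseteq> A) \<and>
     \<not> (\<exists>ps. is_path V (cE V E) ps \<and> odd (length ps - 1) \<and> hd ps \<in> A \<and> last ps \<in> A \<and>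
            E (hd ps) (last ps) \<and> set (butlast (tl ps)) \<subseteq> B)"

end

theory Submission
  imports Defs
begin

text \<open>
  A graph in F11 with a skew partition has a balanced one: if \<open>(A, B)\<close> is a skew partition with \<open>B\<close>
  minimal, then two nonadjacent vertices of \<open>B\<close> are joined through every component of \<open>A\<close>. An odd
  path through one component would, together with a path through another one, be a hole of length at
  least six, and a vertex of a second anticomponent of \<open>B\<close> would see two edges of it; an odd antipath
  would lead to an antihole of length at least five. So \<open>(A, B)\<close> is balanced.

  Now let \<open>G\<close> have no skew partition at all and contain a triangle. Choose at least three anticonnected
  sets, complete to each other, with maximal union, and let \<open>F\<close> be the rest of \<open>G\<close>. If \<open>F\<close> is empty, then
  \<open>G\<close> is complete. Otherwise, by maximality, no vertex of \<open>F\<close> is complete to two of the sets. As there are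
  no skew partitions, \<open>F\<close> is connected, and stays connected without the vertices complete to a given one
  of the sets. A Hayward-type argument then yields, for each of the sets, a vertex of \<open>F\<close> complete to it.
  The same argument reduces the final contradiction to single vertices: shortest paths in \<open>F\<close> joining
  vertices complete to different sets would attach to a triangle, giving a wheel, a prism or an antihole.
\<close>

subsection \<open>Induced paths and connected sets\<close>

text \<open>Parity alone does not bound an induced path, since an even hole may be long. The bound
  comes from a spectator: a vertex off a hole that sees two of its edges forces the hole to have
  only four vertices. This is why the family needs at least three sets: whenever two of them are
  compared, any vertex of a third sees everything in both and acts as the spectator. In the
  complement the bound is immediate, because every antihole has exactly four vertices. The absence
  of skew partitions enters through one principle: deleting two nonempty sets that are complete to
  each other leaves a connected graph. Maximality of the union enters through merging: a vertex of
  \<open>F\<close> can be united with all the sets in which it has a nonneighbour, and if it were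
  complete to two sets, the enlarged family would again have three members. Inductions over an
  anticonnected set remove a vertex whose deletion leaves it anticonnected; where one such vertex
  does not suffice, a second one is used against it.\<close>

locale simple_graph =
  fixes V :: "'a set" and E :: "'a \<Rightarrow> 'a \<Rightarrow> bool"
  assumes graph: "graph V E"
begin

lemma finite_V: "finite V" using graph by (simp add: graph_def)
lemma edge_sym: "E x y \<Longrightarrow> E y x" using graph by (simp add: graph_def)
lemma edge_commute: "E x y \<longleftrightarrow> E y x" using edge_sym by blast
lemma edge_in_V: "E x y \<Longrightarrow> x \<in> V" "E x y \<Longrightarrow> y \<in> V" using graph by (auto simp: graph_def)
lemma edge_irrefl [simp]: "\<not> E x x" using graph by (auto simp: graph_def)

lemma simple_graph_complement: "simple_graph V (cE V E)"
  using graph by unfold_locales (auto simp: graph_def cE_def)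

section \<open>Induced paths as lists\<close>

lemma path_Cons:
  "is_path V E (x # ps) \<longleftrightarrow> x \<in> V \<and> (ps = [] \<or>
     is_path V E ps \<and> x \<notin> set ps \<and> (\<forall>y\<in>set ps. E x y \<longleftrightarrow> y = hd ps))"
proof (cases "ps = []")
  case True
  then show ?thesis by (simp add: is_path_def)
next
  case ne: False
  have hd: "y = hd ps \<longleftrightarrow> k = 0" if "distinct ps" "k < length ps" "y = ps ! k" for y k
    using that ne by (metis hd_conv_nth length_greater_0_conv nth_eq_iff_index_eq)
  let ?Q = "\<lambda>ps. \<forall>i j. i < length ps \<longrightarrow> j < length ps \<longrightarrow> (E (ps ! i) (ps ! j) \<longleftrightarrow> (j = i + 1 \<or> i = j + 1))"
  have Q: "?Q (x # ps) \<longleftrightarrow> ?Q ps \<and> (\<forall>k<length ps. E x (ps ! k) \<longleftrightarrow> k = 0)"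
  proof (rule iffI; (intro conjI allI impI)?)
    fix i j assume Q: "?Q (x # ps)" and "i < length ps" "j < length ps"
    then show "E (ps ! i) (ps ! j) \<longleftrightarrow> (j = i + 1 \<or> i = j + 1)"
      using Q[rule_format, of "Suc i" "Suc j"] by simp
  next
    fix k assume Q: "?Q (x # ps)" and "k < length ps"
    then show "E x (ps ! k) \<longleftrightarrow> k = 0"
      using Q[rule_format, of 0 "Suc k"] by simp
  next
    fix i j assume "?Q ps \<and> (\<forall>k<length ps. E x (ps ! k) \<longleftrightarrow> k = 0)"
      "i < length (x # ps)" "j < length (x # ps)"
    then show "E ((x # ps) ! i) ((x # ps) ! j) \<longleftrightarrow> (j = i + 1 \<or> i = j + 1)"
      by (cases i; cases j) (simp_all add: edge_commute[of "ps ! _" x])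
  qed
  have Q': "(\<forall>k<length ps. E x (ps ! k) \<longleftrightarrow> k = 0) \<longleftrightarrow> (\<forall>y\<in>set ps. E x y \<longleftrightarrow> y = hd ps)"
    if "distinct ps"
    using hd[OF that] by (metis in_set_conv_nth)
  have "is_path V E (x # ps) \<longleftrightarrow> x \<notin> set ps \<and> distinct ps \<and> x \<in> V \<and> set ps \<subseteq> V \<and> ?Q (x # ps)"
    unfolding is_path_def by (simp only: distinct.simps list.set insert_subset) blast
  also have "\<dots> \<longleftrightarrow> x \<in> V \<and> x \<notin> set ps \<and> (distinct ps \<and> set ps \<subseteq> V \<and> ?Q ps) \<and> (\<forall>y\<in>set ps. E x y \<longleftrightarrow> y = hd ps)"
    using Q Q' by blast
  also have "\<dots> \<longleftrightarrow> x \<in> V \<and> x \<notin> set ps \<and> is_path V E ps \<and> (\<forall>y\<in>set ps. E x y \<longleftrightarrow> y = hd ps)"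
    unfolding is_path_def using ne by blast
  finally show ?thesis using ne by blast
qed

lemma path_Nil [simp]: "\<not> is_path V E []" by (simp add: is_path_def)

lemma path_distinct: "is_path V E ps \<Longrightarrow> distinct ps" by (simp add: is_path_def)
lemma path_subset: "is_path V E ps \<Longrightarrow> set ps \<subseteq> V" by (simp add: is_path_def)

lemma path_append:
  assumes "ps \<noteq> []" "qs \<noteq> []"
  shows "is_path V E (ps @ qs) \<longleftrightarrow> is_path V E ps \<and> is_path V E qs \<and> set ps \<inter> set qs = {} \<and>
     (\<forall>x\<in>set ps. \<forall>y\<in>set qs. E x y \<longleftrightarrow> x = last ps \<and> y = hd qs)"
  using assms
proof (induction ps)
  case (Cons p ps)
  show ?case
  proof (cases "ps = []")
    case True
    then show ?thesis using Cons.prems by (auto simp: path_Cons)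
  next
    case False
    then have IH: "is_path V E (ps @ qs) \<longleftrightarrow> is_path V E ps \<and> is_path V E qs \<and> set ps \<inter> set qs = {} \<and>
     (\<forall>x\<in>set ps. \<forall>y\<in>set qs. E x y \<longleftrightarrow> x = last ps \<and> y = hd qs)"
      using Cons by blast
    have h: "hd ps \<in> set ps" "last ps \<in> set ps" "hd (ps @ qs) = hd ps" using False by auto
    have "set ps \<inter> set qs = {} \<Longrightarrow> hd ps \<notin> set qs" using h by blast
    then show ?thesis using IH False Cons.prems h by (auto simp: path_Cons)
  qed
qed simp

lemma path_rev: "is_path V E (rev ps) \<longleftrightarrow> is_path V E ps"
proof -
  have "is_path V E (rev ps)" if "is_path V E ps" for ps
    using that
  proof (induction ps)
    case (Cons p ps)
    show ?case
    proof (cases "ps = []")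
      case True then show ?thesis using Cons by simp
    next
      case False
      then have "is_path V E ps" "p \<in> V" "p \<notin> set ps" "\<forall>y\<in>set ps. E p y \<longleftrightarrow> y = hd ps"
        using Cons.prems by (auto simp: path_Cons)
      then show ?thesis
        using Cons.IH False
        by (auto simp: path_append path_Cons[of p "[]"] last_rev edge_commute[of _ p])
    qed
  qed simp
  from this[of ps] this[of "rev ps"] show ?thesis by auto
qed

text \<open>The cyclic indices of \<open>is_hole\<close> are unfolded here once, so that holes can
  afterwards be assembled from paths by looking at ends and adjacencies alone. Three path vertices
  suffice: the result may be a 4-cycle.\<close>

lemma hole_cap:
  assumes qs: "is_path V E qs" and x: "x \<in> V" "x \<notin> set qs"
    and cross: "\<And>y. y \<in> set qs \<Longrightarrow> E x y \<longleftrightarrow> y = hd qs \<or> y = last qs" and len: "length qs \<ge> 3"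
  shows "is_hole V E (x # qs)"
proof -
  let ?n = "length qs"
  have ne: "qs \<noteq> []" using len by auto
  have d: "distinct qs" using qs by (rule path_distinct)
  have cr: "E x (qs ! k) \<longleftrightarrow> k = 0 \<or> k = ?n - 1" if "k < ?n" for k
    using cross[of "qs ! k"] that ne d
      nth_eq_iff_index_eq[OF d, of k 0] nth_eq_iff_index_eq[OF d, of k "?n - 1"]
    by (simp add: hd_conv_nth last_conv_nth)
  have pp: "E (qs ! i) (qs ! j) \<longleftrightarrow> (j = i + 1 \<or> i = j + 1)" if "i < ?n" "j < ?n" for i j
    using that qs by (simp add: is_path_def)
  \<comment> \<open>The cyclic successor differs from \<open>i + 1\<close> only at the last index,
    where it wraps around to 0, the position of \<open>x\<close>.\<close>
  have md: "j = (i + 1) mod Suc ?n \<longleftrightarrow> j = i + 1 \<or> (j = 0 \<and> i = ?n)"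
    if "i < Suc ?n" "j < Suc ?n" for i j
  proof (cases "i = ?n")
    case False
    then have "(i + 1) mod Suc ?n = i + 1" using that by simp
    then show ?thesis using False by simp
  qed (use that in simp)
  have "E ((x # qs) ! i) ((x # qs) ! j) \<longleftrightarrow> (j = (i + 1) mod Suc ?n \<or> i = (j + 1) mod Suc ?n)"
    if ij: "i < Suc ?n" "j < Suc ?n" for i j
    unfolding md[OF ij] md[OF ij(2) ij(1)]
  proof (cases i)
    case 0
    then show "E ((x # qs) ! i) ((x # qs) ! j) \<longleftrightarrow> (j = i + 1 \<or> j = 0 \<and> i = ?n) \<or> (i = j + 1 \<or> i = 0 \<and> j = ?n)"
      using len ij cr[of "j - 1"] by (cases j) auto
  next
    case (Suc i')
    show "E ((x # qs) ! i) ((x # qs) ! j) \<longleftrightarrow> (j = i + 1 \<or> j = 0 \<and> i = ?n) \<or> (i = j + 1 \<or> i = 0 \<and> j = ?n)"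
    proof (cases j)
      case 0
      then show ?thesis using len ij cr[of i'] Suc edge_commute[of "qs ! i'" x] by auto
    next
      case (Suc j')
      then show ?thesis using ij pp[of i' j'] \<open>i = Suc i'\<close> by auto
    qed
  qed
  then show ?thesis
    using path_subset[OF qs] d x len unfolding is_hole_def by simp
qed

text \<open>The head of \<open>ps\<close> is the cap: the rest of \<open>ps\<close> followed by
  \<open>qs\<close> is an induced path of which it sees exactly the two ends.\<close>

lemma hole_ring:
  assumes ps: "is_path V E ps" and qs: "is_path V E qs" and dis: "set ps \<inter> set qs = {}"
    and cross: "\<And>x y. x \<in> set ps \<Longrightarrow> y \<in> set qs \<Longrightarrow>
       E x y \<longleftrightarrow> (x = last ps \<and> y = hd qs) \<or> (x = hd ps \<and> y = last qs)"
    and len: "length ps + length qs \<ge> 4"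
  shows "is_hole V E (ps @ qs)"
proof (cases ps)
  case (Cons p ps')
  have qne: "qs \<noteq> []" using qs by auto
  show ?thesis
  proof (cases "ps' = []")
    case True
    then show ?thesis using hole_cap[OF qs, of p] Cons ps dis cross[of p] len by (auto simp: path_Cons)
  next
    case False
    then have p: "is_path V E ps'" "p \<in> V" "p \<notin> set ps'" "\<And>y. y \<in> set ps' \<Longrightarrow> E p y \<longleftrightarrow> y = hd ps'"
      using ps Cons by (auto simp: path_Cons)
    have l: "last ps' \<in> set ps'" "hd ps' \<in> set ps'" "last qs \<in> set qs" using False qne by auto
    have cr': "E x y \<longleftrightarrow> x = last ps' \<and> y = hd qs" if "x \<in> set ps'" "y \<in> set qs" for x y
      using cross[of x y] that Cons False p(3) by auto
    have "is_path V E (ps' @ qs)"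
      using False qne p qs dis cr' Cons by (subst path_append) auto
    moreover have "E p y \<longleftrightarrow> y = hd ps' \<or> y = last qs" if "y \<in> set (ps' @ qs)" for y
    proof (cases "y \<in> set ps'")
      case True
      then have "y \<noteq> last qs" using l dis Cons by auto
      then show ?thesis using p(4) True by blast
    next
      case F: False
      then have "y \<in> set qs" "y \<noteq> hd ps'" using that l by auto
      then show ?thesis using cross[of p y] Cons False p(3) l by auto
    qed
    ultimately have "is_hole V E (p # ps' @ qs)"
      using p dis Cons len False qne by (intro hole_cap) auto
    then show ?thesis using Cons by simp
  qed
qed (use ps in simp)

section \<open>Connected sets\<close>

lemma connected_setD:
  "connected_set V E M \<Longrightarrow> S \<subseteq> M \<Longrightarrow> S \<noteq> {} \<Longrightarrow> S \<noteq> M \<Longrightarrow> \<exists>u\<in>S. \<exists>v\<in>M - S. E u v"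
  by (simp add: connected_set_def)

lemma connected_singleton: "connected_set V E {x}"
  by (auto simp: connected_set_def subset_singleton_iff)

lemma connected_union:
  assumes c: "connected_set V E M" "connected_set V E N" and uv: "u \<in> M" "v \<in> N" "u = v \<or> E u v"
  shows "connected_set V E (M \<union> N)"
  unfolding connected_set_def
proof (intro allI impI)
  fix S assume S: "S \<subseteq> M \<union> N" "S \<noteq> {}" "S \<noteq> M \<union> N"
  show "\<exists>a\<in>S. \<exists>b\<in>M \<union> N - S. E a b"
  proof (rule ccontr)
    assume no: "\<not> ?thesis"
    have "S \<inter> M = {} \<or> S \<inter> M = M"
      using connected_setD[OF c(1), of "S \<inter> M"] no by blast
    moreover have "S \<inter> N = {} \<or> S \<inter> N = N"
      using connected_setD[OF c(2), of "S \<inter> N"] no by blast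
    ultimately have "S = M \<and> S \<inter> N = {} \<or> S = N \<and> S \<inter> M = {}"
      using S by blast
    then show False using no uv edge_sym by blast
  qed
qed

lemma connected_insert:
  "connected_set V E M \<Longrightarrow> u \<in> M \<Longrightarrow> E u v \<Longrightarrow> connected_set V E (insert v M)"
  using connected_union[OF _ connected_singleton[of v], of M u v] by simp

lemma path_connected: "is_path V E ps \<Longrightarrow> connected_set V E (set ps)"
proof (induction ps)
  case (Cons p ps)
  show ?case
  proof (cases "ps = []")
    case True then show ?thesis by (simp add: connected_singleton)
  next
    case False
    then show ?thesis using Cons connected_insert[of "set ps" "hd ps" p]
      using edge_commute[of p "hd ps"] by (auto simp: path_Cons)
  qed
qed simp

text \<open>A largest proper connected subset containing \<open>r\<close> misses only one vertex,
  since an edge leaving it would enlarge it. In the complement this gives a vertex whose removal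
  keeps a set anticonnected; the freedom in \<open>r\<close> gives a second one.\<close>

lemma noncut_vertex:
  assumes c: "connected_set V E X" and X: "X \<subseteq> V" "r \<in> X" "X \<noteq> {r}"
  obtains y where "y \<in> X" "y \<noteq> r" "connected_set V E (X - {y})"
proof -
  let ?P = "\<lambda>T. T \<subset> X \<and> r \<in> T \<and> connected_set V E T"
  have fin: "finite X" using X finite_V finite_subset by blast
  have "?P {r}" using X connected_singleton by blast
  moreover have "\<forall>T. ?P T \<longrightarrow> card T < Suc (card X)" using fin by (simp add: card_mono psubset_imp_subset less_Suc_eq_le)
  ultimately obtain T where T: "?P T" and max: "\<And>T'. ?P T' \<Longrightarrow> card T' \<le> card T"
    using ex_has_greatest_nat[of ?P "{r}" card "Suc (card X)"] by blast
  obtain t y where ty: "t \<in> T" "y \<in> X - T" "E t y"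
    using connected_setD[OF c, of T] T by blast
  have "connected_set V E (insert y T)" using connected_insert T ty by blast
  moreover have "card (insert y T) > card T"
    using T ty fin by (metis Diff_iff card_insert_disjoint finite_subset lessI psubset_imp_subset)
  ultimately have "insert y T = X" using max[of "insert y T"] T ty by auto
  then have "X - {y} = T" using ty by auto
  then show thesis using that T ty by auto
qed

lemma maximal_connected:
  assumes "t \<in> T" "T \<subseteq> V"
  obtains D where "t \<in> D" "D \<subseteq> T" "connected_set V E D" "\<And>x y. x \<in> D \<Longrightarrow> y \<in> T - D \<Longrightarrow> \<not> E x y"
proof -
  let ?P = "\<lambda>D. D \<subseteq> T \<and> t \<in> D \<and> connected_set V E D"
  have fin: "finite T" using assms finite_V finite_subset by blast
  have "?P {t}" using assms connected_singleton by blast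
  moreover have "\<forall>D. ?P D \<longrightarrow> card D < Suc (card T)" using fin by (simp add: card_mono less_Suc_eq_le)
  ultimately obtain D where D: "?P D" and max: "\<And>D'. ?P D' \<Longrightarrow> card D' \<le> card D"
    using ex_has_greatest_nat[of ?P "{t}" card "Suc (card T)"] by blast
  have "\<not> E x y" if "x \<in> D" "y \<in> T - D" for x y
  proof
    assume "E x y"
    then have "?P (insert y D)" using connected_insert D that by blast
    moreover have "card (insert y D) > card D"
      using D that fin by (metis Diff_iff card_insert_disjoint finite_subset lessI)
    ultimately show False using max[of "insert y D"] by linarith
  qed
  then show thesis using that D by blast
qed

section \<open>Walks, and shortest walks as induced paths\<close>

definition walk :: "'a list \<Rightarrow> bool" where
  "walk ws \<longleftrightarrow> ws \<noteq> [] \<and> successively E ws"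

lemma walk_Cons: "walk (x # ws) \<longleftrightarrow> ws = [] \<or> walk ws \<and> E x (hd ws)"
  by (auto simp: walk_def successively_Cons)

lemma walk_append:
  "ps \<noteq> [] \<Longrightarrow> qs \<noteq> [] \<Longrightarrow> walk (ps @ qs) \<longleftrightarrow> walk ps \<and> walk qs \<and> E (last ps) (hd qs)"
  by (auto simp: walk_def successively_append_iff)

lemma connected_walk:
  assumes c: "connected_set V E M" and a: "a \<in> M" and b: "b \<in> M"
  shows "\<exists>ws. walk ws \<and> set ws \<subseteq> M \<and> hd ws = a \<and> last ws = b"
proof -
  let ?S = "{b. \<exists>ws. walk ws \<and> set ws \<subseteq> M \<and> hd ws = a \<and> last ws = b}"
  have "walk [a]" by (simp add: walk_def)
  then have aS: "a \<in> ?S" using a by (intro CollectI exI[of _ "[a]"]) auto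
  have sub: "?S \<subseteq> M" by (force simp: walk_def)
  have "?S = M"
  proof (rule ccontr)
    assume "?S \<noteq> M"
    then obtain u v where uv: "u \<in> ?S" "v \<in> M - ?S" "E u v"
      using connected_setD[OF c sub] aS by blast
    then obtain ws where ws: "walk ws" "set ws \<subseteq> M" "hd ws = a" "last ws = u" by blast
    then have "ws \<noteq> []" by (auto simp: walk_def)
    then have "walk (ws @ [v])" "set (ws @ [v]) \<subseteq> M" "hd (ws @ [v]) = a" "last (ws @ [v]) = v"
      using ws uv by (auto simp: walk_append walk_Cons[of v "[]"])
    then have "v \<in> ?S" by blast
    then show False using uv by blast
  qed
  then show ?thesis using b by blast
qed

text \<open>A shortest walk between the two sets is such a path.\<close>
lemma connected_path:
  assumes c: "connected_set V E M" and M: "M \<subseteq> V" and a: "a \<in> M" "a \<in> A" and b: "b \<in> M" "b \<in> B"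
  obtains ps where "is_path V E ps" "set ps \<subseteq> M" "hd ps \<in> A" "last ps \<in> B"
    "\<And>x. x \<in> set ps \<Longrightarrow> x \<in> A \<Longrightarrow> x = hd ps" "\<And>x. x \<in> set ps \<Longrightarrow> x \<in> B \<Longrightarrow> x = last ps"
proof -
  let ?P = "\<lambda>ws. walk ws \<and> set ws \<subseteq> M \<and> hd ws \<in> A \<and> last ws \<in> B"
  have "\<exists>ws. ?P ws" using connected_walk[OF c a(1) b(1)] a b by blast
  then obtain ws where ws: "?P ws" and min: "\<And>vs. ?P vs \<Longrightarrow> length ws \<le> length vs"
    using ex_has_least_nat[of ?P _ length] by blast
  have ne: "ws \<noteq> []" using ws by (auto simp: walk_def)
  \<comment> \<open>A later vertex of \<open>A\<close> would start a shorter walk. An early vertex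
    of \<open>B\<close>, a repeated vertex and a chord are excluded by similar shortcuts.\<close>
  have A: "x = hd ws" if "x \<in> set ws" "x \<in> A" for x
  proof -
    obtain ys zs where s: "ws = ys @ x # zs" using split_list[OF \<open>x \<in> set ws\<close>] by blast
    have "ys = []"
    proof (rule ccontr)
      assume "ys \<noteq> []"
      then have "?P (x # zs)" using ws s that by (auto simp: walk_append)
      then show False using min[of "x # zs"] s \<open>ys \<noteq> []\<close> by simp
    qed
    then show ?thesis using s by simp
  qed
  have B: "x = last ws" if "x \<in> set ws" "x \<in> B" for x
  proof -
    obtain ys zs where s: "ws = ys @ x # zs" using split_list[OF \<open>x \<in> set ws\<close>] by blast
    have "zs = []"
    proof (rule ccontr)
      assume z: "zs \<noteq> []"
      then have "walk ((ys @ [x]) @ zs)" using ws s by simp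
      then have "walk (ys @ [x])" using z by (subst (asm) walk_append) auto
      then have "?P (ys @ [x])" using ws s that by (auto simp: hd_append)
      then show False using min[of "ys @ [x]"] s z by simp
    qed
    then show ?thesis using s by simp
  qed
  have w_split: "walk (as @ [x]) \<and> walk (y # cs)" if "ws = as @ x # bs @ y # cs" for as bs cs x y
  proof -
    have "walk ((as @ x # bs) @ y # cs)" using ws that by simp
    then have *: "walk (as @ x # bs)" "walk (y # cs)" by (subst (asm) walk_append; simp)+
    then have "walk (as @ [x])" by (cases "as = []") (auto simp: walk_append walk_Cons walk_def[of "[x]"])
    then show ?thesis using * by simp
  qed
  have dist: "x \<noteq> y" if s: "ws = as @ x # bs @ y # cs" for as bs cs x y
  proof
    assume "x = y"
    then have "walk (as @ x # cs)"
      using w_split[OF s] by (cases "as = []") (auto simp: walk_append)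
    moreover have "hd (as @ x # cs) = hd ws" "last (as @ x # cs) = last ws" "set (as @ x # cs) \<subseteq> set ws"
      using s \<open>x = y\<close> by (auto simp: hd_append)
    ultimately have "?P (as @ x # cs)" using ws by auto
    then show False using min[of "as @ x # cs"] s by simp
  qed
  have short: "\<not> E x y" if s: "ws = as @ x # bs @ y # cs" "bs \<noteq> []" for as bs cs x y
  proof
    assume "E x y"
    then have "walk ((as @ [x]) @ y # cs)" using w_split[OF s(1)] by (subst walk_append) auto
    moreover have "hd ((as @ [x]) @ y # cs) = hd ws" "last ((as @ [x]) @ y # cs) = last ws"
      "set ((as @ [x]) @ y # cs) \<subseteq> set ws"
      using s by (auto simp: hd_append)
    ultimately have "?P ((as @ [x]) @ y # cs)" using ws by auto
    then show False using min[of "(as @ [x]) @ y # cs"] s by simp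
  qed
  have "is_path V E vs" if "ws = us @ vs" "vs \<noteq> []" for us vs
    using that
  proof (induction vs arbitrary: us)
    case (Cons v vs)
    have v: "v \<in> V" using Cons.prems ws M by auto
    show ?case
    proof (cases "vs = []")
      case False
      have "is_path V E vs" using Cons.IH[of "us @ [v]"] Cons.prems False by simp
      moreover have "v \<noteq> y \<and> (E v y \<longleftrightarrow> y = hd vs)" if y: "y \<in> set vs" for y
      proof -
        obtain bs cs where s: "vs = bs @ y # cs" using y by (meson split_list)
        then have s': "ws = us @ v # bs @ y # cs" using Cons.prems by simp
        have "walk (v # vs)" using w_split[of us v bs y cs] ws Cons.prems False
          by (cases "us = []") (auto simp: walk_append)
        then have e: "E v (hd vs)" using False by (simp add: walk_Cons)
        show ?thesis
        proof (cases "bs = []")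
          case True then show ?thesis using dist[OF s'] e s by auto
        next
          case bs: False
          then have "hd bs \<noteq> y" using dist[of "us @ [v]" "hd bs" "tl bs" y cs] s' by simp
          then show ?thesis using dist[OF s'] short[OF s' bs] s bs by (auto simp: hd_append)
        qed
      qed
      ultimately show ?thesis using v by (auto simp: path_Cons)
    qed (use v in \<open>simp add: path_Cons\<close>)
  qed simp
  from this[of "[]" ws] ne have "is_path V E ws" by simp
  then show thesis using that[of ws] ws A B by blast
qed

lemma path_sub: "is_path V E (xs @ ys @ zs) \<Longrightarrow> ys \<noteq> [] \<Longrightarrow> is_path V E ys"
  by (metis append_Nil append_Nil2 path_append append_is_Nil_conv)

lemma cE_iff: "x \<in> V \<Longrightarrow> y \<in> V \<Longrightarrow> cE V E x y \<longleftrightarrow> x \<noteq> y \<and> \<not> E x y"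
  by (simp add: cE_def)

lemma anticonnected_iff: "X \<subseteq> V \<Longrightarrow> anticonnected V E X \<longleftrightarrow> connected_set V (cE V E) X"
proof -
  assume X: "X \<subseteq> V"
  have "(\<exists>u\<in>S. \<exists>v\<in>X - S. \<not> E u v) \<longleftrightarrow> (\<exists>u\<in>S. \<exists>v\<in>X - S. cE V E u v)" if "S \<subseteq> X" for S
    using X that by (intro bex_cong refl) (auto simp: cE_def)
  then show ?thesis unfolding anticonnected_def connected_set_def by metis
qed

lemma hole_edge_index:
  assumes "is_hole V E cs" "x \<in> set cs" "y \<in> set cs" "E x y"
  shows "\<exists>i<length cs. {x, y} = {cs ! i, cs ! ((i + 1) mod length cs)}"
proof -
  obtain i j where ij: "i < length cs" "x = cs ! i" "j < length cs" "y = cs ! j"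
    using assms(2,3) by (metis in_set_conv_nth)
  then have "j = (i + 1) mod length cs \<or> i = (j + 1) mod length cs"
    using assms(1,4) unfolding is_hole_def by blast
  then show ?thesis using ij by (metis insert_commute)
qed

text \<open>The path leaves \<open>v\<close> through its last neighbour \<open>t\<close> before
  \<open>q\<close> and follows the old path to \<open>q\<close>, the only vertex there that sees
  \<open>y\<close>. What matters is that the new path from \<open>v\<close> to \<open>y\<close> has
  at least the two inner vertices \<open>t\<close> and \<open>q\<close>; the users bound its length
  from above.\<close>

lemma path_detour:
  assumes m: "is_path V E (p # bs @ [q])" and v: "v \<in> V" "v \<notin> set (p # bs @ [q])"
    and y: "y \<in> V" "y \<notin> set (p # bs @ [q])" and vy: "v \<noteq> y" "\<not> E v y"
    and e: "E p v" "\<not> E q v" "E q y" "\<And>x. x \<in> set (p # bs) \<Longrightarrow> \<not> E x y"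
  obtains t es where "set (t # es) \<subseteq> set (p # bs)" "is_path V E (v # (t # es @ [q]) @ [y])"
proof -
  have "\<exists>x\<in>set (p # bs). E x v" using e by auto
  from split_list_last_prop[OF this] obtain ds t es where
    s: "p # bs = ds @ t # es" "E t v" "\<forall>x\<in>set es. \<not> E x v" by blast
  have ms: "p # bs @ [q] = ds @ (t # es @ [q]) @ []" using s(1) by (metis append_Cons append_assoc append_Nil2)
  have tq: "is_path V E (t # es @ [q])" using path_sub[of ds "t # es @ [q]" "[]"] m unfolding ms by simp
  have sub: "set (t # es @ [q]) \<subseteq> set (p # bs @ [q])" unfolding ms by auto
  have tes: "set (t # es) \<subseteq> set (p # bs)" unfolding s(1) by auto
  have out: "v \<notin> set (t # es @ [q])" "y \<notin> set (t # es @ [q])" using v y sub by auto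
  have "E v x \<longleftrightarrow> x = hd (t # es @ [q])" if "x \<in> set (t # es @ [q])" for x
  proof -
    have "t \<notin> set (es @ [q])" using path_distinct[OF tq] by simp
    then show ?thesis using that s e edge_commute[of v x] by auto
  qed
  then have vtq: "is_path V E (v # t # es @ [q])"
    using tq v out by (subst path_Cons) auto
  have "E x y \<longleftrightarrow> x = q" if "x \<in> set (v # t # es @ [q])" for x
    using that vy e tes by auto
  then have "is_path V E ((v # t # es @ [q]) @ [y])"
    using vtq vy y out by (subst path_append) (auto simp: path_Cons[of y])
  then show thesis using that[OF tes] by simp
qed

lemma path_close_ends:
  assumes Q: "is_path V E Q" and u: "u \<in> V" "u \<notin> set Q" and w: "w \<in> V" "w \<notin> set Q" "u \<noteq> w" "\<not> E u w"
    and e: "\<And>x. x \<in> set Q \<Longrightarrow> E u x \<longleftrightarrow> x = hd Q" "\<And>x. x \<in> set Q \<Longrightarrow> E x w \<longleftrightarrow> x = last Q"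
  shows "is_path V E (u # Q @ [w])"
proof -
  have ne: "Q \<noteq> []" using Q by auto
  have "is_path V E (Q @ [w])"
    using Q w e ne by (subst path_append) (auto simp: path_Cons[of w])
  then show ?thesis using u w e ne by (subst path_Cons) auto
qed

text \<open>A disconnected \<open>A\<close> has two sides without edges between them, and the
  connected set \<open>I\<close> lies within one. A component of the other side is a component of
  \<open>A\<close>; it supplies a second route avoiding \<open>I\<close>.\<close>

lemma separated_component:
  assumes A: "\<not> connected_set V E A" "A \<subseteq> V" and I: "connected_set V E I" "I \<subseteq> A"
  obtains D where "D \<subseteq> A - I" "D \<noteq> {}" "D \<noteq> A" "connected_set V E D"
    "\<And>x y. x \<in> D \<Longrightarrow> y \<in> A - D \<Longrightarrow> \<not> E x y"
proof -
  obtain S where S: "S \<subseteq> A" "S \<noteq> {}" "S \<noteq> A" "\<And>x y. x \<in> S \<Longrightarrow> y \<in> A - S \<Longrightarrow> \<not> E x y"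
    using A(1) unfolding connected_set_def by blast
  have "I \<inter> S = {} \<or> I \<inter> S = I"
    using connected_setD[OF I(1), of "I \<inter> S"] S(4) I(2) by blast
  then obtain T where T: "T \<subseteq> A - I" "T \<noteq> {}" "T \<noteq> A" "\<And>x y. x \<in> T \<Longrightarrow> y \<in> A - T \<Longrightarrow> \<not> E x y"
  proof
    assume "I \<inter> S = {}"
    then show thesis using that[of S] S by blast
  next
    assume "I \<inter> S = I"
    then show thesis using that[of "A - S"] S edge_sym by blast
  qed
  obtain t where "t \<in> T" using T by blast
  moreover have "T \<subseteq> V" using T A by blast
  ultimately obtain D where "t \<in> D" "D \<subseteq> T" "connected_set V E D" "\<And>x y. x \<in> D \<Longrightarrow> y \<in> T - D \<Longrightarrow> \<not> E x y"
    using maximal_connected by blast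
  then show thesis using that[of D] T by blast
qed

end

subsection \<open>Holes, antiholes and prisms\<close>

locale F11_graph = simple_graph +
  assumes F11: "F11 V E"
begin

sublocale C: simple_graph V "cE V E"
  by (rule simple_graph_complement)

lemma F11_unfold: "berge V E" "no_three_consecutive V E" "\<not> has_wheel V E" "\<not> has_long_prism V E"
  using F11 by (auto simp: F11_def F10_def F9_def F8_def F7_def F6_def F5_def)

lemma hole_even: "is_hole V E cs \<Longrightarrow> even (length cs)"
  using F11_unfold by (simp add: berge_def)

lemma antihole_length: "is_hole V (cE V E) cs \<Longrightarrow> length cs = 4"
  using F11 by (simp add: F11_def)

text \<open>Two disjoint such edges form a wheel, two adjacent ones give three consecutive neighbours.\<close>
lemma hole_two_edges:
  assumes h: "is_hole V E cs" and len: "length cs \<ge> 6" and z: "z \<in> V" "z \<notin> set cs"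
    and e: "x \<in> set cs" "y \<in> set cs" "E x y" "E z x" "E z y"
    and e': "x' \<in> set cs" "y' \<in> set cs" "E x' y'" "E z x'" "E z y'"
  shows "{x, y} = {x', y'}"
proof (rule ccontr)
  assume ne: "{x, y} \<noteq> {x', y'}"
  let ?k = "length cs"
  let ?s = "\<lambda>i. (i + 1) mod ?k"
  obtain i where i: "i < ?k" "{x, y} = {cs ! i, cs ! ?s i}" using hole_edge_index[OF h e(1-3)] by blast
  obtain j where j: "j < ?k" "{x', y'} = {cs ! j, cs ! ?s j}" using hole_edge_index[OF h e'(1-3)] by blast
  have zi: "E z (cs ! i)" "E z (cs ! ?s i)" using i(2) e(4,5) by (metis doubleton_eq_iff)+
  have zj: "E z (cs ! j)" "E z (cs ! ?s j)" using j(2) e'(4,5) by (metis doubleton_eq_iff)+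
  have d: "distinct cs" using h by (simp add: is_hole_def)
  have no3: False if "E z (cs ! i)" "E z (cs ! ?s i)" "E z (cs ! ?s (?s i))" "i < ?k" for i
  proof -
    have "?s (?s i) = (i + 2) mod ?k" by (simp add: mod_simps)
    then show False using F11_unfold(2) h len z that unfolding no_three_consecutive_def by auto
  qed
  have "i \<noteq> j" using ne i j by auto
  have sk: "?s i < ?k" "?s j < ?k" using len by (auto intro: mod_less_divisor)
  have "i \<noteq> ?s j" using no3[of j] zi zj j by auto
  have "j \<noteq> ?s i" using no3[of i] zi zj i by auto
  have si: "?s i = (if i + 1 = ?k then 0 else i + 1)" if "i < ?k" for i
    using that by auto
  have "?s i \<noteq> ?s j" using \<open>i \<noteq> j\<close> si[OF i(1)] si[OF j(1)] by (auto split: if_splits)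
  then have "{cs ! i, cs ! ?s i} \<inter> {cs ! j, cs ! ?s j} = {}"
    using \<open>i \<noteq> j\<close> \<open>i \<noteq> ?s j\<close> \<open>j \<noteq> ?s i\<close> nth_eq_iff_index_eq[OF d] i j sk by auto
  moreover have "anticonnected V E {z}" by (auto simp: anticonnected_def subset_singleton_iff)
  moreover have "Ycomplete E {z} v \<longleftrightarrow> E z v" for v using edge_commute by (simp add: Ycomplete_def)
  ultimately have "is_wheel V E cs {z}"
    unfolding is_wheel_def using h len z i(1) j(1) zi zj by blast
  then show False using F11_unfold(3) by (auto simp: has_wheel_def)
qed

text \<open>The triangles of the prism are the three heads and the three last vertices. The length
  bounds keep the two triangles disjoint; the path known to be long goes third.\<close>

lemma no_long_prism:
  assumes p: "is_path V E P" "is_path V E Q" "is_path V E R"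
    and len: "length P \<ge> 2" "length Q \<ge> 2" "length R > 2"
    and dis: "set P \<inter> set Q = {}" "set P \<inter> set R = {}" "set Q \<inter> set R = {}"
    and PQ: "\<And>x y. x \<in> set P \<Longrightarrow> y \<in> set Q \<Longrightarrow> E x y \<longleftrightarrow> x = hd P \<and> y = hd Q \<or> x = last P \<and> y = last Q"
    and PR: "\<And>x y. x \<in> set P \<Longrightarrow> y \<in> set R \<Longrightarrow> E x y \<longleftrightarrow> x = hd P \<and> y = hd R \<or> x = last P \<and> y = last R"
    and QR: "\<And>x y. x \<in> set Q \<Longrightarrow> y \<in> set R \<Longrightarrow> E x y \<longleftrightarrow> x = hd Q \<and> y = hd R \<or> x = last Q \<and> y = last R"
  shows False
proof -
  define L where "L = (\<lambda>i::nat. if i = 0 then P else if i = 1 then Q else R)"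
  have L: "L 0 = P" "L (Suc 0) = Q" "L 2 = R" by (auto simp: L_def)
  have three: "(\<forall>i<3. A i) \<longleftrightarrow> A 0 \<and> A (Suc 0) \<and> A 2" for A :: "nat \<Rightarrow> bool"
    by (auto simp: numeral_3_eq_3 numeral_2_eq_2 less_Suc_eq)
  have three': "{..<3::nat} = {0, Suc 0, 2}" by auto
  have ne: "P \<noteq> []" "Q \<noteq> []" "R \<noteq> []" using len by auto
  then have m: "hd P \<in> set P" "last P \<in> set P" "hd Q \<in> set Q" "last Q \<in> set Q" "hd R \<in> set R" "last R \<in> set R"
    by auto
  have hl: "hd xs \<noteq> last xs" if "is_path V E xs" "length xs \<ge> 2" for xs
    using path_distinct[OF that(1)] that(2) by (cases xs) auto
  have *: "hd P \<noteq> last P" "hd Q \<noteq> last Q" "hd R \<noteq> last R" using hl p len by auto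
  have **: "hd P \<noteq> last Q" "hd P \<noteq> last R" "hd Q \<noteq> last P" "hd Q \<noteq> last R" "hd R \<noteq> last P" "hd R \<noteq> last Q"
    using m dis by auto
  have dis': "set Q \<inter> set P = {}" "set R \<inter> set P = {}" "set R \<inter> set Q = {}" using dis by auto
  have QP: "\<And>x y. x \<in> set Q \<Longrightarrow> y \<in> set P \<Longrightarrow> E x y \<longleftrightarrow> x = hd Q \<and> y = hd P \<or> x = last Q \<and> y = last P"
    using PQ edge_commute by metis
  have RP: "\<And>x y. x \<in> set R \<Longrightarrow> y \<in> set P \<Longrightarrow> E x y \<longleftrightarrow> x = hd R \<and> y = hd P \<or> x = last R \<and> y = last P"
    using PR edge_commute by metis
  have RQ: "\<And>x y. x \<in> set R \<Longrightarrow> y \<in> set Q \<Longrightarrow> E x y \<longleftrightarrow> x = hd R \<and> y = hd Q \<or> x = last R \<and> y = last Q"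
    using QR edge_commute by metis
  have "has_long_prism V E"
    unfolding has_long_prism_def
  proof (rule exI[of _ "\<lambda>i. hd (L i)"], rule exI[of _ "\<lambda>i. last (L i)"], rule exI[of _ L], intro conjI)
    show "\<forall>i<3. \<forall>j<3. i \<noteq> j \<longrightarrow> E (hd (L i)) (hd (L j)) \<and> E (last (L i)) (last (L j))"
      unfolding three L using m PQ PR QR QP RP RQ by simp
    show "(\<lambda>i. hd (L i)) ` {..<3} \<inter> (\<lambda>i. last (L i)) ` {..<3} = {}"
      unfolding three' using * ** by (auto simp: L)
    show "\<forall>i<3. is_path V E (L i) \<and> hd (L i) = hd (L i) \<and> last (L i) = last (L i)"
      unfolding three L using p by simp
    show "\<exists>i<3. 2 < length (L i)" using L(3) len by (intro exI[of _ 2]) simp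
    show "\<forall>i<3. \<forall>j<3. i \<noteq> j \<longrightarrow> set (L i) \<inter> set (L j) = {} \<and>
          (\<forall>u\<in>set (L i). \<forall>v\<in>set (L j). E u v \<longleftrightarrow>
             u = hd (L i) \<and> v = hd (L j) \<or> u = last (L i) \<and> v = last (L j))"
      unfolding three L using dis dis' PQ PR QR QP RP RQ by simp
  qed
  then show False using F11_unfold(4) by blast
qed

text \<open>With five or more vertices in total, the two antipaths would close up to an antihole
  longer than four. This bound either gives a contradiction at once or cuts an antipath of unknown
  length down to one or two vertices.\<close>

lemma antiring_length:
  assumes "is_path V (cE V E) ps" "is_path V (cE V E) qs" "set ps \<inter> set qs = {}"
    and cross: "\<And>x y. x \<in> set ps \<Longrightarrow> y \<in> set qs \<Longrightarrow>
       \<not> E x y \<longleftrightarrow> (x = last ps \<and> y = hd qs) \<or> (x = hd ps \<and> y = last qs)"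
  shows "length ps + length qs \<le> 4"
proof (rule ccontr)
  assume "\<not> ?thesis"
  moreover have "cE V E x y \<longleftrightarrow> (x = last ps \<and> y = hd qs) \<or> (x = hd ps \<and> y = last qs)"
    if "x \<in> set ps" "y \<in> set qs" for x y
    using cE_iff[of x y] cross[OF that] that assms(3) C.path_subset assms(1,2) by blast
  ultimately show False
    using C.hole_ring[OF assms(1,2,3)] antihole_length[of "ps @ qs"] by simp
qed

text \<open>Two successive neighbours of \<open>z\<close> along the path are adjacent or close an
  even hole with \<open>z\<close>, so every longer gap has an even number of edges. A path with an
  odd number of edges cannot consist of such gaps only; the induction strips off the first
  gap.\<close>

lemma neighbour_edge:
  assumes "is_path V E ps" "z \<in> V" "z \<notin> set ps" "E z (hd ps)" "E z (last ps)" "even (length ps)"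
  shows "\<exists>x\<in>set ps. \<exists>y\<in>set ps. E x y \<and> E z x \<and> E z y"
  using assms
proof (induction "length ps" arbitrary: ps rule: less_induct)
  case less
  obtain p rest where ps: "ps = p # rest" using less.prems(1) by (cases ps) auto
  then have ne: "rest \<noteq> []" using less.prems by auto
  then have "\<exists>q\<in>set rest. E z q" using less.prems ps by (intro bexI[of _ "last rest"]) auto
  from split_list_first_prop[OF this] obtain as q bs where
    r: "rest = as @ q # bs" "E z q" "\<forall>x\<in>set as. \<not> E z x" by blast
  have ps': "ps = p # as @ q # bs" using ps r by simp
  have zp: "E z p" using less.prems ps by simp
  show ?case
  proof (cases "as = []")
    case True
    then have "E p q" using less.prems(1) ps' by (simp add: path_Cons)
    then show ?thesis using ps' zp r by auto
  next
    case False
    have 1: "is_path V E (p # as @ [q])"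
      using path_sub[of "[]" "p # as @ [q]" bs] less.prems(1) ps' by simp
    have "z \<notin> set (p # as @ [q])" using less.prems ps' by auto
    moreover have "E z y \<longleftrightarrow> y = hd (p # as @ [q]) \<or> y = last (p # as @ [q])"
      if "y \<in> set (p # as @ [q])" for y using that zp r by auto
    ultimately have "is_hole V E (z # p # as @ [q])"
      using 1 less.prems False by (intro hole_cap) (auto simp: Suc_le_eq)
    then have "even (length as + 3)" using hole_even by fastforce
    then have "even (length (q # bs))" using less.prems ps' by auto
    moreover have "is_path V E (q # bs)"
      using path_sub[of "p # as" "q # bs" "[]"] less.prems(1) ps' by simp
    ultimately have "\<exists>x\<in>set (q # bs). \<exists>y\<in>set (q # bs). E x y \<and> E z x \<and> E z y"
      using less.prems ps' r by (intro less.hyps) auto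
    then show ?thesis using ps' by auto
  qed
qed

text \<open>\<open>u\<close> closes \<open>R\<close> to a hole, which is even. A spectator
  \<open>z\<close> of \<open>u\<close> and both ends sees the two hole edges at \<open>u\<close>, so
  the hole can only be a 4-cycle.\<close>

lemma capped_path:
  assumes R: "is_path V E R" "length R \<ge> 3" and u: "u \<in> V" "u \<notin> set R"
    and ux: "\<And>x. x \<in> set R \<Longrightarrow> E u x \<longleftrightarrow> x = hd R \<or> x = last R"
  shows "odd (length R)"
    and "z \<notin> set R \<Longrightarrow> E z u \<Longrightarrow> E z (hd R) \<Longrightarrow> E z (last R) \<Longrightarrow> length R = 3"
proof -
  have h: "is_hole V E (u # R)" using hole_cap[OF R(1) u ux R(2)] by blast
  then show odd: "odd (length R)" using hole_even by fastforce
  assume z: "z \<notin> set R" "E z u" "E z (hd R)" "E z (last R)"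
  show "length R = 3"
  proof (rule ccontr)
    assume "length R \<noteq> 3"
    then have "length R \<noteq> 4" "length R > 3" using odd R(2) by auto
    then have len: "length (u # R) \<ge> 6" by simp
    have "R \<noteq> []" using R by auto
    then have m: "hd R \<in> set R" "last R \<in> set R" by auto
    have "z \<noteq> u" using z by auto
    then have "{u, hd R} = {u, last R}"
      using hole_two_edges[OF h len, of z u "hd R" u "last R"] z m ux edge_in_V by auto
    moreover have "hd R \<noteq> last R" using path_distinct[OF R(1)] R(2) by (cases R) auto
    ultimately show False using m u by (auto simp: doubleton_eq_iff)
  qed
qed

text \<open>The edge between \<open>x\<close> and \<open>x'\<close> closes \<open>ps\<close> to an
  even hole, of length at least six once \<open>ps\<close> has three vertices. A vertex
  \<open>z\<close> seeing that edge may see no second one, and parity turns any further neighbour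
  into a second edge or an odd hole.\<close>

lemma edge_capped_path:
  assumes ps: "is_path V E ps" "length ps \<ge> 2" and x: "x \<notin> set ps" "x' \<notin> set ps" "E x x'"
    and xp: "\<And>p. p \<in> set ps \<Longrightarrow> E x p \<longleftrightarrow> p = hd ps" and xp': "\<And>p. p \<in> set ps \<Longrightarrow> E x' p \<longleftrightarrow> p = last ps"
  shows "even (length ps)"
    and "length ps \<ge> 3 \<Longrightarrow> z \<notin> set ps \<Longrightarrow> E z x \<Longrightarrow> E z x' \<Longrightarrow> p \<in> set ps \<Longrightarrow> \<not> E z p"
proof -
  have V: "x \<in> V" "x' \<in> V" using x edge_in_V by auto
  have ne: "ps \<noteq> []" using ps by auto
  have xne: "x \<noteq> x'" using x by auto
  have hl: "hd ps \<noteq> last ps" using path_distinct[OF ps(1)] ps(2) by (cases ps) auto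
  have "is_path V E [x', x]" using V x xne edge_commute by (auto simp: path_Cons)
  then have h: "is_hole V E ([x', x] @ ps)"
    using ps x xp xp' hl by (intro hole_ring) auto
  then show ev: "even (length ps)" using hole_even by fastforce
  assume len: "length ps \<ge> 3" and z: "z \<notin> set ps" "E z x" "E z x'" and p: "p \<in> set ps"
  have "length ps \<ge> 4" using len ev by (cases "length ps = 3") auto
  then have l6: "length ([x', x] @ ps) \<ge> 6" by simp
  have zV: "z \<in> V" and zne: "z \<noteq> x" "z \<noteq> x'" using z edge_in_V by auto
  have two: False if "a \<in> set ([x', x] @ ps)" "b \<in> set ([x', x] @ ps)" "E a b" "E z a" "E z b" "{a, b} \<noteq> {x, x'}" for a b
    using hole_two_edges[OF h l6 zV, of a b x x'] that z x zne by auto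
  show "\<not> E z p"
  proof
    assume "E z p"
    then have "\<exists>p\<in>set ps. E z p" using p by blast
    from split_list_last_prop[OF this] obtain as q bs where
      s: "ps = as @ q # bs" "E z q" "\<forall>x\<in>set bs. \<not> E z x" by blast
    have q: "q \<in> set ps" using s by auto
    show False
    \<comment> \<open>If \<open>as\<close> has even length, \<open>x # as @ [q]\<close> has an even
      number of vertices and contains an edge seen by \<open>z\<close>, different from the one at
      \<open>x'\<close>. Otherwise \<open>q # bs @ [x']\<close> has an even number of vertices and
      \<open>z\<close> closes it to an odd hole, unless \<open>bs\<close> is empty and
      \<open>q\<close>, \<open>x'\<close> form the second edge.\<close>
    proof (cases "odd (length as)")
      case False
      have "is_path V E (as @ [q])" using path_sub[of "[]" "as @ [q]" bs] ps(1) s by simp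
      then have "is_path V E (x # as @ [q])"
        using V x s xp by (cases as) (auto simp: path_Cons)
      moreover have "even (length (x # as @ [q]))" using False by simp
      ultimately obtain a b where ab: "a \<in> set (x # as @ [q])" "b \<in> set (x # as @ [q])" "E a b" "E z a" "E z b"
        using neighbour_edge[of "x # as @ [q]" z] zV z s zne by auto
      then have "x' \<noteq> a" "x' \<noteq> b" using x xne s by auto
      then show False using two[OF _ _ ab(3-5)] ab s by (auto simp: doubleton_eq_iff)
    next
      case odd: True
      then have ebs: "even (length bs)" using ev s by simp
      show False
      proof (cases "bs = []")
        case True
        then have "E x' q" using xp' s by simp
        then show False using two[of q x'] q z s x xne edge_commute by (auto simp: doubleton_eq_iff)
      next
        case False
        have qb: "is_path V E (q # bs)" using path_sub[of as "q # bs" "[]"] ps(1) s by simp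
        have "is_path V E ((q # bs) @ [x'])"
          using qb V x s xp' False edge_commute[of _ x'] by (subst path_append) (auto simp: path_Cons[of x'])
        moreover have "E z y \<longleftrightarrow> y = hd ((q # bs) @ [x']) \<or> y = last ((q # bs) @ [x'])"
          if "y \<in> set ((q # bs) @ [x'])" for y using that s z by auto
        ultimately have "odd (length ((q # bs) @ [x']))"
          using zV z s zne False by (intro capped_path(1)[of _ z]) (auto simp: Suc_le_eq)
        then show False using ebs by simp
      qed
    qed
  qed
qed

text \<open>The antipath is a shortest one between nonneighbours of \<open>a\<close> and of
  \<open>b\<close>. Hence \<open>a\<close> misses only its head and \<open>b\<close> only its last
  vertex, which is exactly the form in which antipaths are closed to antiholes.\<close>

lemma antipath_between:
  assumes Y: "anticonnected V E Y" "Y \<subseteq> V" and a: "\<not> Ycomplete E Y a" and b: "\<not> Ycomplete E Y b"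
  obtains qs where "is_path V (cE V E) qs" "set qs \<subseteq> Y"
    "\<And>y. y \<in> set qs \<Longrightarrow> \<not> E a y \<longleftrightarrow> y = hd qs" "\<And>y. y \<in> set qs \<Longrightarrow> \<not> E b y \<longleftrightarrow> y = last qs"
proof -
  obtain y y' where "y \<in> Y" "\<not> E a y" "y' \<in> Y" "\<not> E b y'" using a b by (auto simp: Ycomplete_def)
  then obtain qs where "is_path V (cE V E) qs" "set qs \<subseteq> Y" "\<not> E a (hd qs)" "\<not> E b (last qs)"
    "\<And>x. x \<in> set qs \<Longrightarrow> \<not> E a x \<Longrightarrow> x = hd qs" "\<And>x. x \<in> set qs \<Longrightarrow> \<not> E b x \<Longrightarrow> x = last qs"
    using C.connected_path[of Y y "{y. \<not> E a y}" y' "{y. \<not> E b y}"] Y anticonnected_iff by auto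
  then show thesis using that[of qs] by blast
qed

text \<open>The engine of all inductions over an anticonnected set \<open>W\<close>: otherwise \<open>f\<close>, \<open>p\<close>, an antipath
  of \<open>W\<close> ending in \<open>y\<close> and \<open>cs\<close> form an antihole of length at least five.\<close>
lemma complete_step:
  assumes W: "anticonnected V E W" "W \<subseteq> V" "y \<in> W"
    and f: "Ycomplete E (W - {y}) f" "\<not> E f y"
    and p: "E p y" "\<And>v. v \<in> W \<Longrightarrow> v \<noteq> y \<Longrightarrow> \<not> E v y \<Longrightarrow> E p v"
    and cs: "is_path V (cE V E) (f # cs @ [p])" "\<And>c. c \<in> set cs \<Longrightarrow> Ycomplete E W c"
    and dis: "set (f # cs @ [p]) \<inter> W = {}"
  shows "Ycomplete E W p"
proof (rule ccontr)
  assume n: "\<not> Ycomplete E W p"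
  have nf: "\<not> Ycomplete E W f" using f W by (auto simp: Ycomplete_def)
  obtain qs where qs: "is_path V (cE V E) qs" "set qs \<subseteq> W"
    "\<And>v. v \<in> set qs \<Longrightarrow> \<not> E p v \<longleftrightarrow> v = hd qs" "\<And>v. v \<in> set qs \<Longrightarrow> \<not> E f v \<longleftrightarrow> v = last qs"
    using antipath_between[OF W(1,2) n nf] by blast
  have ne: "qs \<noteq> []" using qs by auto
  \<comment> \<open>\<open>y\<close> is the only nonneighbour of \<open>f\<close> in
    \<open>W\<close>.\<close>
  have ly: "last qs = y" using last_in_set[OF ne] qs(2) qs(4)[of "last qs"] f by (auto simp: Ycomplete_def)
  have "length (f # cs @ [p]) + length qs \<le> 4"
    using cs qs dis C.path_distinct[OF cs(1)] hd_in_set[OF ne] last_in_set[OF ne]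
    by (intro antiring_length) (auto simp: Ycomplete_def)
  \<comment> \<open>\<open>f # cs @ [p]\<close> has at least two vertices, so at most two are left
    for \<open>qs\<close>. A single one would be \<open>y\<close>, which \<open>p\<close> sees; with
    two, the first would be a nonneighbour of \<open>y\<close> missed by \<open>p\<close>.\<close>
  then have l: "length qs \<le> 2" by simp
  have h: "\<not> E p (hd qs)" using qs(3)[of "hd qs"] ne by simp
  then have "hd qs \<noteq> last qs" using p ly by auto
  then obtain a where "qs = [a, y]" using l ne ly by (cases qs; cases "tl qs") auto
  then have "\<not> E a y" "a \<in> W" "a \<noteq> y" "\<not> E p a"
    using qs(1,2) h C.path_distinct[OF qs(1)] by (auto simp: C.path_Cons cE_def)
  then show False using p by blast
qed

lemma Ycomplete_insert: "y \<in> Y \<Longrightarrow> Ycomplete E (Y - {y}) v \<Longrightarrow> E v y \<Longrightarrow> Ycomplete E Y v"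
  by (auto simp: Ycomplete_def)

subsection \<open>Paths between complete vertices\<close>

text \<open>If the stretch from \<open>p\<close> to \<open>q\<close> did not fill the whole
  interior, one end \<open>c\<close> of the path would see nothing of it. With \<open>c\<close> as
  cap and \<open>z\<close> as spectator, detours become too short to exist, and
  \<open>complete_step\<close> would make \<open>q\<close> complete to \<open>Y\<close>.\<close>

lemma even_path_step:
  assumes Y: "anticonnected V E Y" "Y \<subseteq> V" "y \<in> Y"
    and path: "is_path V E (u # as @ p # bs @ q # cs @ [w])"
    and dis: "set (u # as @ p # bs @ q # cs @ [w]) \<inter> Y = {}"
    and uw: "Ycomplete E Y u" "Ycomplete E Y w"
    and z: "Ycomplete E Y z" "E z u" "E z w" "z \<notin> set (u # as @ p # bs @ q # cs @ [w])"
    and q: "\<not> Ycomplete E Y q"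
    and p: "Ycomplete E (Y - {y}) p" "\<not> E p y" and qy: "E q y" and bs: "\<And>b. b \<in> set bs \<Longrightarrow> \<not> E b y"
  shows "as = [] \<and> cs = []"
proof (rule ccontr)
  assume n: "\<not> ?thesis"
  let ?m = "p # bs @ [q]"
  have mid: "is_path V E ?m" using path_sub[of "u # as" ?m "cs @ [w]"] path by simp
  have d: "distinct (u # as @ ?m @ cs @ [w])" using path_distinct[OF path] by simp
  have inV: "set (u # as @ ?m @ cs @ [w]) \<subseteq> V" using path_subset[OF path] by simp
  have un: "\<not> E u x" if "x \<in> set ?m" "as \<noteq> []" for x
  proof -
    have "is_path V E (u # as @ ?m @ cs @ [w])" using path by simp
    then have "E u x \<longleftrightarrow> x = hd (as @ ?m @ cs @ [w])" using that by (simp only: path_Cons) auto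
    moreover have "x \<notin> set as" using d that(1) by auto
    then have "x \<noteq> hd as" "hd (as @ ?m @ cs @ [w]) = hd as" using that(2) by auto
    ultimately show ?thesis by simp
  qed
  have wn: "\<not> E w x" if "x \<in> set ?m" "cs \<noteq> []" for x
  proof -
    have "is_path V E ((u # as @ ?m) @ (cs @ [w]))" using path by simp
    then have c: "\<forall>x\<in>set (u # as @ ?m). \<forall>y\<in>set (cs @ [w]). E x y \<longleftrightarrow> x = last (u # as @ ?m) \<and> y = hd (cs @ [w])"
      by (subst (asm) path_append) simp_all
    have "w \<notin> set cs" using d by auto
    then have "w \<noteq> hd cs" "hd (cs @ [w]) = hd cs" using that(2) by auto
    then have "\<not> E x w" using c that(1) by auto
    then show ?thesis using edge_commute by blast
  qed
  obtain c where c: "c = u \<or> c = w" "\<And>x. x \<in> set ?m \<Longrightarrow> \<not> E c x" using un wn n by blast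
  have cY: "Ycomplete E Y c" "E z c" using c uw z by auto
  have cout: "c \<in> V" "c \<notin> set ?m" "c \<notin> Y" using c d inV dis by auto
  have zout: "z \<notin> set ?m" "z \<notin> Y" using z by (auto simp: Ycomplete_def)
  have mY: "set ?m \<inter> Y = {}" using dis by auto
  \<comment> \<open>Otherwise a detour from \<open>v\<close> to \<open>y\<close> along the stretch
    has at least four vertices, while its ends are seen by both \<open>c\<close> and
    \<open>z\<close> and its interior is missed by \<open>c\<close>.\<close>
  have vq: "E q v" if v: "v \<in> Y" "v \<noteq> y" "\<not> E v y" for v
  proof (rule ccontr)
    assume nq: "\<not> E q v"
    have pv: "E p v" using p v by (auto simp: Ycomplete_def)
    have out: "v \<in> V" "v \<notin> set ?m" "y \<in> V" "y \<notin> set ?m" using v Y mY by auto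
    have "\<And>x. x \<in> set (p # bs) \<Longrightarrow> \<not> E x y" using p(2) bs by auto
    with out obtain t es where tes: "set (t # es) \<subseteq> set (p # bs)" and "is_path V E (v # (t # es @ [q]) @ [y])"
      using path_detour[OF mid _ _ _ _ v(2,3) pv nq qy] by blast
    then have R: "is_path V E ((v # t # es @ [q]) @ [y])" by simp
    have sub: "set (t # es @ [q]) \<subseteq> set ?m" using tes by auto
    have "length ((v # t # es @ [q]) @ [y]) = 3"
    proof (rule capped_path(2)[OF R])
      show "3 \<le> length ((v # t # es @ [q]) @ [y])" by simp
      show "c \<in> V" by fact
      show "c \<notin> set ((v # t # es @ [q]) @ [y])" using cout sub v Y by auto
      show "E c x \<longleftrightarrow> x = hd ((v # t # es @ [q]) @ [y]) \<or> x = last ((v # t # es @ [q]) @ [y])"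
        if "x \<in> set ((v # t # es @ [q]) @ [y])" for x
      proof -
        have "E c v" "E c y" using cY v Y by (auto simp: Ycomplete_def)
        then show ?thesis using that c(2) sub by auto
      qed
      show "z \<notin> set ((v # t # es @ [q]) @ [y])" using zout sub v Y by auto
      show "E z c" by fact
    qed (use z(1) v Y in \<open>auto simp: Ycomplete_def\<close>)
    then show False by simp
  qed
  have pq: "p \<noteq> q" "p \<in> V" "q \<in> V" "c \<noteq> p" "c \<noteq> q" using d inV cout by auto
  \<comment> \<open>If \<open>p\<close> and \<open>q\<close> are adjacent, \<open>c\<close> links
    them in the complement, being a nonneighbour of both.\<close>
  have "is_path V (cE V E) (p # (if E p q then [c] else []) @ [q])"
    using pq c(2) cout edge_commute[of p c] by (auto simp: C.path_Cons cE_def)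
  moreover have "\<And>x. x \<in> set (if E p q then [c] else []) \<Longrightarrow> Ycomplete E Y x" using cY by (auto split: if_splits)
  moreover have "set (p # (if E p q then [c] else []) @ [q]) \<inter> Y = {}" using mY cout by auto
  ultimately have "Ycomplete E Y q"
    using complete_step[OF Y p qy vq] by blast
  then show False using q by blast
qed

text \<open>An antipath in \<open>Y\<close> leads from \<open>y1\<close> to \<open>y2\<close>, and
  together with the nonadjacent ends of \<open>ps\<close> it has at most four vertices; so
  \<open>y1\<close> and \<open>y2\<close> are nonadjacent. Then \<open>ps\<close>,
  \<open>u\<close>-\<open>y1\<close> and \<open>y2\<close>-\<open>w\<close> form a long prism with
  triangles \<open>{u, y2, hd ps}\<close> and \<open>{y1, w, last ps}\<close>.\<close>

lemma even_path_prism: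
  assumes Y: "anticonnected V E Y" "Y \<subseteq> V" "y1 \<in> Y" "y2 \<in> Y"
    and path: "is_path V E (u # ps @ [w])" "length ps \<ge> 3"
    and dis: "set (u # ps @ [w]) \<inter> Y = {}"
    and uw: "Ycomplete E Y u" "Ycomplete E Y w"
    and c: "Ycomplete E (Y - {y1}) (hd ps)" "Ycomplete E (Y - {y2}) (last ps)"
    and y1: "\<And>x. x \<in> set ps \<Longrightarrow> E x y1 \<longleftrightarrow> x = last ps"
    and y2: "\<And>x. x \<in> set ps \<Longrightarrow> E x y2 \<longleftrightarrow> x = hd ps"
  shows False
proof -
  have ne: "ps \<noteq> []" using path by auto
  have m: "hd ps \<in> set ps" "last ps \<in> set ps" using ne by auto
  have pi: "is_path V E ps" using path_sub[of "[u]" ps "[w]"] path ne by simp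
  have p1: "u \<in> V" "w \<in> V" "u \<notin> set ps" "w \<notin> set ps" "u \<noteq> w" "set ps \<subseteq> V" "\<not> E u w"
    using path_distinct[OF path(1)] path_subset[OF path(1)] path(1) m ne by (auto simp: path_Cons)
  have ue: "E u x \<longleftrightarrow> x = hd ps" if "x \<in> set ps" for x
    using path(1) that ne by (simp only: path_Cons) auto
  have we: "E x w \<longleftrightarrow> x = last ps" if "x \<in> set ps" for x
  proof -
    have "is_path V E ((u # ps) @ [w])" using path by simp
    then have "\<forall>x\<in>set (u # ps). \<forall>y\<in>set [w]. E x y \<longleftrightarrow> x = last (u # ps) \<and> y = hd [w]"
      by (subst (asm) path_append) simp_all
    then show ?thesis using that ne by simp
  qed
  have hl: "hd ps \<noteq> last ps" using path_distinct[OF pi] path(2) by (cases ps) auto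
  have ne12: "y1 \<noteq> y2" using y1[of "hd ps"] y2[of "hd ps"] hl m by auto
  have nhl: "\<not> E (hd ps) (last ps)"
  proof -
    obtain a rest where s: "ps = a # rest" using ne by (cases ps) auto
    then have r: "rest \<noteq> []" "last ps = last rest" using path(2) by auto
    have "hd rest \<noteq> last rest" using path_distinct[OF pi] s path(2) by (cases rest) auto
    then show ?thesis using pi s r by (auto simp: path_Cons)
  qed
  have nY: "\<not> Ycomplete E Y (hd ps)" "\<not> Ycomplete E Y (last ps)"
    using y1[OF m(1)] y2[OF m(2)] hl Y by (auto simp: Ycomplete_def)
  obtain qs where qs: "is_path V (cE V E) qs" "set qs \<subseteq> Y"
    "\<And>y. y \<in> set qs \<Longrightarrow> \<not> E (hd ps) y \<longleftrightarrow> y = hd qs" "\<And>y. y \<in> set qs \<Longrightarrow> \<not> E (last ps) y \<longleftrightarrow> y = last qs"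
    using antipath_between[OF Y(1,2) nY] by blast
  have qne: "qs \<noteq> []" using qs by auto
  have hq: "hd qs = y1" "last qs = y2"
    using hd_in_set[OF qne] last_in_set[OF qne] qs(2) qs(3)[of "hd qs"] qs(4)[of "last qs"] c
    by (auto simp: Ycomplete_def)
  have "is_path V (cE V E) [last ps, hd ps]"
    using nhl hl m p1 edge_commute by (auto simp: C.path_Cons cE_def)
  then have "length [last ps, hd ps] + length qs \<le> 4"
    using qs dis m hl by (intro antiring_length) auto
  then have "length qs \<le> 2" by simp
  then have "qs = [y1, y2]" using qne hq ne12 by (cases qs; cases "tl qs") auto
  then have n12: "\<not> E y1 y2" using qs(1) by (auto simp: C.path_Cons cE_def)
  have yV: "y1 \<in> V" "y2 \<in> V" using Y by auto
  have e: "E u y1" "E u y2" "E w y1" "E w y2" using uw Y by (auto simp: Ycomplete_def)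
  have dy: "y1 \<notin> set ps" "y2 \<notin> set ps" "u \<noteq> y1" "u \<noteq> y2" "w \<noteq> y1" "w \<noteq> y2" using dis Y by auto
  show False
  proof (rule no_long_prism[of "[u, y1]" "[y2, w]" ps])
    show "is_path V E [u, y1]" "is_path V E [y2, w]"
      using p1 yV dy e edge_commute by (auto simp: path_Cons)
    show "E x y \<longleftrightarrow> x = hd [u, y1] \<and> y = hd [y2, w] \<or> x = last [u, y1] \<and> y = last [y2, w]"
      if "x \<in> set [u, y1]" "y \<in> set [y2, w]" for x y
      using that e p1 n12 dy ne12 edge_commute by auto
    show "E x y \<longleftrightarrow> x = hd [u, y1] \<and> y = hd ps \<or> x = last [u, y1] \<and> y = last ps"
      if "x \<in> set [u, y1]" "y \<in> set ps" for x y
      using that ue y1[of y] dy edge_commute[of y1 y] by auto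
    show "E x y \<longleftrightarrow> x = hd [y2, w] \<and> y = hd ps \<or> x = last [y2, w] \<and> y = last ps"
      if "x \<in> set [y2, w]" "y \<in> set ps" for x y
      using that we[of y] y2[of y] dy edge_commute[of y2 y] edge_commute[of w y] by auto
  qed (use pi path(2) p1 dy ne12 in auto)
qed

text \<open>A variant of the Roussel--Rubio lemma: without the witness \<open>z\<close> the path could have any even length.\<close>
lemma path_between_complete:
  assumes "anticonnected V E Y" "Y \<subseteq> V" "Y \<noteq> {}"
    and path: "is_path V E (u # ps @ [w])" "ps \<noteq> []"
    and dis: "set (u # ps @ [w]) \<inter> Y = {}"
    and "Ycomplete E Y u" "Ycomplete E Y w"
    and "Ycomplete E Y z" "E z u" "E z w" "z \<notin> set (u # ps @ [w])"
    and "\<And>x. x \<in> set ps \<Longrightarrow> \<not> Ycomplete E Y x"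
  shows "length ps = 1"
  using assms(1-3,6-)
proof (induction "card Y" arbitrary: Y rule: less_induct)
  case less
  note Y = less.prems(1-3) and dis = less.prems(4) and uw = less.prems(5,6) and z = less.prems(7-10)
    and nc = less.prems(11)
  show ?case
  proof (rule ccontr)
    assume n1: "length ps \<noteq> 1"
    then have l2: "length ps \<ge> 2" using path(2) by (cases ps; cases "tl ps") auto
    have dst: "distinct (u # ps @ [w])" using path_distinct[OF path(1)] .
    have inV: "set (u # ps @ [w]) \<subseteq> V" using path_subset[OF path(1)] .
    have pathr: "is_path V E (w # rev ps @ [u])" using path_rev[of "u # ps @ [w]"] path(1) by simp
    have finY: "finite Y" using Y finite_V finite_subset by blast
    \<comment> \<open>Otherwise \<open>y\<close> caps the whole path, and the spectator
      \<open>z\<close> forces a single inner vertex.\<close>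
    have nb: "\<exists>x\<in>set ps. E x y" if y: "y \<in> Y" for y
    proof (rule ccontr)
      assume no: "\<not> ?thesis"
      have "E y x \<longleftrightarrow> x = hd (u # ps @ [w]) \<or> x = last (u # ps @ [w])" if "x \<in> set (u # ps @ [w])" for x
        using that no uw y edge_commute[of y x] by (auto simp: Ycomplete_def)
      moreover have "E z y" using z y by (simp add: Ycomplete_def)
      ultimately have "length (u # ps @ [w]) = 3"
        using capped_path(2)[OF path(1), of y z] z Y y dis l2 by auto
      then show False using n1 by simp
    qed
    show False
    proof (cases "length ps = 2")
      case True
      then obtain a b where i: "ps = [a, b]" by (cases ps; cases "tl ps") auto
      have nab: "\<not> Ycomplete E Y b" "\<not> Ycomplete E Y a" using nc i by auto
      obtain qs where qs: "is_path V (cE V E) qs" "set qs \<subseteq> Y"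
        "\<And>y. y \<in> set qs \<Longrightarrow> \<not> E b y \<longleftrightarrow> y = hd qs" "\<And>y. y \<in> set qs \<Longrightarrow> \<not> E a y \<longleftrightarrow> y = last qs"
        using antipath_between[OF Y(1,2) nab] by blast
      \<comment> \<open>A path on four vertices is an antipath in another order. Closed through
        \<open>Y\<close> it gives an antihole with at least five vertices.\<close>
      have "is_path V (cE V E) [a, w, u, b]"
        using path(1) i dst inV edge_commute[of w u] edge_commute[of w b] edge_commute[of u a] edge_commute[of w a]
          by (auto simp: path_Cons C.path_Cons cE_def)
      then have "length [a, w, u, b] + length qs \<le> 4"
        using qs dis uw i dst by (intro antiring_length) (auto simp: Ycomplete_def)
      then show False using qs(1) by auto
    next
      case False
      then have l3: "length ps \<ge> 3" using l2 by simp
      \<comment> \<open>The induction hypothesis, read backwards, gives an inner vertex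
        \<open>p\<close> complete to \<open>Y - {y}\<close>; it misses \<open>y\<close>. With the
        nearest neighbour \<open>q\<close> of \<open>y\<close> on one side,
        \<open>even_path_step\<close> forces \<open>p\<close> and \<open>q\<close> to be the two
        ends of \<open>ps\<close>, so \<open>y\<close> sees just one of them and nothing in
        between.\<close>
      have dich: "(Ycomplete E (Y - {y}) (hd ps) \<and> (\<forall>x\<in>set ps. E x y \<longleftrightarrow> x = last ps)) \<or>
          (Ycomplete E (Y - {y}) (last ps) \<and> (\<forall>x\<in>set ps. E x y \<longleftrightarrow> x = hd ps))"
        if y: "y \<in> Y" "anticonnected V E (Y - {y})" "Y - {y} \<noteq> {}" for y
      proof -
        have "card (Y - {y}) < card Y" using y finY by (meson card_Diff1_less)
        moreover have "set (u # ps @ [w]) \<inter> (Y - {y}) = {}" "Y - {y} \<subseteq> V" using dis Y by blast+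
        moreover have "Ycomplete E (Y - {y}) u" "Ycomplete E (Y - {y}) w" "Ycomplete E (Y - {y}) z"
          using uw z by (auto simp: Ycomplete_def)
        ultimately have "\<exists>p\<in>set ps. Ycomplete E (Y - {y}) p"
          using less.hyps[of "Y - {y}"] y n1 z by blast
        then obtain p where p: "p \<in> set ps" "Ycomplete E (Y - {y}) p" by blast
        have npy: "\<not> E p y" using nc[OF p(1)] Ycomplete_insert[OF y(1) p(2)] by blast
        obtain as ds where s: "ps = as @ p # ds" using p(1) by (meson split_list)
        obtain q0 where q0: "q0 \<in> set ps" "E q0 y" using nb y by blast
        have "q0 \<noteq> p" using q0 npy by auto
        then consider "q0 \<in> set ds" | "q0 \<in> set as" using q0 s by auto
        then show ?thesis
        proof cases
          case 1
          then have "\<exists>q\<in>set ds. E q y" using q0 by blast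
          from split_list_first_prop[OF this] obtain bs q cs where
            t: "ds = bs @ q # cs" "E q y" "\<forall>x\<in>set bs. \<not> E x y" by blast
          have i: "ps = as @ p # bs @ q # cs" using s t by simp
          have "as = [] \<and> cs = []"
            using even_path_step[of Y y u as p bs q cs w z] Y(1,2) y(1) path(1) dis uw z nc p(2) npy t i by auto
          then show ?thesis using i p(2) npy t by auto
        next
          case 2
          then have "\<exists>q\<in>set as. E q y" using q0 by blast
          from split_list_last_prop[OF this] obtain cs q bs where
            t: "as = cs @ q # bs" "E q y" "\<forall>x\<in>set bs. \<not> E x y" by blast
          have i: "rev ps = rev ds @ p # rev bs @ q # rev cs" using s t by simp
          have "set (w # rev ps @ [u]) = set (u # ps @ [w])" by auto
          then have "rev ds = [] \<and> rev cs = []"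
            using even_path_step[of Y y w "rev ds" p "rev bs" q "rev cs" u z] Y(1,2) y(1) pathr dis uw z nc p(2) npy t(2,3) i
              s t(1) by auto
          then show ?thesis using s t p(2) npy by auto
        qed
      qed
      obtain y0 where y0: "y0 \<in> Y" using Y by blast
      have "Y \<noteq> {y0}" using nb[OF y0] nc by (auto simp: Ycomplete_def)
      moreover have cY: "connected_set V (cE V E) Y" using Y anticonnected_iff by blast
      ultimately obtain y1 where y1: "y1 \<in> Y" "y1 \<noteq> y0" "connected_set V (cE V E) (Y - {y1})"
        using C.noncut_vertex[OF cY Y(2) y0] by blast
      obtain y2 where y2: "y2 \<in> Y" "y2 \<noteq> y1" "connected_set V (cE V E) (Y - {y2})"
        using C.noncut_vertex[OF cY Y(2) y1(1)] y0 y1 by blast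
      have a: "anticonnected V E (Y - {y1})" "anticonnected V E (Y - {y2})"
        using y1(3) y2(3) Y(2) anticonnected_iff[of "Y - {y1}"] anticonnected_iff[of "Y - {y2}"] by blast+
      have hli: "hd ps \<in> set ps" "last ps \<in> set ps" using path(2) by auto
      have com: "Ycomplete E Y x" if "Ycomplete E (Y - {y1}) x" "Ycomplete E (Y - {y2}) x" for x
        using that y2 by (auto simp: Ycomplete_def)
      have d1: "(Ycomplete E (Y - {y1}) (hd ps) \<and> (\<forall>x\<in>set ps. E x y1 \<longleftrightarrow> x = last ps)) \<or>
          (Ycomplete E (Y - {y1}) (last ps) \<and> (\<forall>x\<in>set ps. E x y1 \<longleftrightarrow> x = hd ps))"
        using dich[OF y1(1) a(1)] y2 by blast
      have d2: "(Ycomplete E (Y - {y2}) (hd ps) \<and> (\<forall>x\<in>set ps. E x y2 \<longleftrightarrow> x = last ps)) \<or>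
          (Ycomplete E (Y - {y2}) (last ps) \<and> (\<forall>x\<in>set ps. E x y2 \<longleftrightarrow> x = hd ps))"
        using dich[OF y2(1) a(2)] y1 y2 by blast
      \<comment> \<open>If \<open>y1\<close> and \<open>y2\<close> single out the same end of
        \<open>ps\<close>, that end is complete to \<open>Y\<close> by \<open>com\<close>; if they
        single out different ends, the prism appears.\<close>
      show False
        using d1 d2 com nc hli even_path_prism[OF Y(1,2) y1(1) y2(1) path(1) l3 dis uw]
          even_path_prism[OF Y(1,2) y2(1) y1(1) path(1) l3 dis uw] by metis
    qed
  qed
qed

text \<open>This is the step from many partial attachments to one full attachment. By induction some
  \<open>f\<close> in \<open>M\<close> is complete to \<open>X - {y}\<close>; if it misses
  \<open>y\<close>, the first neighbour \<open>q\<close> of \<open>y\<close> on a shortest path from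
  \<open>f\<close> inside \<open>M\<close> is complete to \<open>X\<close>. The set \<open>Y\<close>
  serves twice: its absence from the neighbourhoods in \<open>M\<close> bounds detours, and its
  antipaths link \<open>f\<close> to \<open>q\<close> in the complement.\<close>

lemma complete_vertex_exists:
  assumes Y: "anticonnected V E Y" "Y \<subseteq> V"
    and "anticonnected V E X" "X \<subseteq> V" "X \<noteq> {}" "\<And>x. x \<in> X \<Longrightarrow> Ycomplete E Y x"
    and z: "Ycomplete E Y z" "Ycomplete E X z"
    and M: "connected_set V E M" "M \<subseteq> V" and "M \<inter> X = {}" and MY: "M \<inter> Y = {}" and zM: "z \<notin> M"
    and nc: "\<And>m. m \<in> M \<Longrightarrow> \<not> Ycomplete E Y m"
    and "\<And>x. x \<in> X \<Longrightarrow> \<exists>m\<in>M. E x m"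
  shows "\<exists>m\<in>M. Ycomplete E X m"
  using assms(3-6) z(2) assms(11) assms(15)
proof (induction "card X" arbitrary: X rule: less_induct)
  case less
  note X = less.prems(1-3) and XY = less.prems(4) and zX = less.prems(5) and MX = less.prems(6) and nb = less.prems(7)
  obtain y0 where y0: "y0 \<in> X" using X by blast
  show ?case
  proof (cases "X = {y0}")
    case True
    then show ?thesis using nb[OF y0] edge_commute by (auto simp: Ycomplete_def)
  next
    case False
    have cX: "connected_set V (cE V E) X" using X anticonnected_iff by blast
    obtain y where y: "y \<in> X" "y \<noteq> y0" "connected_set V (cE V E) (X - {y})"
      using C.noncut_vertex[OF cX X(2) y0 False] by blast
    have "card (X - {y}) < card X"
      using y(1) X(2) finite_V by (meson card_Diff1_less finite_subset)
    moreover have "anticonnected V E (X - {y})"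
      using y(3) X(2) anticonnected_iff[of "X - {y}"] by blast
    moreover have "X - {y} \<subseteq> V" "X - {y} \<noteq> {}" "M \<inter> (X - {y}) = {}" using X y y0 MX by auto
    moreover have "Ycomplete E (X - {y}) z" using zX by (simp add: Ycomplete_def)
    ultimately have "\<exists>f\<in>M. Ycomplete E (X - {y}) f"
      using less.hyps[of "X - {y}"] XY nb by blast
    then obtain f where f: "f \<in> M" "Ycomplete E (X - {y}) f" by blast
    show ?thesis
    proof (cases "E f y")
      case True
      then show ?thesis using Ycomplete_insert[OF y(1) f(2)] f(1) by blast
    next
      case nfy: False
      obtain m where "m \<in> M" "E m y" using nb[OF y(1)] edge_sym by blast
      then obtain ps where ps: "is_path V E ps" "set ps \<subseteq> M" "hd ps = f" "E (last ps) y"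
        "\<And>x. x \<in> set ps \<Longrightarrow> E x y \<Longrightarrow> x = last ps"
        using connected_path[OF M f(1), of "{f}" m "{m. E m y}"] by auto
      obtain rest where r: "ps = f # rest" using ps(1,3) by (cases ps) auto
      have "rest \<noteq> []" using r ps(4) nfy by auto
      then obtain bs q where "rest = bs @ [q]" by (cases rest rule: rev_cases) auto
      then have s: "ps = f # bs @ [q]" using r by simp
      have qy: "E q y" using ps(4) s by simp
      have bs: "\<not> E x y" if "x \<in> set (f # bs)" for x
        using ps(5)[of x] that s path_distinct[OF ps(1)] by auto
      have inM: "set (f # bs @ [q]) \<subseteq> M" using ps(2) s by simp
      \<comment> \<open>A detour from \<open>v\<close> to \<open>y\<close> through \<open>M\<close>
        has two ends complete to \<open>Y\<close>, no inner vertex complete to \<open>Y\<close> and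
        the spectator \<open>z\<close>; so it would have one inner vertex, but it has at least
        two.\<close>
      have vq: "E q v" if v: "v \<in> X" "v \<noteq> y" "\<not> E v y" for v
      proof (rule ccontr)
        assume nq: "\<not> E q v"
        have mid: "is_path V E (f # bs @ [q])" using ps(1) s by simp
        have fv: "E f v" using f v by (auto simp: Ycomplete_def)
        have "v \<in> V" "y \<in> V" "v \<notin> set (f # bs @ [q])" "y \<notin> set (f # bs @ [q])"
          using v y X MX inM by auto
        then obtain t es where tes: "set (t # es) \<subseteq> set (f # bs)" and R: "is_path V E (v # (t # es @ [q]) @ [y])"
          using path_detour[OF mid, of v y] v nq qy fv bs by metis
        have sub: "set (t # es @ [q]) \<subseteq> M" using tes inM by auto
        have "Y \<noteq> {}" using nc f(1) by (auto simp: Ycomplete_def)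
        moreover have "x \<notin> Y" if "Ycomplete E Y x" for x using that by (auto simp: Ycomplete_def)
        then have "set (v # (t # es @ [q]) @ [y]) \<inter> Y = {}" using sub MY XY v(1) y(1) by auto
        moreover have "z \<noteq> v" "z \<noteq> y" "E z v" "E z y" using zX v y by (auto simp: Ycomplete_def)
        then have "z \<notin> set (v # (t # es @ [q]) @ [y])" using sub zM by auto
        ultimately have "length (t # es @ [q]) = 1"
          using path_between_complete[OF Y _ R] XY v(1) y(1) z(1) \<open>E z v\<close> \<open>E z y\<close> nc sub by blast
        then show False by simp
      qed
      have fq: "f \<in> V" "q \<in> V" "f \<noteq> q" "q \<in> M" "\<not> Ycomplete E Y f" "\<not> Ycomplete E Y q"
        using inM M nc qy nfy by auto
      \<comment> \<open>If \<open>f\<close> and \<open>q\<close> are adjacent, the link runs through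
        \<open>Y\<close>, all of whose vertices are complete to \<open>X\<close>.\<close>
      obtain cs where cs: "is_path V (cE V E) (f # cs @ [q])" "set cs \<subseteq> Y"
      proof (cases "E f q")
        case False
        then have "is_path V (cE V E) (f # [] @ [q])" using fq by (auto simp: C.path_Cons cE_def)
        then show thesis using that[of "[]"] by simp
      next
        case True
        obtain qs where qs: "is_path V (cE V E) qs" "set qs \<subseteq> Y"
          "\<And>y. y \<in> set qs \<Longrightarrow> \<not> E f y \<longleftrightarrow> y = hd qs" "\<And>y. y \<in> set qs \<Longrightarrow> \<not> E q y \<longleftrightarrow> y = last qs"
          using antipath_between[OF Y fq(5,6)] by blast
        have "f \<notin> set qs" "q \<notin> set qs" using qs(2) MY f(1) fq(4) by auto
        moreover have "cE V E f x \<longleftrightarrow> x = hd qs" "cE V E x q \<longleftrightarrow> x = last qs" if "x \<in> set qs" for x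
          using qs(2-4) that fq(1,2) Y(2) cE_iff edge_commute[of x q] calculation by (metis subsetD)+
        ultimately have "is_path V (cE V E) (f # qs @ [q])"
          using qs(1) fq True cE_iff by (intro C.path_close_ends) auto
        then show thesis using that qs(2) by blast
      qed
      have "Ycomplete E X c" if "c \<in> set cs" for c
        using XY cs(2) that edge_commute by (auto simp: Ycomplete_def)
      moreover have "set (f # cs @ [q]) \<inter> X = {}"
      proof -
        have "x \<notin> X" if "x \<in> set cs" for x using calculation[OF that] by (auto simp: Ycomplete_def)
        then show ?thesis using f(1) fq(4) MX by auto
      qed
      ultimately have "Ycomplete E X q"
        using complete_step[OF X(1,2) y(1) f(2) nfy qy vq cs(1)] by blast
      then show ?thesis using fq(4) by blast
    qed
  qed
qed

subsection \<open>Skew partitions\<close>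

text \<open>A skew partition with \<open>B\<close> as small as possible is balanced: every vertex of \<open>B\<close> with a
  nonneighbour in \<open>B\<close> then has a neighbour in each component of \<open>A\<close>, so that a second component
  closes the path or antipath in question.\<close>
lemma balanced_skew_partition_exists:
  assumes "skew_partition V E A0 B0"
  shows "\<exists>A B. balanced_skew_partition V E A B"
proof -
  obtain A B where sk: "skew_partition V E A B"
    and min: "\<And>A' B'. skew_partition V E A' B' \<Longrightarrow> card B \<le> card B'"
    using ex_has_least_nat[of "\<lambda>(A, B). skew_partition V E A B" "(A0, B0)" "\<lambda>(A, B). card B"] assms by auto
  have AB: "A \<union> B = V" "A \<inter> B = {}" "\<not> connected_set V E A" "\<not> connected_set V (cE V E) B" "A \<noteq> {}"
    using sk by (auto simp: skew_partition_def)
  have sub: "A \<subseteq> V" "B \<subseteq> V" using AB by auto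
  obtain S where S: "S \<subseteq> B" "S \<noteq> {}" "S \<noteq> B" "\<And>u v. u \<in> S \<Longrightarrow> v \<in> B - S \<Longrightarrow> \<not> cE V E u v"
    using AB(4) unfolding connected_set_def by blast
  then have Sc: "\<And>u v. u \<in> S \<Longrightarrow> v \<in> B - S \<Longrightarrow> E u v" using cE_iff sub by blast
  \<comment> \<open>\<open>S\<close> and \<open>B - S\<close> are complete to each other, so
    nonadjacent vertices lie on the same side, and any vertex of the other side sees both.\<close>
  have side: "\<exists>S'. x \<in> S' \<and> y \<in> S' \<and> S' \<subseteq> B \<and> S' \<noteq> B \<and> (\<forall>u\<in>S'. \<forall>v\<in>B - S'. E u v)"
    if "x \<in> B" "y \<in> B" "\<not> E x y" for x y
  proof (cases "x \<in> S")
    case True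
    then have "y \<in> S" using Sc that by blast
    then show ?thesis using True S(1,3) Sc by (intro exI[of _ S]) simp
  next
    case False
    then have "y \<notin> S" using Sc[of y x] that edge_sym by blast
    moreover have "B - S \<noteq> B" using S(1,2) by blast
    moreover have "E u v" if "u \<in> B - S" "v \<in> B - (B - S)" for u v using Sc[of v u] that edge_sym by blast
    ultimately show ?thesis using False that by (intro exI[of _ "B - S"]) simp
  qed
  \<comment> \<open>Otherwise \<open>x\<close> could move from \<open>B\<close> to \<open>A\<close>:
    \<open>D\<close> would remain cut off in \<open>insert x A\<close>, and \<open>B - {x}\<close>
    would still split, because \<open>y\<close> keeps the side of \<open>x\<close> nonempty. That
    contradicts the choice of \<open>B\<close>.\<close>
  have nbD: "\<exists>d\<in>D. E x d"
    if D: "D \<subseteq> A" "D \<noteq> {}" "D \<noteq> A" "\<And>x y. x \<in> D \<Longrightarrow> y \<in> A - D \<Longrightarrow> \<not> E x y"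
      and xy: "x \<in> B" "y \<in> B" "x \<noteq> y" "\<not> E x y" for D x y
  proof (rule ccontr)
    assume no: "\<not> ?thesis"
    obtain S' where S': "x \<in> S'" "y \<in> S'" "S' \<subseteq> B" "S' \<noteq> B" "\<forall>u\<in>S'. \<forall>v\<in>B - S'. E u v"
      using side[OF xy(1,2,4)] by blast
    have "\<not> connected_set V (cE V E) (B - {x})"
    proof
      assume "connected_set V (cE V E) (B - {x})"
      then have "\<exists>u\<in>S' - {x}. \<exists>v\<in>(B - {x}) - (S' - {x}). cE V E u v"
        using S' xy by (intro C.connected_setD) auto
      then show False using S'(5) by (auto simp: cE_def)
    qed
    moreover have "\<not> connected_set V E (insert x A)"
    proof
      assume "connected_set V E (insert x A)"
      then have "\<exists>u\<in>D. \<exists>v\<in>insert x A - D. E u v"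
        using D xy AB by (intro connected_setD) auto
      then show False using D(4) no edge_sym by blast
    qed
    ultimately have "skew_partition V E (insert x A) (B - {x})"
      using AB xy by (auto simp: skew_partition_def)
    then have "card B \<le> card (B - {x})" by (rule min)
    moreover have "card (B - {x}) < card B"
      using xy(1) sub finite_V by (meson card_Diff1_less finite_subset)
    ultimately show False by simp
  qed
  have no_path: False
    if p: "is_path V E ps" "odd (length ps - 1)" "hd ps \<in> B" "last ps \<in> B" "\<not> E (hd ps) (last ps)"
      "set (butlast (tl ps)) \<subseteq> A" for ps
  proof -
    obtain u rest where r: "ps = u # rest" using p(1) by (cases ps) auto
    have "rest \<noteq> []" using r p(2) by auto
    then obtain vs w where "rest = vs @ [w]" by (cases rest rule: rev_cases) auto
    then have s: "ps = u # vs @ [w]" using r by simp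
    have uw: "u \<in> B" "w \<in> B" "\<not> E u w" "set vs \<subseteq> A" using p s by auto
    have dst: "distinct (u # vs @ [w])" using path_distinct[OF p(1)] s by simp
    have ne: "vs \<noteq> []" using p(1) uw(3) s by (auto simp: path_Cons)
    have ev: "even (length ps)" using p(2) s by simp
    have "is_path V E vs" using path_sub[of "[u]" vs "[w]"] p(1) s ne by simp
    then have "connected_set V E (set vs)" by (rule path_connected)
    then obtain D where D: "D \<subseteq> A - set vs" "D \<noteq> {}" "D \<noteq> A" "connected_set V E D"
      "\<And>x y. x \<in> D \<Longrightarrow> y \<in> A - D \<Longrightarrow> \<not> E x y"
      using separated_component[OF AB(3) sub(1) _ uw(4)] by blast
    have DA: "D \<subseteq> A" "D \<subseteq> V" using D sub by auto
    have "u \<noteq> w" using dst by auto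
    then obtain d e where "d \<in> D" "E d u" "e \<in> D" "E e w"
      using nbD[OF DA(1) D(2,3,5) uw(1,2)] nbD[OF DA(1) D(2,3,5) uw(2,1)] uw(3) edge_sym by metis
    then obtain Q where Q: "is_path V E Q" "set Q \<subseteq> D" "E (hd Q) u" "E (last Q) w"
      "\<And>x. x \<in> set Q \<Longrightarrow> E x u \<Longrightarrow> x = hd Q" "\<And>x. x \<in> set Q \<Longrightarrow> E x w \<Longrightarrow> x = last Q"
      using connected_path[OF D(4) DA(2), of d "{x. E x u}" e "{x. E x w}"] by auto
    have qne: "Q \<noteq> []" using Q by auto
    have out: "u \<notin> set Q" "w \<notin> set Q" "set vs \<inter> set Q = {}" using Q(2) D(1) DA uw AB by auto
    have vsQ: "\<not> E x y" if "x \<in> set vs" "y \<in> set Q" for x y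
      using D(5)[of y x] that Q(2) D(1) uw(4) edge_sym by blast
    have uQ: "E u x \<longleftrightarrow> x = hd Q" if "x \<in> set Q" for x using Q(3,5) that edge_commute by blast
    have wQ: "E w x \<longleftrightarrow> x = last Q" if "x \<in> set Q" for x using Q(4,6) that edge_commute by blast
    have wQ': "E x w \<longleftrightarrow> x = last Q" if "x \<in> set Q" for x using wQ[OF that] edge_commute by blast
    have l: "hd Q \<in> set Q" "last Q \<in> set Q" using qne by auto
    have rQ: "is_path V E (rev Q)" using Q(1) path_rev by blast
    have dd: "set ps \<inter> set (rev Q) = {}" using s out by auto
    have cross: "E x y \<longleftrightarrow> (x = last ps \<and> y = hd (rev Q)) \<or> (x = hd ps \<and> y = last (rev Q))"
      if "x \<in> set ps" "y \<in> set (rev Q)" for x y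
      using that s vsQ uQ wQ dst qne by (auto simp: hd_rev last_rev)
    have "length ps \<ge> 3" using s ne by (cases vs) auto
    then have l4: "length ps \<ge> 4" using ev by (cases "length ps = 3") auto
    then have h: "is_hole V E (ps @ rev Q)" using hole_ring[OF p(1) rQ dd cross] by simp
    then have evQ: "even (length Q)" using hole_even[OF h] ev by simp
    then have "length Q \<ge> 2" using qne by (cases Q; cases "tl Q") auto
    then have l6: "length (ps @ rev Q) \<ge> 6" using l4 by simp
    \<comment> \<open>A spectator from the other side of \<open>B\<close>.\<close>
    obtain b where b: "b \<in> B" "E u b" "E w b" using side[OF uw(1-3)] by blast
    have bV: "b \<in> V" "b \<noteq> u" "b \<noteq> w" using b sub by auto
    have bout: "b \<notin> set ps" "b \<notin> set (u # Q @ [w])" using bV b(1) s uw(4) AB(2) Q(2) DA by auto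
    have be: "E b u" "E b w" using b edge_sym by auto
    obtain x y where xy: "x \<in> set ps" "y \<in> set ps" "E x y" "E b x" "E b y"
      using neighbour_edge[OF p(1) bV(1) bout(1)] be s ev by auto
    \<comment> \<open>Both routes from \<open>u\<close> to \<open>w\<close> have an even number of
      vertices, so \<open>b\<close> sees an edge of each. The routes share only \<open>u\<close> and
      \<open>w\<close>, which are nonadjacent, so these are two edges of the hole.\<close>
    have "is_path V E (u # Q @ [w])"
      using Q(1) uw sub out uQ wQ' \<open>u \<noteq> w\<close> by (intro path_close_ends) auto
    from neighbour_edge[OF this bV(1) bout(2)] obtain x' y' where
      xy': "x' \<in> set (u # Q @ [w])" "y' \<in> set (u # Q @ [w])" "E x' y'" "E b x'" "E b y'"
      using be evQ by auto
    have "set (u # Q @ [w]) \<subseteq> set (ps @ rev Q)" "set ps \<subseteq> set (ps @ rev Q)" using s by auto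
    then have mem: "x \<in> set (ps @ rev Q)" "y \<in> set (ps @ rev Q)" "x' \<in> set (ps @ rev Q)" "y' \<in> set (ps @ rev Q)"
      using xy(1,2) xy'(1,2) by blast+
    have bn: "b \<notin> set (ps @ rev Q)" using bout by simp
    have "{x, y} = {x', y'}"
      by (rule hole_two_edges[OF h l6 bV(1) bn mem(1,2) xy(3-5) mem(3,4) xy'(3-5)])
    then have "x \<in> set (u # Q @ [w])" "y \<in> set (u # Q @ [w])" using xy'(1,2) by (auto simp: doubleton_eq_iff)
    then have "x \<in> {u, w}" "y \<in> {u, w}" using xy(1,2) s out by auto
    then show False using xy(3) uw(3) edge_sym by auto
  qed
  have no_antipath: False
    if p: "is_path V (cE V E) ps" "odd (length ps - 1)" "hd ps \<in> A" "last ps \<in> A" "E (hd ps) (last ps)"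
      "set (butlast (tl ps)) \<subseteq> B" for ps
  proof -
    have ev: "even (length ps)" using p(1,2) by (cases ps) auto
    have inV: "set ps \<subseteq> V" using C.path_subset[OF p(1)] .
    consider a b where "ps = [a, b]" | a b c d where "ps = [a, b, c, d]"
      | a b c d rest where "ps = a # b # c # d # rest" "length rest \<ge> 2"
    proof -
      obtain a r1 where 1: "ps = a # r1" using p(1) by (cases ps) auto
      obtain b r2 where 2: "r1 = b # r2" using 1 ev by (cases r1) auto
      show thesis
      proof (cases r2)
        case Nil
        then show thesis using that(1) 1 2 by simp
      next
        case (Cons c r3)
        then obtain d r4 where 4: "r3 = d # r4" using 1 2 ev by (cases r3) auto
        show thesis
        proof (cases r4)
          case Nil
          then show thesis using that(2) 1 2 Cons 4 by simp
        next
          case (Cons e r5)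
          then have "r5 \<noteq> []" using 1 2 \<open>r2 = c # r3\<close> 4 ev by auto
          then show thesis using that(3) 1 2 \<open>r2 = c # r3\<close> 4 Cons by (simp add: Suc_le_eq)
        qed
      qed
    qed
    then show False
    proof cases
      case (1 a b)
      then show False using p(1,5) by (auto simp: C.path_Cons cE_def)
    next
      case (2 a b c d)
      \<comment> \<open>Reordered, an antipath on four vertices is a path with ends and interior
        exchanged: here the ends lie in \<open>B\<close> and the interior in \<open>A\<close>, so
        this case falls under \<open>no_path\<close>.\<close>
      then have "is_path V E [c, a, d, b]"
        using p(1) inV edge_commute[of a c] edge_commute[of b d] edge_commute[of b c] edge_commute[of d c] edge_commute[of a b]
        by (auto simp: C.path_Cons path_Cons cE_def)
      then show False using no_path[of "[c, a, d, b]"] p 2 edge_commute[of b c] by (auto simp: C.path_Cons cE_def)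
    next
      case (3 q0 q1 q2 q3 rest)
      have rne: "rest \<noteq> []" using 3 by auto
      let ?z = "last rest"
      have zr: "?z \<in> set rest" using rne by simp
      have zl: "last ps = ?z" "hd ps = q0" using 3 rne by auto
      have btl: "butlast (tl ps) = q1 # q2 # q3 # butlast rest" using 3 rne by simp
      have q0z: "q0 \<in> A" "?z \<in> A" "E q0 ?z" using p zl by auto
      have qB: "q2 \<in> B" "q3 \<in> B" using p(6) btl by auto
      have dst: "distinct ps" using C.path_distinct[OF p(1)] .
      have adj: "\<not> E q2 q3" "E q0 q2" "E q0 q3" "q2 \<noteq> q3"
        using p(1) 3 inV by (auto simp: C.path_Cons cE_def)
      have "?z \<noteq> hd rest"
        using 3 dst rne by (cases rest; cases "tl rest") auto
      then have zq: "E ?z q2" "E ?z q3"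
        using p(1) 3 inV zr edge_commute[of ?z q2] edge_commute[of ?z q3] by (auto simp: C.path_Cons cE_def)
      have "connected_set V E {q0, ?z}"
        using connected_insert[OF connected_singleton[of q0], of q0 ?z] q0z by (simp add: insert_commute)
      then obtain D where D: "D \<subseteq> A - {q0, ?z}" "D \<noteq> {}" "D \<noteq> A" "connected_set V E D"
        "\<And>x y. x \<in> D \<Longrightarrow> y \<in> A - D \<Longrightarrow> \<not> E x y"
        using separated_component[OF AB(3) sub(1), of "{q0, ?z}"] q0z by blast
      have DA: "D \<subseteq> A" "D \<subseteq> V" using D sub by auto
      obtain d e where "d \<in> D" "E d q2" "e \<in> D" "E e q3"
        using nbD[OF DA(1) D(2,3,5) qB] nbD[OF DA(1) D(2,3,5) qB(2,1)] adj edge_sym by metis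
      then obtain Q where Q: "is_path V E Q" "set Q \<subseteq> D" "E (hd Q) q2" "E (last Q) q3"
        "\<And>x. x \<in> set Q \<Longrightarrow> E x q2 \<Longrightarrow> x = hd Q" "\<And>x. x \<in> set Q \<Longrightarrow> E x q3 \<Longrightarrow> x = last Q"
        using connected_path[OF D(4) DA(2), of d "{x. E x q2}" e "{x. E x q3}"] by auto
      have qne: "Q \<noteq> []" using Q by auto
      have out: "q2 \<notin> set Q" "q3 \<notin> set Q" "q0 \<notin> set Q" "?z \<notin> set Q" using Q(2) D(1) qB AB by auto
      have nD: "\<not> E x q0" "\<not> E x ?z" if "x \<in> D" for x using D(5)[OF that] D(1) q0z by auto
      have e2: "E q2 x \<longleftrightarrow> x = hd Q" if "x \<in> set Q" for x using Q(3,5) that edge_commute by blast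
      have e3: "E x q3 \<longleftrightarrow> x = last Q" if "x \<in> set Q" for x using Q(4,6) that by blast
      have R: "is_path V E (q2 # Q @ [q3])"
        using Q(1) qB sub out e2 e3 adj by (intro path_close_ends) auto
      \<comment> \<open>\<open>q0\<close> caps the route through \<open>D\<close> and
        \<open>?z\<close> is the spectator, so a single vertex of \<open>D\<close> joins
        \<open>q2\<close> to \<open>q3\<close>.\<close>
      have "length (q2 # Q @ [q3]) = 3"
      proof (rule capped_path(2)[OF R])
        show "3 \<le> length (q2 # Q @ [q3])" using qne by (cases Q) auto
        show "q0 \<in> V" using q0z sub by auto
        show "q0 \<notin> set (q2 # Q @ [q3])" using out adj by auto
        show "E q0 x \<longleftrightarrow> x = hd (q2 # Q @ [q3]) \<or> x = last (q2 # Q @ [q3])" if "x \<in> set (q2 # Q @ [q3])" for x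
          using that adj nD Q(2) edge_commute[of q0 x] by auto
        show "?z \<notin> set (q2 # Q @ [q3])" using out zq by auto
        show "E ?z q0" using q0z edge_sym by blast
      qed (use zq in auto)
      then have "length Q = 1" by simp
      then obtain c where c: "Q = [c]" by (cases Q) auto
      have cD: "c \<in> D" "E c q2" "E c q3" using Q c by auto
      have cn: "\<not> E c q0" "\<not> E c ?z" using nD cD by auto
      have cps: "c \<notin> set ps"
      proof -
        have "set ps \<subseteq> {q0, ?z} \<union> B"
        proof -
          have "rest = butlast rest @ [?z]" using rne by simp
          then have "set rest \<subseteq> set (butlast rest) \<union> {?z}" by (metis Un_insert_right list.simps(15) set_append empty_set subset_refl)
          then show ?thesis using 3 btl p(6) by auto
        qed
        then show ?thesis using cD D(1) AB(2) by auto
      qed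
      have "\<exists>x\<in>set rest. \<not> E c x" using cn zr by blast
      from split_list_first_prop[OF this] obtain as s bs where
        r: "rest = as @ s # bs" "\<not> E c s" "\<forall>x\<in>set as. E c x" by blast
      \<comment> \<open>The stretch of the antipath around \<open>q2\<close> and \<open>q3\<close>
        between the nearest nonneighbours of \<open>c\<close> on either side: \<open>q1\<close> or
        else \<open>q0\<close> on the left, \<open>s\<close> on the right. As \<open>c\<close>
        misses exactly its ends, it closes an antihole with at least five vertices.\<close>
      define L where "L = (if E c q1 then [q0, q1] else [q1]) @ q2 # q3 # as @ [s]"
      have "is_path V (cE V E) L"
        using C.path_sub[of "[]" "[q0, q1] @ q2 # q3 # as @ [s]" bs]
          C.path_sub[of "[q0]" "[q1] @ q2 # q3 # as @ [s]" bs] p(1) 3 r unfolding L_def by auto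
      moreover have "set L \<subseteq> set ps" using 3 r by (auto simp: L_def)
      moreover have "cE V E c y \<longleftrightarrow> y = hd L \<or> y = last L" if y: "y \<in> set L" for y
      proof -
        have "y \<in> V" "c \<in> V" "c \<noteq> y" using calculation(2) y inV cD DA cps by auto
        then have "cE V E c y \<longleftrightarrow> \<not> E c y" using cE_iff by blast
        moreover have "distinct (q0 # q1 # q2 # q3 # as @ [s])" using dst 3 r by auto
        ultimately show ?thesis using y cD cn r by (auto simp: L_def split: if_splits)
      qed
      moreover have "length L \<ge> 4" by (simp add: L_def)
      ultimately have "is_hole V (cE V E) (c # L)"
        using cD DA cps by (intro C.hole_cap) auto
      then have "length (c # L) = 4" by (rule antihole_length)
      then show False using \<open>length L \<ge> 4\<close> by simp
    qed
  qed
  show ?thesis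
    using sk no_path no_antipath unfolding balanced_skew_partition_def by blast
qed

subsection \<open>Three sets complete to each other\<close>

text \<open>Three members of the maximal family and the set outside them; the last clause is what
  maximality leaves behind. The predicate is symmetric in the three sets, and connectivity of
  \<open>F\<close> is kept apart, so that the lemmas can be applied to any permutation.\<close>

definition triad :: "'a set \<Rightarrow> 'a set \<Rightarrow> 'a set \<Rightarrow> 'a set \<Rightarrow> bool" where
  "triad X Y W F \<longleftrightarrow> F \<subseteq> V \<and> (\<forall>A\<in>{X, Y, W}. A \<subseteq> V \<and> A \<noteq> {} \<and> anticonnected V E A \<and> A \<inter> F = {}) \<and>
     (\<forall>x\<in>X. \<forall>y\<in>Y. E x y) \<and> (\<forall>x\<in>X. \<forall>w\<in>W. E x w) \<and> (\<forall>y\<in>Y. \<forall>w\<in>W. E y w) \<and>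
     (\<forall>f\<in>F. \<not> (Ycomplete E X f \<and> Ycomplete E Y f) \<and> \<not> (Ycomplete E X f \<and> Ycomplete E W f) \<and>
        \<not> (Ycomplete E Y f \<and> Ycomplete E W f))"

lemma triad_swap:
  assumes "triad X Y W F"
  shows "triad Y X W F" "triad X W Y F"
  using assms edge_sym unfolding triad_def by auto

lemma triadD:
  assumes "triad X Y W F"
  shows "F \<subseteq> V" "X \<subseteq> V" "Y \<subseteq> V" "W \<subseteq> V" "X \<noteq> {}" "Y \<noteq> {}" "W \<noteq> {}"
    "anticonnected V E X" "anticonnected V E Y" "anticonnected V E W"
    "X \<inter> F = {}" "Y \<inter> F = {}" "W \<inter> F = {}"
    "\<And>x y. x \<in> X \<Longrightarrow> y \<in> Y \<Longrightarrow> E x y" "\<And>x w. x \<in> X \<Longrightarrow> w \<in> W \<Longrightarrow> E x w"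
    "\<And>y w. y \<in> Y \<Longrightarrow> w \<in> W \<Longrightarrow> E y w"
    "\<And>f. f \<in> F \<Longrightarrow> Ycomplete E X f \<Longrightarrow> \<not> Ycomplete E Y f" "\<And>f. f \<in> F \<Longrightarrow> Ycomplete E X f \<Longrightarrow> \<not> Ycomplete E W f"
    "\<And>f. f \<in> F \<Longrightarrow> Ycomplete E Y f \<Longrightarrow> \<not> Ycomplete E W f"
    "\<And>f. f \<in> F \<Longrightarrow> Ycomplete E Y f \<Longrightarrow> \<not> Ycomplete E X f" "\<And>f. f \<in> F \<Longrightarrow> Ycomplete E W f \<Longrightarrow> \<not> Ycomplete E X f"
    "\<And>f. f \<in> F \<Longrightarrow> Ycomplete E W f \<Longrightarrow> \<not> Ycomplete E Y f"
  using assms unfolding triad_def by auto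

text \<open>The contrapositive of \<open>complete_vertex_exists\<close>, with any vertex of
  \<open>W\<close> as spectator. It lets one vertex stand for the whole of \<open>X\<close>.\<close>

lemma triad_anticomplete:
  assumes T: "triad X Y W F" and M: "connected_set V E M" "M \<subseteq> F"
    and n: "\<And>m. m \<in> M \<Longrightarrow> \<not> Ycomplete E X m" "\<And>m. m \<in> M \<Longrightarrow> \<not> Ycomplete E Y m"
  obtains x where "x \<in> X" "\<And>m. m \<in> M \<Longrightarrow> \<not> E x m"
proof (rule ccontr)
  assume c: "\<not> thesis"
  note t = triadD[OF T]
  have nb: "\<exists>m\<in>M. E x m" if "x \<in> X" for x using that c \<open>\<And>x. x \<in> X \<Longrightarrow> (\<And>m. m \<in> M \<Longrightarrow> \<not> E x m) \<Longrightarrow> thesis\<close> by blast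
  obtain z where z: "z \<in> W" using t(7) by blast
  have "\<exists>m\<in>M. Ycomplete E X m"
  proof (rule complete_vertex_exists[OF t(9) t(3) t(8) t(2) t(5) _ _ _ M(1)])
    show "Ycomplete E Y x" if "x \<in> X" for x using t(14) that by (simp add: Ycomplete_def)
    show "Ycomplete E Y z" using t(16) z edge_sym by (simp add: Ycomplete_def)
    show "Ycomplete E X z" using t(15) z edge_sym by (simp add: Ycomplete_def)
    show "M \<subseteq> V" "M \<inter> X = {}" "M \<inter> Y = {}" "z \<notin> M" using M(2) t(1,11-13) z by auto
  qed (use n(2) nb in auto)
  then show False using n(1) by blast
qed

section \<open>Antiholes through several sets of a triad\<close>

lemma antipath_join:
  assumes s: "is_path V (cE V E) s" and t: "is_path V (cE V E) t"
    and st: "\<And>x y. x \<in> set s \<Longrightarrow> y \<in> set t \<Longrightarrow> E x y"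
    and b: "b \<in> V" "b \<notin> set s" "b \<notin> set t"
    and bs: "\<And>x. x \<in> set s \<Longrightarrow> \<not> E b x \<longleftrightarrow> x = last s"
    and bt: "\<And>x. x \<in> set t \<Longrightarrow> \<not> E b x \<longleftrightarrow> x = hd t"
  shows "is_path V (cE V E) (s @ b # t)"
proof -
  have ne: "s \<noteq> []" "t \<noteq> []" using s t by auto
  have V: "set s \<subseteq> V" "set t \<subseteq> V" using C.path_subset s t by auto
  have dis: "set s \<inter> set t = {}" using st by fastforce
  have 1: "cE V E b x \<longleftrightarrow> x = hd t" if "x \<in> set t" for x
    using that b V bt cE_iff by (metis subsetD)
  have 2: "cE V E x b \<longleftrightarrow> x = last s" if "x \<in> set s" for x
    using that b V bs cE_iff edge_commute by (metis subsetD)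
  have 3: "\<not> cE V E x y" if "x \<in> set s" "y \<in> set t" for x y using st[OF that] by (simp add: cE_def)
  have "is_path V (cE V E) (b # t)" using t b 1 by (simp add: C.path_Cons)
  moreover have "hd (b # t) \<notin> set t" using b by simp
  ultimately show ?thesis using s b ne dis 2 3 by (subst C.path_append) auto
qed

text \<open>Each of the three sets contains an antipath between the two triangle vertices that are
  not complete to it. In cyclic order \<open>a\<close>, \<open>r\<close>, \<open>b\<close>,
  \<open>s\<close>, \<open>c\<close>, \<open>u\<close> this is an antihole with at least six
  vertices.\<close>

lemma triad_triangle:
  assumes T: "triad X Y W F" and F: "a \<in> F" "b \<in> F" "c \<in> F"
    and Z: "Ycomplete E X a" "Ycomplete E Y b" "Ycomplete E W c" and e: "E a b" "E b c" "E a c"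
  shows False
proof -
  note t = triadD[OF T]
  have n: "\<not> Ycomplete E Y a" "\<not> Ycomplete E W a" "\<not> Ycomplete E X b" "\<not> Ycomplete E W b"
    "\<not> Ycomplete E X c" "\<not> Ycomplete E Y c"
    using t(17-22) F Z by blast+
  obtain r where r: "is_path V (cE V E) r" "set r \<subseteq> W"
    "\<And>y. y \<in> set r \<Longrightarrow> \<not> E a y \<longleftrightarrow> y = hd r" "\<And>y. y \<in> set r \<Longrightarrow> \<not> E b y \<longleftrightarrow> y = last r"
    using antipath_between[OF t(10) t(4) n(2) n(4)] by blast
  obtain s where s: "is_path V (cE V E) s" "set s \<subseteq> X"
    "\<And>y. y \<in> set s \<Longrightarrow> \<not> E b y \<longleftrightarrow> y = hd s" "\<And>y. y \<in> set s \<Longrightarrow> \<not> E c y \<longleftrightarrow> y = last s"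
    using antipath_between[OF t(8) t(2) n(3) n(5)] by blast
  obtain u where u: "is_path V (cE V E) u" "set u \<subseteq> Y"
    "\<And>y. y \<in> set u \<Longrightarrow> \<not> E c y \<longleftrightarrow> y = hd u" "\<And>y. y \<in> set u \<Longrightarrow> \<not> E a y \<longleftrightarrow> y = last u"
    using antipath_between[OF t(9) t(3) n(6) n(1)] by blast
  have ne: "r \<noteq> []" "s \<noteq> []" "u \<noteq> []" using r s u by auto
  have abc: "a \<in> V" "b \<in> V" "c \<in> V" "a \<noteq> b" "b \<noteq> c" "a \<noteq> c" using e edge_in_V by auto
  have notin: "a \<notin> X \<union> Y \<union> W" "b \<notin> X \<union> Y \<union> W" "c \<notin> X \<union> Y \<union> W" using t(11-13) F by auto
  have su: "E x y" if "x \<in> set s" "y \<in> set u" for x y using that s(2) u(2) t(14) by blast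
  have q: "is_path V (cE V E) (s @ c # u)"
    using antipath_join[OF s(1) u(1) su abc(3)] notin s u by blast
  have "cE V E a x \<longleftrightarrow> x = hd r" "cE V E x b \<longleftrightarrow> x = last r" if x: "x \<in> set r" for x
  proof -
    have "x \<in> V" "x \<noteq> a" "x \<noteq> b" using x r(2) t(4) notin by auto
    then show "cE V E a x \<longleftrightarrow> x = hd r" "cE V E x b \<longleftrightarrow> x = last r"
      using r(3,4)[OF x] cE_iff abc edge_commute[of x b] by auto
  qed
  then have p: "is_path V (cE V E) (a # r @ [b])"
    using r notin abc e(1) by (intro C.path_close_ends) (auto simp: cE_def)
  have XY: "x \<noteq> y" if "x \<in> X" "y \<in> Y" for x y using t(14)[OF that] by auto
  have XW: "x \<noteq> y" "E y x" if "x \<in> X" "y \<in> W" for x y using t(15)[OF that] edge_sym by auto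
  have YW: "x \<noteq> y" "E y x" if "x \<in> Y" "y \<in> W" for x y using t(16)[OF that] edge_sym by auto
  have "length (a # r @ [b]) + length (s @ c # u) \<le> 4"
  proof (rule antiring_length[OF p q])
    show "set (a # r @ [b]) \<inter> set (s @ c # u) = {}"
      using r(2) s(2) u(2) notin abc XW(1) YW(1) by fastforce
    show "\<not> E x y \<longleftrightarrow> x = last (a # r @ [b]) \<and> y = hd (s @ c # u) \<or> x = hd (a # r @ [b]) \<and> y = last (s @ c # u)"
      if x: "x \<in> set (a # r @ [b])" and y: "y \<in> set (s @ c # u)" for x y
    proof -
      have l: "hd (s @ c # u) = hd s" "last (s @ c # u) = last u" using ne by auto
      have m: "hd s \<in> X" "last u \<in> Y" using ne s u by auto
      have m': "last u \<notin> set s" "hd s \<notin> set u" using m XY s(2) u(2) by blast+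
      consider "x = a" | "x = b" | "x \<in> set r" using x by auto
      then show ?thesis
      proof cases
        case 1
        consider "y \<in> set s" | "y = c" | "y \<in> set u" using y by auto
        then show ?thesis
          using 1 l m m' abc e u(4) s(2) u(2) Z(1) notin XY by cases (auto simp: Ycomplete_def)
      next
        case 2
        consider "y \<in> set s" | "y = c" | "y \<in> set u" using y by auto
        then show ?thesis
          using 2 l m m' abc e s(3) s(2) u(2) Z(2) notin XY by cases (auto simp: Ycomplete_def)
      next
        case 3
        then have xW: "x \<in> W" "x \<noteq> a" "x \<noteq> b" using r(2) notin by auto
        consider "y \<in> set s" | "y = c" | "y \<in> set u" using y by auto
        then have "E x y"
          using xW Z(3) s(2) u(2) XW YW edge_sym by cases (auto simp: Ycomplete_def)
        then show ?thesis using xW by simp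
      qed
    qed
  qed
  then show False using ne by (cases r; cases s; cases u) auto
qed

text \<open>The nonadjacent pair \<open>c\<close>, \<open>a\<close> is closed through
  \<open>Y\<close>, \<open>b\<close> and \<open>X\<close> to an antihole with at least five
  vertices.\<close>

lemma triad_path3:
  assumes T: "triad X Y W F" and F: "a \<in> F" "b \<in> F" "c \<in> F"
    and Z: "Ycomplete E X a" "Ycomplete E W b" "Ycomplete E Y c" and e: "E a b" "E b c" "\<not> E a c" "a \<noteq> c"
  shows False
proof -
  note t = triadD[OF T]
  have n: "\<not> Ycomplete E Y a" "\<not> Ycomplete E Y b" "\<not> Ycomplete E X b" "\<not> Ycomplete E X c"
    using t(17-22) F Z by blast+
  obtain s where s: "is_path V (cE V E) s" "set s \<subseteq> Y"
    "\<And>y. y \<in> set s \<Longrightarrow> \<not> E a y \<longleftrightarrow> y = hd s" "\<And>y. y \<in> set s \<Longrightarrow> \<not> E b y \<longleftrightarrow> y = last s"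
    using antipath_between[OF t(9) t(3) n(1) n(2)] by blast
  obtain u where u: "is_path V (cE V E) u" "set u \<subseteq> X"
    "\<And>y. y \<in> set u \<Longrightarrow> \<not> E b y \<longleftrightarrow> y = hd u" "\<And>y. y \<in> set u \<Longrightarrow> \<not> E c y \<longleftrightarrow> y = last u"
    using antipath_between[OF t(8) t(2) n(3) n(4)] by blast
  have ne: "s \<noteq> []" "u \<noteq> []" using s u by auto
  have abc: "a \<in> V" "b \<in> V" "c \<in> V" "a \<noteq> b" "b \<noteq> c" using e edge_in_V by auto
  have notin: "a \<notin> X \<union> Y" "b \<notin> X \<union> Y" "c \<notin> X \<union> Y" using t(11-12) F by auto
  have su: "E x y" if "x \<in> set s" "y \<in> set u" for x y using that s(2) u(2) t(14) edge_sym by blast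
  have q: "is_path V (cE V E) (s @ b # u)"
    using antipath_join[OF s(1) u(1) su abc(2)] notin s u by blast
  have p: "is_path V (cE V E) [c, a]" using abc e edge_commute[of c a] by (auto simp: C.path_Cons cE_def)
  have XY: "x \<noteq> y" if "x \<in> X" "y \<in> Y" for x y using t(14)[OF that] by auto
  have "length [c, a] + length (s @ b # u) \<le> 4"
  proof (rule antiring_length[OF p q])
    show "set [c, a] \<inter> set (s @ b # u) = {}" using s(2) u(2) notin abc by auto
    show "\<not> E x y \<longleftrightarrow> x = last [c, a] \<and> y = hd (s @ b # u) \<or> x = hd [c, a] \<and> y = last (s @ b # u)"
      if x: "x \<in> set [c, a]" and y: "y \<in> set (s @ b # u)" for x y
    proof -
      have l: "hd (s @ b # u) = hd s" "last (s @ b # u) = last u" using ne by auto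
      have m: "hd s \<in> Y" "last u \<in> X" using ne s u by auto
      consider "y \<in> set s" | "y = b" | "y \<in> set u" using y by auto
      then show ?thesis
      proof cases
        case 1
        then have "y \<in> Y" using s(2) by blast
        then have "y \<noteq> last u" "E c y" using m XY Z(3) by (auto simp: Ycomplete_def)
        then show ?thesis using x l s(3)[OF 1] e by auto
      next
        case 2
        then have "y \<noteq> hd s" "y \<noteq> last u" "E c y" "E a y" using m notin e edge_sym by auto
        then show ?thesis using x l by auto
      next
        case 3
        then have "y \<in> X" using u(2) by blast
        then have "y \<noteq> hd s" "E a y" using m XY Z(1) by (auto simp: Ycomplete_def)
        then show ?thesis using x l u(4)[OF 3] e by auto
      qed
    qed
  qed
  then show False using ne by (cases s; cases u) auto
qed

text \<open>\<open>b\<close>, \<open>c\<close>, \<open>a\<close> is an antipath, so the antipath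
  inside \<open>X\<close> that closes it has just one vertex, missed by both \<open>a\<close> and
  \<open>b\<close>.\<close>

lemma common_nonneighbour:
  assumes X: "anticonnected V E X" "X \<subseteq> V" and n: "\<not> Ycomplete E X a" "\<not> Ycomplete E X b"
    and c: "Ycomplete E X c" "\<not> E c a" "\<not> E c b" "c \<noteq> a" "c \<noteq> b" "c \<in> V" and e: "E a b" and dis: "a \<notin> X" "b \<notin> X"
  obtains x where "x \<in> X" "\<not> E x a" "\<not> E x b"
proof -
  obtain s where s: "is_path V (cE V E) s" "set s \<subseteq> X"
    "\<And>y. y \<in> set s \<Longrightarrow> \<not> E a y \<longleftrightarrow> y = hd s" "\<And>y. y \<in> set s \<Longrightarrow> \<not> E b y \<longleftrightarrow> y = last s"
    using antipath_between[OF X n] by blast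
  have ne: "s \<noteq> []" using s by auto
  have ab: "a \<noteq> b" "a \<in> V" "b \<in> V" using e edge_in_V by auto
  have "c \<notin> X" using c by (auto simp: Ycomplete_def)
  have "is_path V (cE V E) [b, c, a]"
    using c ab e edge_commute[of b c] edge_commute[of b a] by (auto simp: C.path_Cons cE_def)
  then have "length [b, c, a] + length s \<le> 4"
    using s c ab dis \<open>c \<notin> X\<close> by (intro antiring_length) (auto simp: Ycomplete_def)
  then obtain x where "s = [x]" using ne by (cases s) auto
  then show thesis using that[of x] s(2-4) edge_commute[of x a] edge_commute[of x b] by auto
qed

text \<open>The tail from the last neighbour \<open>e\<close> of \<open>x\<close> is to be closed by
  an edge at \<open>x\<close> and tested with a spectator in \<open>W\<close>. For this it needs
  three vertices, one of them complete to \<open>W\<close>. So \<open>x\<close> is chosen to miss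
  everything behind the last such vertex \<open>p\<close>, and \<open>p\<close> itself if only one
  vertex follows.\<close>

lemma triad_attachment:
  assumes T: "triad X Y W F" and P: "is_path V E P" "set P \<subseteq> F" "length P \<ge> 4"
    and ZX: "\<And>p. p \<in> set P \<Longrightarrow> Ycomplete E X p \<longleftrightarrow> p = hd P" and ZY: "Ycomplete E Y (last P)"
    and ZW: "\<exists>p\<in>set P. Ycomplete E W p"
  obtains x as e bs where "x \<in> X" "P = as @ e # bs" "E x e" "\<And>p. p \<in> set bs \<Longrightarrow> \<not> E x p"
    "length bs \<ge> 2" "\<exists>p\<in>set (e # bs). Ycomplete E W p"
proof -
  note t = triadD[OF T]
  from split_list_last_prop[OF ZW] obtain cs p ds where
    s: "P = cs @ p # ds" "Ycomplete E W p" "\<forall>x\<in>set ds. \<not> Ycomplete E W x" by blast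
  have dst: "distinct P" using path_distinct[OF P(1)] .
  have hF: "hd P \<in> F" "last P \<in> F" "p \<in> F" using P s by (auto simp: hd_append)
  have hdP: "hd P \<in> set P" using P by (cases P) auto
  have ZXh: "Ycomplete E X (hd P)" using ZX hdP by blast
  have "p \<noteq> hd P" using s(2) t(21) hF(3) ZXh by auto
  then have cs: "cs \<noteq> []" using s by auto
  have ds: "ds \<noteq> []" using s ZY t(19) hF by auto
  have hcs: "hd P = hd cs" "hd cs \<in> set cs" using s cs by auto
  have xh: "E x (hd P)" if "x \<in> X" for x using ZXh that edge_sym by (auto simp: Ycomplete_def)
  show thesis
  proof (cases "length ds \<ge> 2")
    case True
    have "is_path V E ds" using path_sub[of "cs @ [p]" ds "[]"] P(1) s(1) ds by simp
    then have "connected_set V E (set ds)" by (rule path_connected)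
    moreover have "set ds \<subseteq> F" "\<And>m. m \<in> set ds \<Longrightarrow> \<not> Ycomplete E X m" "\<And>m. m \<in> set ds \<Longrightarrow> \<not> Ycomplete E W m"
    proof -
      have "hd cs \<notin> set ds" using dst s(1) hcs by auto
      then show "set ds \<subseteq> F" "\<And>m. m \<in> set ds \<Longrightarrow> \<not> Ycomplete E X m" "\<And>m. m \<in> set ds \<Longrightarrow> \<not> Ycomplete E W m"
        using P(2) s ZX hcs by auto
    qed
    ultimately obtain x where x: "x \<in> X" "\<And>m. m \<in> set ds \<Longrightarrow> \<not> E x m"
      using triad_anticomplete[OF triad_swap(2)[OF T]] by metis
    have "\<exists>e\<in>set (cs @ [p]). E x e" using xh[OF x(1)] hcs by auto
    from split_list_last_prop[OF this] obtain as e v where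
      r: "cs @ [p] = as @ e # v" "E x e" "\<forall>q\<in>set v. \<not> E x q" by blast
    have "P = as @ e # (v @ ds)" using s(1) r(1) by (metis append_Cons append_assoc append_Nil)
    moreover have "p \<in> set (e # v)"
    proof -
      have "last (cs @ [p]) = last (as @ e # v)" using r(1) by simp
      then have "p = last (e # v)" by simp
      then show ?thesis using last_in_set[of "e # v"] by auto
    qed
    ultimately show thesis using that[of x as e "v @ ds"] x r True s(2) by auto
  next
    case False
    then obtain m where m: "ds = [m]" using ds by (cases ds; cases "tl ds") auto
    have mF: "m \<in> F" "m = last P" using s m P(2) by auto
    obtain c0 cs' where c0: "cs = c0 # cs'" using cs by (cases cs) auto
    have c0h: "c0 = hd P" using hcs c0 by simp
    have "cs' \<noteq> []" using P(3) s m c0 by auto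
    have pc: "is_path V E (c0 # cs' @ [p, m])" using P(1) s m c0 by simp
    have far: "\<not> E c0 p" "\<not> E c0 m" "c0 \<noteq> p" "c0 \<noteq> m"
    proof -
      have "\<forall>y\<in>set (cs' @ [p, m]). E c0 y \<longleftrightarrow> y = hd cs'" "c0 \<notin> set (cs' @ [p, m])"
        using pc \<open>cs' \<noteq> []\<close> by (auto simp: path_Cons[of c0])
      moreover have "hd cs' \<in> set cs'" "p \<notin> set cs'" "m \<notin> set cs'"
        using \<open>cs' \<noteq> []\<close> path_distinct[OF pc] by auto
      ultimately show "\<not> E c0 p" "\<not> E c0 m" "c0 \<noteq> p" "c0 \<noteq> m" by auto
    qed
    have pm: "E p m" using path_sub[of cs "[p, m]" "[]"] P(1) s m by (simp add: path_Cons)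
    have nc: "\<not> Ycomplete E X p" "\<not> Ycomplete E X m"
      using s(2) t(21) hF(3) mF ZY t(20) by auto
    have out: "p \<notin> X" "m \<notin> X" "c0 \<in> V" using hF mF t(11) t(1) c0h by auto
    have Zc0: "Ycomplete E X c0" using ZXh c0h by simp
    \<comment> \<open>Missing \<open>m\<close> alone would leave too short a tail. Since
      \<open>x\<close> misses both, \<open>e\<close> precedes \<open>p\<close> and the tail contains
      \<open>p\<close> and \<open>m\<close> behind \<open>e\<close>.\<close>
    obtain x where x: "x \<in> X" "\<not> E x p" "\<not> E x m"
      using common_nonneighbour[OF t(8) t(2) nc Zc0 far out(3) pm out(1,2)] by blast
    have "\<exists>e\<in>set cs. E x e" using xh[OF x(1)] hcs by auto
    from split_list_last_prop[OF this] obtain as e v where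
      r: "cs = as @ e # v" "E x e" "\<forall>q\<in>set v. \<not> E x q" by blast
    show thesis using that[of x as e "v @ [p, m]"] x r s m by auto
  qed
qed

text \<open>A tail of \<open>P\<close> and an edge between vertices of \<open>X\<close> and
  \<open>Y\<close> form a hole of length at least six. A vertex of \<open>W\<close> sees that edge
  and also a vertex of the tail complete to \<open>W\<close>, against
  \<open>edge_capped_path\<close>. A path on three vertices is the case of
  \<open>triad_path3\<close>.\<close>

lemma triad_no_path_aux:
  assumes T: "triad X Y W F" and P: "is_path V E P" "set P \<subseteq> F"
    and ZX: "\<And>p. p \<in> set P \<Longrightarrow> Ycomplete E X p \<longleftrightarrow> p = hd P"
    and ZY: "\<And>p. p \<in> set P \<Longrightarrow> Ycomplete E Y p \<longleftrightarrow> p = last P"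
    and ZW: "\<exists>p\<in>set P. Ycomplete E W p"
  shows False
proof -
  note t = triadD[OF T]
  have ne: "P \<noteq> []" using P by auto
  have hl: "hd P \<in> set P" "last P \<in> set P" using ne by auto
  have Zhl: "Ycomplete E X (hd P)" "Ycomplete E Y (last P)" using ZX ZY hl by auto
  obtain w where w: "w \<in> set P" "Ycomplete E W w" using ZW by blast
  have wne: "w \<noteq> hd P" "w \<noteq> last P" "hd P \<noteq> last P"
  proof -
    have "w \<in> F" "hd P \<in> F" using w(1) hl P(2) by auto
    then have "\<not> Ycomplete E X w" "\<not> Ycomplete E Y w" "\<not> Ycomplete E Y (hd P)"
      using t(21,22)[of w] t(17)[of "hd P"] w(2) Zhl by blast+
    then show "w \<noteq> hd P" "w \<noteq> last P" "hd P \<noteq> last P" using Zhl by auto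
  qed
  obtain p rest where "P = p # rest" using ne by (cases P) auto
  moreover have "rest \<noteq> []" using calculation wne by auto
  then obtain ms q where "rest = ms @ [q]" by (cases rest rule: rev_cases) auto
  ultimately have s: "P = p # ms @ [q]" by simp
  have wm: "w \<in> set ms" using w(1) wne s by auto
  then have msne: "ms \<noteq> []" by auto
  show False
  proof (cases "length P \<ge> 4")
    case False
    then have "length ms = 1" using s msne by (cases ms; cases "tl ms") auto
    then have ms: "ms = [w]" using wm by (cases ms) auto
    have "E p w" "E w q" "\<not> E p q" "p \<noteq> q" using P(1) s ms by (auto simp: path_Cons)
    then show False using triad_path3[OF T, of p w q] w(2) Zhl s ms P(2) by auto
  next
    case True
    have pm: "is_path V E ms" using path_sub[of "[p]" ms "[q]"] P(1) s msne by simp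
    have dst: "distinct P" using path_distinct[OF P(1)] .
    have mm: "set ms \<subseteq> F" "\<And>m. m \<in> set ms \<Longrightarrow> \<not> Ycomplete E Y m" "\<And>m. m \<in> set ms \<Longrightarrow> \<not> Ycomplete E X m"
      using ZX ZY s P(2) dst by auto
    obtain y where y: "y \<in> Y" "\<And>m. m \<in> set ms \<Longrightarrow> \<not> E y m"
      using triad_anticomplete[OF triad_swap(1)[OF T] path_connected[OF pm] mm] by metis
    have yq: "E y q" using Zhl y s edge_sym by (auto simp: Ycomplete_def)
    obtain z where z: "z \<in> W" using t(7) by blast
    obtain x as e bs where x: "x \<in> X" "P = as @ e # bs" "E x e" "\<And>p. p \<in> set bs \<Longrightarrow> \<not> E x p"
      "length bs \<ge> 2" "\<exists>p\<in>set (e # bs). Ycomplete E W p"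
      using triad_attachment[OF T P True ZX Zhl(2) ZW] by blast
    have pe: "is_path V E (e # bs)" using path_sub[of as "e # bs" "[]"] P(1) x(2) by simp
    have notin: "x \<notin> set P" "y \<notin> set P" "z \<notin> set P" using P(2) t(11-13) x(1) y(1) z by auto
    have exy: "E x y" "E z x" "E z y" using x(1) y(1) z t(14-16) edge_sym by auto
    show False
    \<comment> \<open>\<open>y\<close> misses the interior of \<open>P\<close>, so a second
      neighbour besides \<open>q\<close> can only be \<open>p\<close>, and it disturbs only if the
      tail is all of \<open>P\<close>.\<close>
    proof (cases "as = [] \<and> E y p")
      case False
      have "last (e # bs) = q" using x(2,5) s by (metis last_append last_snoc list.distinct(1) append_Cons)
      have "E x r \<longleftrightarrow> r = hd (e # bs)" if "r \<in> set (e # bs)" for r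
        using that x(3,4) path_distinct[OF pe] by auto
      moreover have "E y r \<longleftrightarrow> r = last (e # bs)" if "r \<in> set (e # bs)" for r
      proof (cases "r = q")
        case True
        then show ?thesis using yq \<open>last (e # bs) = q\<close> by simp
      next
        case rq: False
        have "r = p \<Longrightarrow> as = []"
        proof -
          assume "r = p"
          have "hd P = p" using s by simp
          then show "as = []" using x(2) \<open>r = p\<close> that dst by (cases as) auto
        qed
        moreover have "r \<in> set P" using that x(2) by auto
        ultimately have "\<not> E y r" using rq s y(2) False by auto
        then show ?thesis using rq \<open>last (e # bs) = q\<close> by simp
      qed
      moreover have "x \<notin> set (e # bs)" "y \<notin> set (e # bs)" "z \<notin> set (e # bs)" using notin x(2) by auto
      moreover obtain v where v: "v \<in> set (e # bs)" "Ycomplete E W v" using x(6) by blast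
      ultimately have "\<not> E z v"
        using edge_capped_path(2)[OF pe, of x y z v] x(5) exy by auto
      then show False using v z edge_sym by (auto simp: Ycomplete_def)
    next
      case True
      \<comment> \<open>Now \<open>x\<close> sees nothing of \<open>P\<close> but \<open>p\<close>.
        The argument is repeated from the other end: \<open>x\<close> stays fixed at
        \<open>p\<close>, and a new vertex of \<open>Y\<close> is attached to the reversed
        path.\<close>
      then have xp: "E x r \<longleftrightarrow> r = p" if "r \<in> set P" for r using that x s dst by auto
      have rP: "is_path V E (rev P)" "set (rev P) \<subseteq> F" "length (rev P) \<ge> 4"
        using P path_rev \<open>length P \<ge> 4\<close> by auto
      have hr: "hd (rev P) = last P" "last (rev P) = hd P" using ne by (auto simp: hd_rev last_rev)
      have ZY': "Ycomplete E Y r \<longleftrightarrow> r = hd (rev P)" if "r \<in> set (rev P)" for r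
        using that ZY hr by auto
      have c: "Ycomplete E X (last (rev P))" "\<exists>p\<in>set (rev P). Ycomplete E W p" using Zhl(1) hr ZW by auto
      obtain y' as' g bs' where y': "y' \<in> Y" "rev P = as' @ g # bs'" "E y' g" "\<And>p. p \<in> set bs' \<Longrightarrow> \<not> E y' p"
        "length bs' \<ge> 2" "\<exists>p\<in>set (g # bs'). Ycomplete E W p"
        using triad_attachment[OF triad_swap(1)[OF T] rP ZY' c] by blast
      have pg: "is_path V E (g # bs')" using path_sub[of as' "g # bs'" "[]"] rP(1) y'(2) by simp
      have sub: "set (g # bs') \<subseteq> set P" using y'(2) by (metis Un_upper2 set_append set_rev)
      have "last (g # bs') = p" using y'(2) hr(2) s by (metis last_appendR list.distinct(1) list.sel(1))
      then have "E x r \<longleftrightarrow> r = last (g # bs')" if "r \<in> set (g # bs')" for r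
        using xp sub that by blast
      moreover have "E y' r \<longleftrightarrow> r = hd (g # bs')" if "r \<in> set (g # bs')" for r
        using that y'(3,4) path_distinct[OF pg] by auto
      moreover have "y' \<notin> set P" "E y' x" "E z y'" using P(2) t(12) y'(1) x(1) z t(14,16) edge_sym by auto
      moreover obtain v where v: "v \<in> set (g # bs')" "Ycomplete E W v" using y'(6) by blast
      moreover have "x \<notin> set (g # bs')" "y' \<notin> set (g # bs')" "z \<notin> set (g # bs')"
        using notin sub calculation(3) by auto
      ultimately have "\<not> E z v"
        using edge_capped_path(2)[OF pg, of y' x z v] y'(5) exy by auto
      then show False using v z edge_sym by (auto simp: Ycomplete_def)
    qed
  qed
qed

text \<open>In a shortest such path each end is the only vertex complete to some set, as otherwise
  that end could be dropped. The two sets differ, and a permutation of the triad gives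
  \<open>triad_no_path_aux\<close>.\<close>

lemma triad_no_path:
  assumes "triad X Y W F" "is_path V E P" "set P \<subseteq> F"
    and "\<exists>p\<in>set P. Ycomplete E X p" "\<exists>p\<in>set P. Ycomplete E Y p" "\<exists>p\<in>set P. Ycomplete E W p"
  shows False
  using assms(2-)
proof (induction "length P" arbitrary: P rule: less_induct)
  case less
  note T = assms(1) and P = less.prems(1,2) and Z = less.prems(3-5)
  note t = triadD[OF T]
  obtain p rest where pr: "P = p # rest" using P by (cases P) auto
  have "rest \<noteq> []"
    using Z pr t(17) P(2) by auto
  then obtain ms q where "rest = ms @ [q]" by (cases rest rule: rev_cases) auto
  then have s: "P = p # ms @ [q]" using pr by simp
  have sub: "is_path V E (ms @ [q])" "is_path V E (p # ms)"
    using path_sub[of "[p]" "ms @ [q]" "[]"] path_sub[of "[]" "p # ms" "[q]"] P(1) s by simp_all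
  have first: "\<exists>A\<in>{X, Y, W}. \<forall>r\<in>set (ms @ [q]). \<not> Ycomplete E A r"
  proof (rule ccontr)
    assume "\<not> ?thesis"
    then show False using less.hyps[OF _ sub(1)] P(2) s by auto
  qed
  have second: "\<exists>A\<in>{X, Y, W}. \<forall>r\<in>set (p # ms). \<not> Ycomplete E A r"
  proof (rule ccontr)
    assume "\<not> ?thesis"
    then show False using less.hyps[OF _ sub(2)] P(2) s by auto
  qed
  have key: False if "triad A B D F" "\<exists>r\<in>set P. Ycomplete E A r" "\<exists>r\<in>set P. Ycomplete E B r"
    "\<exists>r\<in>set P. Ycomplete E D r" "\<forall>r\<in>set (ms @ [q]). \<not> Ycomplete E A r"
    "\<forall>r\<in>set (p # ms). \<not> Ycomplete E B r" for A B D
  proof -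
    have "Ycomplete E A r \<longleftrightarrow> r = hd P" if "r \<in> set P" for r using that \<open>\<exists>r\<in>set P. Ycomplete E A r\<close> \<open>\<forall>r\<in>set (ms @ [q]). \<not> Ycomplete E A r\<close> s by auto
    moreover have "Ycomplete E B r \<longleftrightarrow> r = last P" if "r \<in> set P" for r using that \<open>\<exists>r\<in>set P. Ycomplete E B r\<close> \<open>\<forall>r\<in>set (p # ms). \<not> Ycomplete E B r\<close> s by auto
    ultimately show False using triad_no_path_aux[OF that(1) P] that(4) by blast
  qed
  have same: False if "\<exists>r\<in>set P. Ycomplete E A r" "\<forall>r\<in>set (ms @ [q]). \<not> Ycomplete E A r"
    "\<forall>r\<in>set (p # ms). \<not> Ycomplete E A r" for A using that s by auto
  have perms: "triad X Y W F" "triad Y X W F" "triad X W Y F" "triad W X Y F" "triad Y W X F" "triad W Y X F"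
    using T triad_swap by blast+
  obtain A where A: "A \<in> {X, Y, W}" "\<forall>r\<in>set (ms @ [q]). \<not> Ycomplete E A r" using first by blast
  obtain B where B: "B \<in> {X, Y, W}" "\<forall>r\<in>set (p # ms). \<not> Ycomplete E B r" using second by blast
  consider "A = B" | "A = X" "B = Y" | "A = Y" "B = X" | "A = X" "B = W" | "A = W" "B = X" | "A = Y" "B = W" | "A = W" "B = Y"
    using A(1) B(1) by auto
  then show False
  proof cases
    case 1
    then show ?thesis using same A B Z by auto
  next
    case 2
    then show ?thesis using key[OF perms(1)] A B Z by blast
  next
    case 3
    then show ?thesis using key[OF perms(2)] A B Z by blast
  next
    case 4
    then show ?thesis using key[OF perms(3)] A B Z by blast
  next
    case 5
    then show ?thesis using key[OF perms(4)] A B Z by blast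
  next
    case 6
    then show ?thesis using key[OF perms(5)] A B Z by blast
  next
    case 7
    then show ?thesis using key[OF perms(6)] A B Z by blast
  qed
qed

text \<open>By parity the extreme neighbours of \<open>last Q\<close> on \<open>P\<close> are distinct, and adjacent unless there is an
  odd hole; this leaves a prism.\<close>
lemma no_attached_triangle:
  assumes P: "is_path V E P" "length P \<ge> 2" and Q: "is_path V E Q" and dis: "set P \<inter> set Q = {}"
    and tri: "E x1 x2" "E x2 x3" "E x1 x3"
    and out: "x1 \<notin> set P \<union> set Q" "x2 \<notin> set P \<union> set Q" "x3 \<notin> set P \<union> set Q"
    and e1: "\<And>p. p \<in> set P \<union> set Q \<Longrightarrow> E x1 p \<longleftrightarrow> p = hd P"
    and e2: "\<And>p. p \<in> set P \<union> set Q \<Longrightarrow> E x2 p \<longleftrightarrow> p = last P"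
    and e3: "\<And>p. p \<in> set P \<union> set Q \<Longrightarrow> E x3 p \<longleftrightarrow> p = hd Q"
    and PQ: "\<And>p q. p \<in> set P \<Longrightarrow> q \<in> set Q \<Longrightarrow> E p q \<Longrightarrow> q = last Q"
    and att: "\<exists>p\<in>set P. E p (last Q)"
  shows False
proof -
  have V: "x1 \<in> V" "x2 \<in> V" "x3 \<in> V" "x1 \<noteq> x2" "x2 \<noteq> x3" "x1 \<noteq> x3" using tri edge_in_V by auto
  have ne: "P \<noteq> []" "Q \<noteq> []" using P Q by auto
  have dst: "distinct P" using path_distinct[OF P(1)] .
  let ?q = "last Q"
  have q: "?q \<in> set Q" "?q \<notin> set P" "?q \<in> V" using ne dis path_subset[OF Q] by (auto dest: last_in_set)
  have hQ: "hd Q \<in> set Q" "hd Q \<notin> set P" using ne dis by (auto dest: hd_in_set)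
  have hlP: "hd P \<in> set P" "last P \<in> set P" using ne by auto
  from split_list_first_prop[OF att] obtain as pa r1 where
    a: "P = as @ pa # r1" "E pa ?q" "\<forall>x\<in>set as. \<not> E x ?q" by blast
  from split_list_last_prop[OF att] obtain r2 pb bs where
    b: "P = r2 @ pb # bs" "E pb ?q" "\<forall>x\<in>set bs. \<not> E x ?q" by blast
  have hdP: "hd P = hd (as @ [pa])" using a by (auto simp: hd_append)
  have lastP: "last P = last (pb # bs)" using b by simp
  have pA: "is_path V E (as @ [pa])" using path_sub[of "[]" "as @ [pa]" r1] P(1) a by simp
  have pB: "is_path V E (pb # bs)" using path_sub[of r2 "pb # bs" "[]"] P(1) b by simp
  have subA: "set (as @ [pa]) \<subseteq> set P" using a(1) by auto
  have subB: "set (pb # bs) \<subseteq> set P" using b(1) by auto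
  have p1: "is_path V E (x1 # as @ [pa])"
    using pA V out subA e1 hdP by (simp add: path_Cons) blast
  have "E x2 y \<longleftrightarrow> y = hd (rev (pb # bs))" if "y \<in> set (rev (pb # bs))" for y
  proof -
    have "hd (rev (pb # bs)) = last P" using lastP by (simp only: hd_rev)
    moreover have "y \<in> set P \<union> set Q" using that subB by auto
    ultimately show ?thesis using e2 by simp
  qed
  then have p2: "is_path V E (x2 # rev (pb # bs))"
    using pB path_rev[of "pb # bs"] V out subB by (subst path_Cons) auto
  have p3: "is_path V E (x3 # Q)" using Q V out e3 by (simp add: path_Cons)
  have p3r: "is_path V E (rev Q @ [x3])" using p3 path_rev[of "x3 # Q"] by simp
  have hr: "hd (rev Q @ [x3]) = ?q" using ne by (simp add: hd_rev)
  have xq: "\<not> E x1 y" "\<not> E x2 y" if "y \<in> set Q" for y using e1[of y] e2[of y] that hlP dis by auto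
  have x3P: "\<not> E x3 y" "\<not> E y x3" if "y \<in> set P" for y using e3[of y] that hQ edge_commute[of y x3] by auto
  have PQ': "E p y \<longleftrightarrow> y = ?q \<and> E p ?q" if "p \<in> set P" "y \<in> set Q" for p y using PQ[OF that] by blast
  have asq: "E p ?q \<longleftrightarrow> p = pa" if "p \<in> set (as @ [pa])" for p using that a by auto
  have bsq: "E p ?q \<longleftrightarrow> p = pb" if "p \<in> set (pb # bs)" for p using that b by auto
  \<comment> \<open>The hole runs from \<open>x1\<close> along \<open>P\<close> to
    \<open>pa\<close>, back along \<open>Q\<close> and through \<open>x3\<close>:
    \<open>length as + length Q + 3\<close> vertices. \<open>ev2\<close> is its mirror image at
    \<open>pb\<close>.\<close>
  have ev1: "even (length as + length Q + 1)"
  proof -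
    have cross: "E x y \<longleftrightarrow> x = last (x1 # as @ [pa]) \<and> y = hd (rev Q @ [x3]) \<or> x = hd (x1 # as @ [pa]) \<and> y = last (rev Q @ [x3])"
      if "x \<in> set (x1 # as @ [pa])" "y \<in> set (rev Q @ [x3])" for x y
    proof -
      have "x1 \<noteq> pa" "x3 \<noteq> ?q" using out subA q by auto
      then show ?thesis
        using that tri xq[of y] x3P[of x] PQ'[of x y] asq[of x] subA out hr by auto
    qed
    have "is_hole V E ((x1 # as @ [pa]) @ (rev Q @ [x3]))"
      using p1 p3r cross out V subA dis ne by (intro hole_ring) (auto simp: Suc_le_eq)
    then show ?thesis using hole_even by fastforce
  qed
  have ev2: "even (length bs + length Q + 1)"
  proof -
    have l: "last (x2 # rev (pb # bs)) = pb" by simp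
    have cross: "E x y \<longleftrightarrow> x = last (x2 # rev (pb # bs)) \<and> y = hd (rev Q @ [x3]) \<or> x = hd (x2 # rev (pb # bs)) \<and> y = last (rev Q @ [x3])"
      if "x \<in> set (x2 # rev (pb # bs))" "y \<in> set (rev Q @ [x3])" for x y
    proof -
      have "x2 \<noteq> pb" "x3 \<noteq> ?q" using out subB q by auto
      then show ?thesis
        using that tri xq[of y] x3P[of x] PQ'[of x y] bsq[of x] subB out hr l by auto
    qed
    have "is_hole V E ((x2 # rev (pb # bs)) @ (rev Q @ [x3]))"
      using p2 p3r cross out V subB dis ne by (intro hole_ring) (auto simp: Suc_le_eq)
    then show ?thesis using hole_even by fastforce
  qed
  have evP: "even (length P)"
    using edge_capped_path(1)[OF P, of x1 x2] out tri e1 e2 by auto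
  have "r1 = bs \<and> pa = pb \<or> (\<exists>ms. r1 = ms @ pb # bs)"
  proof -
    have "pb \<in> set (pa # r1)"
    proof (rule ccontr)
      assume "pb \<notin> set (pa # r1)"
      then have "pb \<in> set as" using a(1) subB by auto
      then show False using a(3) b(2) by blast
    qed
    then obtain u v where uv: "pa # r1 = u @ pb # v" by (meson split_list)
    then have "P = (as @ u) @ pb # v" using a(1) by simp
    then have "v = bs"
      using b(1) dst by (metis append_Cons_eq_iff distinct_append distinct.simps(2) disjoint_iff list.set_intros(1) set_append UnCI not_distinct_conv_prefix)
    then show ?thesis using uv by (cases u) auto
  qed
  then show False
  proof
    assume "r1 = bs \<and> pa = pb"
    then have "length P = length as + length bs + 1" using a(1) by simp
    then show False using evP ev1 ev2 by presburger
  next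
    assume "\<exists>ms. r1 = ms @ pb # bs"
    then obtain ms where ms: "P = as @ pa # ms @ pb # bs" using a(1) by blast
    have dAB: "set (as @ [pa]) \<inter> set (pb # bs) = {}" using dst ms by auto
    have "is_path V E ((as @ [pa] @ ms) @ (pb # bs))" using P(1) ms by simp
    then have cAB: "\<And>x y. x \<in> set (as @ [pa] @ ms) \<Longrightarrow> y \<in> set (pb # bs) \<Longrightarrow> E x y \<longleftrightarrow> x = last (as @ [pa] @ ms) \<and> y = pb"
      by (subst (asm) path_append) auto
    have x12: "\<not> E x1 y" if "y \<in> set (pb # bs)" for y
    proof -
      have "y \<noteq> hd P" using that dAB hdP hd_in_set[of "as @ [pa]"] by auto
      then show ?thesis using e1[of y] that subB by auto
    qed
    have x21: "\<not> E x2 y" if "y \<in> set (as @ [pa])" for y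
    proof -
      have "y \<noteq> last P" using that dAB lastP last_in_set[of "pb # bs"] by auto
      then show ?thesis using e2[of y] that subA by auto
    qed
    show False
    proof (cases "ms = []")
      case False
      have cAB': "\<not> E x y" if "x \<in> set (as @ [pa])" "y \<in> set (pb # bs)" for x y
      proof -
        have "x \<noteq> last (as @ [pa] @ ms)" using that(1) False dst ms last_in_set[OF False] by auto
        then show ?thesis using cAB[of x y] that by auto
      qed
      \<comment> \<open>The route from \<open>pa\<close> back to \<open>x1\<close>, across to
        \<open>x2\<close> and on to \<open>pb\<close> avoids \<open>ms\<close>. It is induced, and
        \<open>?q\<close> caps it; so \<open>length as + length bs + 4\<close> would be odd.\<close>
      let ?W = "rev (x1 # as @ [pa]) @ (x2 # rev (pb # bs))"
      have "is_path V E (rev (x1 # as @ [pa]))" using p1 path_rev by blast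
      moreover have "E x y \<longleftrightarrow> x = x1 \<and> y = x2"
        if "x \<in> set (rev (x1 # as @ [pa]))" "y \<in> set (x2 # rev (pb # bs))" for x y
      proof -
        have "x = x1 \<or> x \<in> set (as @ [pa])" "y = x2 \<or> y \<in> set (pb # bs)" using that by auto
        moreover have "x2 \<notin> set (pb # bs)" "x1 \<notin> set (as @ [pa])" using out subA subB by auto
        ultimately show ?thesis using tri(1) x12[of y] x21[of x] cAB'[of x y] edge_commute[of x x2] by blast
      qed
      ultimately have W: "is_path V E ?W"
        using p2 V out subA subB dAB by (subst path_append) auto
      have hlW: "hd ?W = pa" "last ?W = pb" by auto
      have qW: "E ?q y \<longleftrightarrow> y = hd ?W \<or> y = last ?W" if "y \<in> set ?W" for y
      proof -
        have c: "y = x1 \<or> y = x2 \<or> y \<in> set (as @ [pa]) \<or> y \<in> set (pb # bs)" using that by auto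
        have "\<not> E ?q x1" "\<not> E ?q x2" using xq[OF q(1)] edge_sym by blast+
        moreover have "x1 \<noteq> pa" "x1 \<noteq> pb" "x2 \<noteq> pa" "x2 \<noteq> pb" using out subA subB by auto
        moreover have "pa \<notin> set (pb # bs)" "pb \<notin> set (as @ [pa])" using dAB by auto
        ultimately show ?thesis using c asq[of y] bsq[of y] edge_commute[of ?q y] hlW by metis
      qed
      have "?q \<notin> set ?W" using q out subA subB by auto
      then have "odd (length ?W)" using capped_path(1)[OF W _ q(3) _ qW] by simp
      then have "odd (length as + length bs)" by simp
      then show False using ev1 ev2 by presburger
    next
      case True
      then have P': "P = as @ pa # pb # bs" using ms by simp
      have cAB2: "E x y \<longleftrightarrow> x = pa \<and> y = pb" if "x \<in> set (as @ [pa])" "y \<in> set (pb # bs)" for x y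
        using cAB[of x y] that True by auto
      have xpa: "x1 \<noteq> pa" "x2 \<noteq> pb" "x3 \<noteq> ?q" using out subA subB q by auto
      have l: "length (x1 # as @ [pa]) \<ge> 2" "length (x2 # rev (pb # bs)) \<ge> 2" "length (x3 # Q) \<ge> 2"
        using ne by (auto simp: Suc_le_eq)
      have d12: "set (x1 # as @ [pa]) \<inter> set (x2 # rev (pb # bs)) = {}" using V out subA subB dAB by auto
      have d13: "set (x1 # as @ [pa]) \<inter> set (x3 # Q) = {}" using V out subA dis by auto
      have d23: "set (x2 # rev (pb # bs)) \<inter> set (x3 # Q) = {}" using V out subB dis by auto
      have lasts: "last (x1 # as @ [pa]) = pa" "last (x2 # rev (pb # bs)) = pb" "last (x3 # Q) = ?q"
        using ne by auto
      have c12: "E x y \<longleftrightarrow> x = hd (x1 # as @ [pa]) \<and> y = hd (x2 # rev (pb # bs)) \<or> x = last (x1 # as @ [pa]) \<and> y = last (x2 # rev (pb # bs))"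
        if "x \<in> set (x1 # as @ [pa])" "y \<in> set (x2 # rev (pb # bs))" for x y
      proof -
        have "x = x1 \<or> x \<in> set (as @ [pa])" "y = x2 \<or> y \<in> set (pb # bs)" using that by auto
        moreover have "x2 \<notin> set (pb # bs)" "x1 \<notin> set (as @ [pa])" using out subA subB by auto
        ultimately show ?thesis
          using tri(1) x12[of y] x21[of x] cAB2[of x y] edge_commute[of x x2] xpa unfolding lasts list.sel by metis
      qed
      have c13: "E x y \<longleftrightarrow> x = hd (x1 # as @ [pa]) \<and> y = hd (x3 # Q) \<or> x = last (x1 # as @ [pa]) \<and> y = last (x3 # Q)"
        if "x \<in> set (x1 # as @ [pa])" "y \<in> set (x3 # Q)" for x y
      proof -
        have "x = x1 \<or> x \<in> set (as @ [pa])" "y = x3 \<or> y \<in> set Q" using that by auto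
        moreover have "x3 \<notin> set Q" "x1 \<notin> set (as @ [pa])" using out subA by auto
        ultimately show ?thesis
          using tri(3) xq[of y] x3P[of x] PQ'[of x y] asq[of x] subA xpa unfolding lasts list.sel by (metis subsetD)
      qed
      have c23: "E x y \<longleftrightarrow> x = hd (x2 # rev (pb # bs)) \<and> y = hd (x3 # Q) \<or> x = last (x2 # rev (pb # bs)) \<and> y = last (x3 # Q)"
        if "x \<in> set (x2 # rev (pb # bs))" "y \<in> set (x3 # Q)" for x y
      proof -
        have "x = x2 \<or> x \<in> set (pb # bs)" "y = x3 \<or> y \<in> set Q" using that by auto
        moreover have "x3 \<notin> set Q" "x2 \<notin> set (pb # bs)" using out subB by auto
        ultimately show ?thesis
          using tri(2) xq[of y] x3P[of x] PQ'[of x y] bsq[of x] subB xpa unfolding lasts list.sel by (metis subsetD)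
      qed
      \<comment> \<open>The triangles \<open>{x1, x2, x3}\<close> and \<open>{pa, pb, ?q}\<close>
        now form a prism, which is long unless all three paths are single edges.\<close>
      consider "length (x1 # as @ [pa]) > 2" | "length (x2 # rev (pb # bs)) > 2" | "length (x3 # Q) > 2"
        | "as = []" "bs = []" "length Q = 1"
        using l by (cases as; cases bs; cases "length Q = 1") auto
      then show False
      proof cases
        case 1
        show False
        proof (rule no_long_prism[OF p2 p3 p1 l(2,3) 1 d23])
          show "set (x2 # rev (pb # bs)) \<inter> set (x1 # as @ [pa]) = {}" using d12 by blast
          show "set (x3 # Q) \<inter> set (x1 # as @ [pa]) = {}" using d13 by blast
        qed (use c23 c12 c13 edge_commute in metis)+
      next
        case 2
        show False
        proof (rule no_long_prism[OF p1 p3 p2 l(1,3) 2 d13 d12])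
          show "set (x3 # Q) \<inter> set (x2 # rev (pb # bs)) = {}" using d23 by blast
        qed (use c23 c12 c13 edge_commute in metis)+
      next
        case 3
        show False by (rule no_long_prism[OF p1 p2 p3 l(1,2) 3 d12 d13 d23 c12 c13 c23])
      next
        case 4
        then obtain q where Qq: "Q = [q]" using ne by (cases Q) auto
        have Pp: "P = [pa, pb]" using P' 4 by simp
        have VV: "pa \<in> V" "pb \<in> V" "q \<in> V" "pa \<noteq> pb" using path_subset[OF P(1)] dst Pp q Qq by auto
        have m: "pa \<in> set P \<union> set Q" "pb \<in> set P \<union> set Q" "q \<in> set P \<union> set Q" using Pp Qq by auto
        have hl: "hd P = pa" "last P = pb" "hd Q = q" using Pp Qq by auto
        have ED: "x1 \<noteq> pa" "x1 \<noteq> pb" "x1 \<noteq> q" "x2 \<noteq> pa" "x2 \<noteq> pb" "x2 \<noteq> q" "x3 \<noteq> pa" "x3 \<noteq> pb" "x3 \<noteq> q" "pa \<noteq> q" "pb \<noteq> q"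
          using out Pp Qq dis by auto
        have E: "E x1 pa" "\<not> E x1 pb" "\<not> E x1 q" "\<not> E x2 pa" "E x2 pb" "\<not> E x2 q"
          "\<not> E x3 pa" "\<not> E x3 pb" "E x3 q" "E pa pb" "E pa q" "E pb q"
          using e1[OF m(1)] e1[OF m(2)] e1[OF m(3)] e2[OF m(1)] e2[OF m(2)] e2[OF m(3)]
            e3[OF m(1)] e3[OF m(2)] e3[OF m(3)] VV(4) ED hl cAB2[of pa pb] a(2) b(2) Qq by simp_all
        have E': "E x2 x1" "E x3 x2" "E x3 x1" "E pa x1" "\<not> E pb x1" "\<not> E q x1" "\<not> E pa x2" "E pb x2" "\<not> E q x2"
          "\<not> E pa x3" "\<not> E pb x3" "E q x3" "E pb pa" "E q pa" "E q pb"
          using E tri edge_sym by blast+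
        \<comment> \<open>The prism on six vertices is the complement of a 6-cycle.\<close>
        have h1: "is_path V (cE V E) [x1, pb, x3]" and h2: "is_path V (cE V E) [pa, x2, q]"
          using E E' ED V VV tri by (auto simp: C.path_Cons cE_def)
        have "length [x1, pb, x3] + length [pa, x2, q] \<le> 4"
          using E E' ED V VV tri by (intro antiring_length[OF h1 h2]) auto
        then show False by simp
      qed
    qed
  qed
qed

text \<open>Minimality of \<open>P\<close> over all pairs of sets makes its ends the only vertices
  of \<open>P\<close> complete to \<open>X\<close> or \<open>Y\<close>. A shortest path
  \<open>Q\<close> from a vertex complete to \<open>W\<close> to the surroundings of
  \<open>P\<close> gives the third leg, and one vertex of each set forms the triangle to which the
  legs attach.\<close>

lemma triad_contradiction_aux:
  assumes T: "triad X Y W F" and F: "connected_set V E F" and ZW: "\<exists>f\<in>F. Ycomplete E W f"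
    and P: "is_path V E P" "set P \<subseteq> F" "Ycomplete E X (hd P)" "Ycomplete E Y (last P)"
    and min: "\<And>A B Q. A \<in> {X, Y, W} \<Longrightarrow> B \<in> {X, Y, W} \<Longrightarrow> A \<noteq> B \<Longrightarrow> is_path V E Q \<Longrightarrow> set Q \<subseteq> F \<Longrightarrow>
      Ycomplete E A (hd Q) \<Longrightarrow> Ycomplete E B (last Q) \<Longrightarrow> length P \<le> length Q"
  shows False
proof -
  note t = triadD[OF T]
  have neq: "X \<noteq> Y" "X \<noteq> W" "Y \<noteq> W" using t(5-7,14-16) by (metis edge_irrefl ex_in_conv)+
  have ne: "P \<noteq> []" using P by auto
  have hl: "hd P \<in> set P" "last P \<in> set P" "hd P \<in> F" "last P \<in> F" using ne P(2) by auto
  have hlne: "hd P \<noteq> last P" using P(3,4) t(17)[OF hl(3)] by auto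
  obtain p rest where "P = p # rest" using ne by (cases P) auto
  moreover have "rest \<noteq> []" using calculation hlne by auto
  then obtain ms p' where "rest = ms @ [p']" by (cases rest rule: rev_cases) auto
  ultimately have s: "P = p # ms @ [p']" by simp
  then have pp: "hd P = p" "last P = p'" by auto
  have dst: "distinct P" using path_distinct[OF P(1)] .
  have len: "length P \<ge> 2" using s by simp
  have noW: "\<not> Ycomplete E W f" if "f \<in> set P" for f
    using triad_no_path[OF T P(1,2)] P(3,4) hl that by blast
  have ZX: "f = p" if f: "f \<in> set P" "Ycomplete E X f" for f
  proof -
    obtain as bs where ab: "P = as @ f # bs" using f(1) by (meson split_list)
    have "is_path V E (f # bs)" using path_sub[of as "f # bs" "[]"] P(1) ab by simp
    moreover have "set (f # bs) \<subseteq> F" "last (f # bs) = last P" using P(2) ab by auto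
    ultimately have "length P \<le> length (f # bs)" using min[of X Y "f # bs"] f(2) P(4) neq by auto
    then show ?thesis using ab s by (cases as) auto
  qed
  have ZY: "f = p'" if f: "f \<in> set P" "Ycomplete E Y f" for f
  proof -
    obtain as bs where ab: "P = as @ f # bs" using f(1) by (meson split_list)
    have "is_path V E (as @ [f])" using path_sub[of "[]" "as @ [f]" bs] P(1) ab by simp
    moreover have "set (as @ [f]) \<subseteq> F" "hd (as @ [f]) = hd P" using P(2) ab by (auto simp: hd_append)
    ultimately have "length P \<le> length (as @ [f])" using min[of X Y "as @ [f]"] f(2) P(3) neq by auto
    then have "bs = []" using ab by simp
    then show ?thesis using ab s pp by auto
  qed
  let ?B = "{f. f \<in> set P \<or> (\<exists>p\<in>set P. E p f)}"
  obtain w where w: "w \<in> F" "Ycomplete E W w" using ZW by blast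
  obtain Q where Q: "is_path V E Q" "set Q \<subseteq> F" "Ycomplete E W (hd Q)" "last Q \<in> ?B"
    "\<And>f. f \<in> set Q \<Longrightarrow> Ycomplete E W f \<Longrightarrow> f = hd Q" "\<And>f. f \<in> set Q \<Longrightarrow> f \<in> ?B \<Longrightarrow> f = last Q"
    using connected_path[OF F t(1) w(1), of "{f. Ycomplete E W f}" "hd P" ?B] w(2) hl by auto
  have Qne: "Q \<noteq> []" using Q by auto
  let ?q = "last Q"
  obtain q1 qt where Qs: "Q = q1 # qt" using Qne by (cases Q) auto
  have q1: "hd Q = q1" "q1 \<in> F" "Ycomplete E W q1" using Qs Q by auto
  \<comment> \<open>If \<open>Q\<close> ran into \<open>P\<close>, its last vertex but one would
    already be adjacent to \<open>P\<close>.\<close>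
  have lqP: "?q \<notin> set P"
  proof
    assume lp: "?q \<in> set P"
    then have "?q \<noteq> q1" using noW q1 by auto
    then obtain Q' where "qt = Q' @ [?q]" using Qs by (cases qt rule: rev_cases) auto
    then have Q': "Q = (q1 # Q') @ [?q]" using Qs by simp
    have "is_path V E ((q1 # Q') @ [?q])" using Q(1) Q' by metis
    from path_append[THEN iffD1, OF _ _ this]
    have "set (q1 # Q') \<inter> {?q} = {}" and c: "\<forall>x\<in>set (q1 # Q'). E x ?q \<longleftrightarrow> x = last (q1 # Q')" by simp_all
    then have e: "E (last (q1 # Q')) ?q" "last (q1 # Q') \<noteq> ?q"
      using last_in_set[of "q1 # Q'"] by blast+
    have "last (q1 # Q') \<in> set Q" using Q' last_in_set[of "q1 # Q'"] by (metis UnI1 list.distinct(1) set_append)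
    then show False using Q(6)[of "last (q1 # Q')"] e lp edge_sym by blast
  qed
  have dis: "set P \<inter> set Q = {}" using Q(6) lqP by blast
  have PQ: "f = ?q" if "g \<in> set P" "f \<in> set Q" "E g f" for f g using Q(6) that by blast
  have att: "\<exists>f\<in>set P. E f ?q" using Q(4) lqP by blast
  from split_list_first_prop[OF att] obtain as pa r1 where
    a: "P = as @ pa # r1" "E pa ?q" "\<forall>x\<in>set as. \<not> E x ?q" by blast
  from split_list_last_prop[OF att] obtain r2 pb bs where
    b: "P = r2 @ pb # bs" "E pb ?q" "\<forall>x\<in>set bs. \<not> E x ?q" by blast
  have subA: "set (as @ [pa]) \<subseteq> set P" using a(1) by auto
  have subB: "set (pb # bs) \<subseteq> set P" using b(1) by auto
  have pA: "is_path V E (rev (as @ [pa]))" using path_sub[of "[]" "as @ [pa]" r1] P(1) a path_rev[of "as @ [pa]"] by simp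
  have pB: "is_path V E (pb # bs)" using path_sub[of r2 "pb # bs" "[]"] P(1) b by simp
  have QA: "is_path V E (Q @ rev (as @ [pa]))"
  proof (subst path_append)
    have "E x y \<longleftrightarrow> x = last Q \<and> y = hd (rev (as @ [pa]))" if "x \<in> set Q" "y \<in> set (rev (as @ [pa]))" for x y
      using PQ[of y x] that subA a(2,3) edge_commute[of x y] by auto
    then show "is_path V E Q \<and> is_path V E (rev (as @ [pa])) \<and> set Q \<inter> set (rev (as @ [pa])) = {} \<and>
       (\<forall>x\<in>set Q. \<forall>y\<in>set (rev (as @ [pa])). E x y \<longleftrightarrow> x = last Q \<and> y = hd (rev (as @ [pa])))"
      using Q(1) pA dis subA by auto
  qed (use Qne in auto)
  have QB: "is_path V E (Q @ pb # bs)"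
  proof (subst path_append)
    have "E x y \<longleftrightarrow> x = last Q \<and> y = hd (pb # bs)" if "x \<in> set Q" "y \<in> set (pb # bs)" for x y
      using PQ[of y x] that subB b(2,3) edge_commute[of x y] by auto
    then show "is_path V E Q \<and> is_path V E (pb # bs) \<and> set Q \<inter> set (pb # bs) = {} \<and>
       (\<forall>x\<in>set Q. \<forall>y\<in>set (pb # bs). E x y \<longleftrightarrow> x = last Q \<and> y = hd (pb # bs))"
      using Q(1) pB dis subB by auto
  qed (use Qne in auto)
  have pinA: "p \<in> set (as @ [pa])" using a(1) s by (cases as) auto
  have pinB: "p' \<in> set (pb # bs)" using b(1) pp(2) last_in_set[of "pb # bs"] by auto
  have QA_F: "set (Q @ rev (as @ [pa])) \<subseteq> F" and QB_F: "set (Q @ pb # bs) \<subseteq> F"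
    using Q(2) P(2) subA subB by auto
  \<comment> \<open>This path already contains vertices complete to \<open>W\<close> and to
    \<open>X\<close>, namely \<open>q1\<close> and \<open>p\<close>; a vertex complete to
    \<open>Y\<close> would contradict \<open>triad_no_path\<close>. \<open>noXB\<close> is the
    mirror image.\<close>
  have noYA: "\<not> Ycomplete E Y f" if "f \<in> set (Q @ rev (as @ [pa]))" for f
  proof
    assume "Ycomplete E Y f"
    moreover have "p \<in> set (Q @ rev (as @ [pa]))" "q1 \<in> set (Q @ rev (as @ [pa]))" using pinA Qs by auto
    ultimately show False using triad_no_path[OF T QA QA_F] that q1 P(3) pp by blast
  qed
  have noXB: "\<not> Ycomplete E X f" if "f \<in> set (Q @ pb # bs)" for f
  proof
    assume "Ycomplete E X f"
    moreover have "p' \<in> set (Q @ pb # bs)" "q1 \<in> set (Q @ pb # bs)" using pinB Qs by auto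
    ultimately show False using triad_no_path[OF T QB QB_F] that q1 P(4) pp by blast
  qed
  have paP: "pa \<in> set (p # ms)"
  proof -
    have "pa \<noteq> p'" using noYA[of pa] P(4) pp by auto
    then show ?thesis using subA s by auto
  qed
  have pbP: "pb \<in> set (ms @ [p'])"
  proof -
    have "pb \<noteq> p" using noXB[of pb] P(3) pp by auto
    then show ?thesis using subB s by auto
  qed
  have qtQ: "set qt \<subseteq> set Q" "q1 \<notin> set qt" using Qs path_distinct[OF Q(1)] by auto
  have qtW: "\<not> Ycomplete E W f" if "f \<in> set qt" for f using Q(5)[of f] that qtQ q1(1) by auto
  have qtX: "\<not> Ycomplete E X f" if "f \<in> set qt" for f using noXB[of f] that qtQ by auto
  have qtY: "\<not> Ycomplete E Y f" if "f \<in> set qt" for f using noYA[of f] that qtQ by auto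
  have con: "connected_set V E (set M \<union> set qt)"
    if M: "is_path V E M" "f \<in> set M" "E f ?q" for M f
  proof (cases "qt = []")
    case True
    then show ?thesis using path_connected[OF M(1)] by simp
  next
    case False
    then have "is_path V E qt" using path_sub[of "[q1]" qt "[]"] Q(1) Qs by simp
    moreover have "?q \<in> set qt" using False Qs by simp
    ultimately show ?thesis using connected_union[OF path_connected[OF M(1)] path_connected] M(2,3) by blast
  qed
  have pm1: "is_path V E (ms @ [p'])" using path_sub[of "[p]" "ms @ [p']" "[]"] P(1) s by simp
  have pm2: "is_path V E (p # ms)" using path_sub[of "[]" "p # ms" "[p']"] P(1) s by simp
  have c1: "connected_set V E (set (ms @ [p']) \<union> set qt)" using con[OF pm1 pbP b(2)] .
  have c2: "connected_set V E (set (p # ms) \<union> set qt)" using con[OF pm2 paP a(2)] .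
  have m1: "set (ms @ [p']) \<union> set qt \<subseteq> F" "set (p # ms) \<union> set qt \<subseteq> F" using P(2) s qtQ Q(2) by auto
  have m1X: "\<not> Ycomplete E X f" "\<not> Ycomplete E W f" if "f \<in> set (ms @ [p']) \<union> set qt" for f
    using that ZX[of f] noW[of f] qtX[of f] qtW[of f] s dst by auto
  have m2Y: "\<not> Ycomplete E Y f" "\<not> Ycomplete E W f" if "f \<in> set (p # ms) \<union> set qt" for f
    using that ZY[of f] noW[of f] qtY[of f] qtW[of f] s dst by auto
  obtain x where x: "x \<in> X" "\<And>f. f \<in> set (ms @ [p']) \<union> set qt \<Longrightarrow> \<not> E x f"
    using triad_anticomplete[OF triad_swap(2)[OF T] c1 m1(1) m1X] by blast
  obtain y where y: "y \<in> Y" "\<And>f. f \<in> set (p # ms) \<union> set qt \<Longrightarrow> \<not> E y f"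
    using triad_anticomplete[OF triad_swap(2)[OF triad_swap(1)[OF T]] c2 m1(2) m2Y] by blast
  obtain z where z: "z \<in> W" "\<And>f. f \<in> set (ms @ [p']) \<union> set qt \<Longrightarrow> \<not> E z f"
    using triad_anticomplete[OF triad_swap(1)[OF triad_swap(2)[OF T]] c1 m1(1) m1X(2) m1X(1)] by blast
  have tri: "E x y" "E y z" "E x z" "E z x" "E z y" "E y x" using x(1) y(1) z(1) t(14-16) edge_sym by blast+
  have out: "x \<notin> set P \<union> set Q" "y \<notin> set P \<union> set Q" "z \<notin> set P \<union> set Q"
    using x(1) y(1) z(1) t(11-13) P(2) Q(2) by auto
  \<comment> \<open>All adjacencies between the triangle \<open>x\<close>, \<open>y\<close>,
    \<open>z\<close> and the two paths are now known, except those of \<open>x\<close> with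
    \<open>q1\<close>, \<open>y\<close> with \<open>q1\<close> and \<open>z\<close> with
    \<open>p\<close>. The final case distinction is over these three.\<close>
  have xp: "E x p" and yp: "E y p'" and zq: "E z q1"
    using P(3,4) pp q1(3) x(1) y(1) z(1) edge_sym by (auto simp: Ycomplete_def)
  have xP: "E x f \<longleftrightarrow> f = hd P" if "f \<in> set P" for f using that x(2)[of f] xp s pp dst by auto
  have yP: "E y f \<longleftrightarrow> f = last P" if "f \<in> set P" for f using that y(2)[of f] yp s pp dst by auto
  have no3: "\<not> E v f" if "length P \<ge> 3" "v \<notin> set P" "E v x" "E v y" "f \<in> set P" for v f
    using edge_capped_path(2)[OF P(1) len, of x y v f] out tri xP yP that by auto
  have short: False if l: "length P = 2" "Q = [q1]"
  proof -
    have "ms = []" using l s by simp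
    then have "pa = p" "pb = p'" using paP pbP by auto
    then have "E p q1" "E p' q1" "E p p'" using a(2) b(2) l(2) P(1) s \<open>ms = []\<close> by (auto simp: path_Cons)
    then show False
      using triad_triangle[OF T, of p p' q1] P(3,4) pp q1 hl by auto
  qed
  show False
  proof (cases "E x q1")
    case False
    note xq = this
    have xQ: "\<not> E x f" if "f \<in> set Q" for f using that xq x(2) Qs by auto
    show False
    proof (cases "E y q1")
      case False
      have yQ: "\<not> E y f" if "f \<in> set Q" for f using that False y(2) Qs by auto
      show False
      proof (cases "E z p")
        case True
        then have "\<not> length P \<ge> 3" using no3[of z p] out tri s by auto
        then have lP: "length P = 2" using len by simp
        then have msn: "ms = []" using s by simp
        then have ab: "pa = p" "pb = p'" "as = []" "bs = []"
          using paP pbP a(1) b(1) s hlne by (auto simp: Cons_eq_append_conv append_eq_Cons_conv)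
        \<comment> \<open>\<open>z\<close> caps both \<open>Q @ [p]\<close> and
          \<open>(Q @ [p']) @ [y]\<close>, whose lengths differ by one; one of the two holes is
          odd.\<close>
        have Q2: "length Q \<ge> 2" using short[OF lP] Qs by (cases qt) auto
        have "is_path V E (Q @ [p])" using QA ab by simp
        moreover have "E z f \<longleftrightarrow> f = hd (Q @ [p]) \<or> f = last (Q @ [p])" if "f \<in> set (Q @ [p])" for f
          using that z(2)[of f] zq True Qs qtQ by auto
        ultimately have "odd (length (Q @ [p]))"
          using Q2 out s tri edge_in_V by (intro capped_path(1)[of _ z]) auto
        moreover have "odd (length ((Q @ [p']) @ [y]))"
        proof (rule capped_path(1)[of _ z])
          have "is_path V E (Q @ [p'])" using QB ab by simp
          then show "is_path V E ((Q @ [p']) @ [y])"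
            using out tri edge_in_V yQ yp s by (subst path_append) (auto simp: path_Cons[of y] edge_commute[of _ y])
          show "E z f \<longleftrightarrow> f = hd ((Q @ [p']) @ [y]) \<or> f = last ((Q @ [p']) @ [y])"
            if "f \<in> set ((Q @ [p']) @ [y])" for f
            using that z(2)[of f] zq tri Qs qtQ out msn by auto
        qed (use Q2 out s tri edge_in_V in auto)
        ultimately show False by simp
      next
        case zp: False
        show False
        proof (rule no_attached_triangle[OF P(1) len Q(1) dis tri(1-3) out _ _ _ _ att])
          show "E x f \<longleftrightarrow> f = hd P" if "f \<in> set P \<union> set Q" for f using that xP xQ hl(1) dis by auto
          show "E y f \<longleftrightarrow> f = last P" if "f \<in> set P \<union> set Q" for f using that yP yQ hl(2) dis by auto
          show "E z f \<longleftrightarrow> f = hd Q" if "f \<in> set P \<union> set Q" for f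
            using that z(2)[of f] zq zp Qs qtQ s dis by auto
        qed (use PQ in blast)
      qed
    next
      case True
      \<comment> \<open>The edge between \<open>y\<close> and \<open>x\<close> caps this route from
        \<open>q1\<close> to \<open>p\<close>, and \<open>z\<close> sees \<open>x\<close>,
        \<open>y\<close> and \<open>q1\<close>. So the route has only two vertices, and by
        minimality so has \<open>P\<close>, which leaves the case \<open>short\<close>.\<close>
      let ?W = "Q @ rev (as @ [pa])"
      have lW: "last ?W = p" "hd ?W = q1" using a(1) s Qs by (cases as; auto)+
      have "E y f \<longleftrightarrow> f = hd ?W" if "f \<in> set ?W" for f
      proof -
        have "f = q1 \<or> f \<in> set qt \<or> f \<in> set (p # ms)" using that Qs noYA[OF that] P(4) pp s subA by auto
        moreover have "q1 \<notin> set (p # ms)" using Qs dis s by auto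
        ultimately show ?thesis using True y(2)[of f] lW qtQ by auto
      qed
      moreover have "E x f \<longleftrightarrow> f = last ?W" if "f \<in> set ?W" for f
      proof -
        have "f \<in> set Q \<or> f \<in> set P" using that subA by auto
        moreover have "p \<notin> set Q" using dis s by auto
        ultimately show ?thesis using xQ[of f] xP[of f] lW pp by auto
      qed
      moreover have "y \<notin> set ?W" "x \<notin> set ?W" "z \<notin> set ?W" using out subA by auto
      moreover have "length ?W \<ge> 2" "q1 \<in> set ?W" using Qs by auto
      ultimately have "\<not> length ?W \<ge> 3"
        using edge_capped_path(2)[OF QA, of y x z q1] tri zq by auto
      then have l: "as = []" "qt = []" using Qs by (cases as; cases qt; simp)+
      then have QQ: "Q = [q1]" and pa: "pa = p" using Qs a(1) s by auto
      have "is_path V E [q1, p]" using QA l QQ pa by simp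
      then have "length P \<le> 2" using min[of W X "[q1, p]"] neq q1 P(3) pp hl by auto
      then show False using short QQ len by auto
    qed
  next
    case True
    show False
    proof (cases "E y q1")
      case False
      have yQ: "\<not> E y f" if "f \<in> set Q" for f using that False y(2) Qs by auto
      let ?W = "Q @ pb # bs"
      have lW: "last ?W = p'" "hd ?W = q1" using b(1) pp Qs by auto
      have "E x f \<longleftrightarrow> f = hd ?W" if "f \<in> set ?W" for f
      proof -
        have "f = q1 \<or> f \<in> set qt \<or> f \<in> set (ms @ [p'])" using that Qs noXB[OF that] P(3) pp s subB by auto
        moreover have "q1 \<notin> set (ms @ [p'])" using Qs dis s by auto
        ultimately show ?thesis using True x(2)[of f] lW qtQ by auto
      qed
      moreover have "E y f \<longleftrightarrow> f = last ?W" if "f \<in> set ?W" for f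
      proof -
        have "f \<in> set Q \<or> f \<in> set P" using that subB by auto
        moreover have "p' \<notin> set Q" using dis s by auto
        ultimately show ?thesis using yQ[of f] yP[of f] lW pp by auto
      qed
      moreover have "y \<notin> set ?W" "x \<notin> set ?W" "z \<notin> set ?W" using out subB by auto
      moreover have "length ?W \<ge> 2" "q1 \<in> set ?W" using Qs by auto
      ultimately have "\<not> length ?W \<ge> 3"
        using edge_capped_path(2)[OF QB, of x y z q1] tri zq by auto
      then have l: "bs = []" "qt = []" using Qs by (cases bs; cases qt; simp)+
      then have QQ: "Q = [q1]" and pb: "pb = p'" using Qs lW by auto
      have "is_path V E [q1, p']" using QB l QQ pb by simp
      then have "length P \<le> 2" using min[of W Y "[q1, p']"] neq q1 P(4) pp hl by auto
      then show False using short QQ len by auto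
    next
      \<comment> \<open>\<open>q1\<close> sees \<open>x\<close> and \<open>y\<close>, so it replaces
        \<open>z\<close> in the triangle, and the rest \<open>qt\<close> of \<open>Q\<close>, if
        there is any, becomes the third leg.\<close>
      case yq: True
      have q1e: "E q1 x" "E q1 y" using True yq edge_sym by auto
      have q1P: "q1 \<notin> set P" using dis Qs by auto
      show False
      proof (cases "qt = []")
        case True
        then have QQ: "Q = [q1]" using Qs by simp
        have "E q1 pa" using a(2) QQ edge_sym by auto
        then have "\<not> length P \<ge> 3" using no3[of q1 pa] q1P q1e subA by auto
        then show False using short QQ len by auto
      next
        case False
        have pqt: "is_path V E qt" using path_sub[of "[q1]" qt "[]"] Q(1) Qs False by simp
        have lq: "last qt = ?q" using Qs False by simp
        have q1q: "q1 \<noteq> ?q" using lq False qtQ by (metis last_in_set)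
        have q1qt: "E q1 f \<longleftrightarrow> f = hd qt" if "f \<in> set qt" for f
          using Q(1) that False unfolding Qs by (auto simp: path_Cons)
        show False
        proof (rule no_attached_triangle[OF P(1) len pqt, of x y q1])
          show "set P \<inter> set qt = {}" using dis qtQ by auto
          show "E x y" "E y q1" "E x q1" using tri yq \<open>E x q1\<close> by auto
          show "x \<notin> set P \<union> set qt" "y \<notin> set P \<union> set qt" "q1 \<notin> set P \<union> set qt" using out qtQ q1P by auto
          show "E x f \<longleftrightarrow> f = hd P" if "f \<in> set P \<union> set qt" for f
            using that xP x(2)[of f] hl(1) dis qtQ by auto
          show "E y f \<longleftrightarrow> f = last P" if "f \<in> set P \<union> set qt" for f
            using that yP y(2)[of f] hl(2) dis qtQ by auto
          show "E q1 f \<longleftrightarrow> f = hd qt" if "f \<in> set P \<union> set qt" for f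
          proof (cases "f \<in> set qt")
            case True
            then show ?thesis using q1qt by blast
          next
            case F: False
            then have "f \<in> set P" using that by auto
            then have "\<not> E q1 f" using PQ[of f q1] q1q Qs edge_sym by auto
            then show ?thesis using F False by (metis hd_in_set)
          qed
          show "f' = last qt" if "f \<in> set P" "f' \<in> set qt" "E f f'" for f f' using PQ[of f f'] that qtQ lq by auto
          show "\<exists>f\<in>set P. E f (last qt)" using att lq by simp
        qed
      qed
    qed
  qed
qed

text \<open>The shortest path is taken over all pairs of sets at once, so that after renaming it has
  the minimality that the previous lemma asks for.\<close>

lemma triad_contradiction:
  assumes T: "triad X Y W F" and F: "connected_set V E F"
    and Z: "\<exists>f\<in>F. Ycomplete E X f" "\<exists>f\<in>F. Ycomplete E Y f" "\<exists>f\<in>F. Ycomplete E W f"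
  shows False
proof -
  note t = triadD[OF T]
  have perms: "triad X Y W F" "triad Y X W F" "triad X W Y F" "triad W X Y F" "triad Y W X F" "triad W Y X F"
    using T triad_swap by blast+
  define R where "R = (\<lambda>P. is_path V E P \<and> set P \<subseteq> F \<and> (\<exists>A\<in>{X, Y, W}. \<exists>B\<in>{X, Y, W}. A \<noteq> B \<and>
      Ycomplete E A (hd P) \<and> Ycomplete E B (last P)))"
  obtain f g where fg: "f \<in> F" "Ycomplete E X f" "g \<in> F" "Ycomplete E Y g" using Z by blast
  have neq: "X \<noteq> Y" using t(5,14) by (metis edge_irrefl ex_in_conv)
  obtain P0 where "is_path V E P0" "set P0 \<subseteq> F" "hd P0 \<in> {f}" "last P0 \<in> {g}"
    using connected_path[OF F t(1) fg(1), of "{f}" g "{g}"] fg(3) by blast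
  then have "R P0" unfolding R_def using fg neq by blast
  then obtain P where P: "R P" "\<And>Q. R Q \<Longrightarrow> length P \<le> length Q"
    using ex_has_least_nat[of R P0 length] by blast
  then obtain A B where r: "A \<in> {X, Y, W}" "B \<in> {X, Y, W}" "A \<noteq> B" "is_path V E P" "set P \<subseteq> F"
    "Ycomplete E A (hd P)" "Ycomplete E B (last P)" unfolding R_def by blast
  have min: "length P \<le> length Q" if "A' \<in> {X, Y, W}" "B' \<in> {X, Y, W}" "A' \<noteq> B'" "is_path V E Q" "set Q \<subseteq> F"
    "Ycomplete E A' (hd Q)" "Ycomplete E B' (last Q)" for A' B' Q
    using P(2)[of Q] that unfolding R_def by blast
  have key: False if "triad A B D F" "{A, B, D} = {X, Y, W}" "\<exists>f\<in>F. Ycomplete E D f" for D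
    using triad_contradiction_aux[OF that(1) F that(3) r(4-7)] min unfolding that(2) by blast
  consider "A = X" "B = Y" | "A = Y" "B = X" | "A = X" "B = W" | "A = W" "B = X" | "A = Y" "B = W" | "A = W" "B = Y"
    using r(1-3) by auto
  then show False
  proof cases
    case 1
    then show ?thesis using key[of W] perms(1) Z by auto
  next
    case 2
    then show ?thesis using key[of W] perms(2) Z by (simp add: insert_commute)
  next
    case 3
    then show ?thesis using key[of Y] perms(3) Z by (simp add: insert_commute)
  next
    case 4
    then show ?thesis using key[of Y] perms(4) Z by (simp add: insert_commute)
  next
    case 5
    then show ?thesis using key[of X] perms(5) Z by (simp add: insert_commute)
  next
    case 6
    then show ?thesis using key[of X] perms(6) Z by (simp add: insert_commute)
  qed
qed

subsection \<open>Graphs without skew partitions\<close>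

lemma path_alternates:
  assumes "is_path V E ps" "set ps \<subseteq> U" "\<And>u v. u \<in> U \<Longrightarrow> v \<in> U \<Longrightarrow> E u v \<Longrightarrow> u \<in> S \<longleftrightarrow> v \<notin> S"
  shows "(hd ps \<in> S \<longleftrightarrow> last ps \<in> S) \<longleftrightarrow> odd (length ps)"
  using assms(1,2)
proof (induction ps)
  case (Cons p ps)
  show ?case
  proof (cases "ps = []")
    case False
    then have "is_path V E ps" "E p (hd ps)" using Cons.prems(1) by (auto simp: path_Cons)
    moreover have "hd ps \<in> set ps" using False by simp
    moreover have "set ps \<subseteq> U" "p \<in> U" using Cons.prems(2) by auto
    ultimately have "p \<in> S \<longleftrightarrow> hd ps \<notin> S" "(hd ps \<in> S \<longleftrightarrow> last ps \<in> S) \<longleftrightarrow> odd (length ps)"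
      using Cons.IH assms(3)[of p "hd ps"] by blast+
    then show ?thesis using False by auto
  qed simp
qed simp

lemma triangle_free_bipartite:
  assumes tf: "\<And>x y z. E x y \<Longrightarrow> E y z \<Longrightarrow> \<not> E x z"
  shows "bipartite V E"
proof -
  have "\<exists>S. \<forall>u\<in>U. \<forall>v\<in>U. E u v \<longrightarrow> (u \<in> S \<longleftrightarrow> v \<notin> S)" if "finite U" "U \<subseteq> V" for U
    using that
  proof (induction U rule: finite_induct)
    case (insert v U)
    have U: "U \<subseteq> V" "v \<in> V" using insert.prems by auto
    obtain S where "\<forall>u\<in>U. \<forall>v\<in>U. E u v \<longrightarrow> (u \<in> S \<longleftrightarrow> v \<notin> S)" using insert.IH[OF U(1)] by blast
    then have S: "\<And>u v. u \<in> U \<Longrightarrow> v \<in> U \<Longrightarrow> E u v \<Longrightarrow> u \<in> S \<longleftrightarrow> v \<notin> S" by blast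
    \<comment> \<open>The components of \<open>U\<close> that contain a neighbour of
      \<open>v\<close> in \<open>S\<close>, written as a union of connected sets. A shortest path
      from there to a neighbour of \<open>v\<close> outside \<open>S\<close> would close with
      \<open>v\<close> to a triangle or an odd hole, so exchanging the colours on \<open>T\<close>
      puts all neighbours of \<open>v\<close> outside the new class.\<close>
    define T where "T = \<Union>{D. D \<subseteq> U \<and> connected_set V E D \<and> (\<exists>a\<in>D. E v a \<and> a \<in> S)}"
    have T: "b \<in> T" if aT: "a \<in> T" and b: "b \<in> U" "E a b" for a b
    proof -
      obtain D c where D: "D \<subseteq> U" "connected_set V E D" "c \<in> D" "E v c" "c \<in> S" "a \<in> D"
        using aT unfolding T_def by blast
      have "connected_set V E (insert b D)" using connected_insert[OF D(2,6) b(2)] .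
      then show ?thesis unfolding T_def
        by (intro UnionI[of "insert b D"] CollectI conjI bexI[of _ c]) (use D b in auto)
    qed
    have in_T: "a \<in> T" if "a \<in> U" "E v a" "a \<in> S" for a
      unfolding T_def using that connected_singleton[of a] by blast
    have notin_T: "b \<notin> T" if b: "b \<in> U" "E v b" "b \<notin> S" for b
    proof
      assume "b \<in> T"
      then obtain D a where D: "D \<subseteq> U" "connected_set V E D" "a \<in> D" "E v a" "a \<in> S" "b \<in> D"
        unfolding T_def by blast
      have DV: "D \<subseteq> V" using D(1) U by blast
      define K where "K = {x. E v x \<and> x \<in> S}"
      define L where "L = {x. E v x \<and> x \<notin> S}"
      have "a \<in> K" "b \<in> L" using D b by (auto simp: K_def L_def)
      then obtain ps where ps0: "is_path V E ps" "set ps \<subseteq> D" "hd ps \<in> K" "last ps \<in> L"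
        "\<And>x. x \<in> set ps \<Longrightarrow> x \<in> K \<Longrightarrow> x = hd ps" "\<And>x. x \<in> set ps \<Longrightarrow> x \<in> L \<Longrightarrow> x = last ps"
        using connected_path[OF D(2) DV D(3) _ D(6)] by blast
      then have ps: "is_path V E ps" "set ps \<subseteq> D" "E v (hd ps)" "hd ps \<in> S" "E v (last ps)" "last ps \<notin> S"
        by (auto simp: K_def L_def)
      have "set ps \<subseteq> U" using ps(2) D(1) by blast
      then have ev: "even (length ps)" using path_alternates[OF ps(1) _ S, of U] ps(4,6) by auto
      have vx: "E v x \<longleftrightarrow> x = hd ps \<or> x = last ps" if "x \<in> set ps" for x using ps ps0(5)[of x] ps0(6)[of x] that unfolding K_def L_def by auto
      show False
      proof (cases "length ps \<ge> 3")
        case True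
        have "v \<notin> set ps" using ps(2) D(1) insert.hyps by auto
        then show False using capped_path(1)[OF ps(1) True U(2) _ vx] ev by simp
      next
        case False
        obtain x r where r: "ps = x # r" using ps(1) by (cases ps) auto
        then obtain y r' where "r = y # r'" using ev by (cases r) auto
        then have "ps = [x, y]" using r False by (cases r') auto
        then show False using ps(1,3,5) tf[of v x y] by (auto simp: path_Cons)
      qed
    qed
    let ?S = "insert v {x \<in> U. x \<in> S \<longleftrightarrow> x \<notin> T}"
    have vnb: "u \<notin> ?S" if "u \<in> U" "E v u" for u
      using that in_T notin_T insert.hyps by auto
    have "u \<in> ?S \<longleftrightarrow> w \<notin> ?S" if uw: "u \<in> insert v U" "w \<in> insert v U" "E u w" for u w
    proof -
      consider "u = v" "w \<in> U" | "w = v" "u \<in> U" | "u \<in> U" "w \<in> U" using uw by (auto intro: edge_irrefl)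
      then show ?thesis
      proof cases
        case 1
        then show ?thesis using vnb[of w] uw by auto
      next
        case 2
        then show ?thesis using vnb[of u] uw edge_sym by auto
      next
        case 3
        then have "u \<in> T \<longleftrightarrow> w \<in> T" using T[of u w] T[of w u] uw(3) edge_sym by blast
        moreover have "u \<in> S \<longleftrightarrow> w \<notin> S" using S 3 uw(3) by blast
        moreover have "u \<noteq> v" "w \<noteq> v" using 3 insert.hyps by auto
        ultimately show ?thesis using 3 by auto
      qed
    qed
    then show ?case by blast
  qed simp
  from this[OF finite_V] obtain S where "\<forall>u\<in>V. \<forall>v\<in>V. E u v \<longrightarrow> (u \<in> S \<longleftrightarrow> v \<notin> S)" by blast
  then have "u \<in> S \<longleftrightarrow> v \<notin> S" if "E u v" for u v using that edge_in_V[OF that] by blast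
  then show ?thesis unfolding bipartite_def by (intro exI[of _ S]) simp
qed

text \<open>\<open>B1 \<union> B2\<close> is disconnected in the complement, so a disconnected
  \<open>A\<close> would complete a skew partition. For a two-element \<open>A\<close> this yields
  an edge.\<close>

lemma no_skew_connected:
  assumes ns: "\<And>A B. \<not> skew_partition V E A B"
    and B: "B1 \<subseteq> V" "B2 \<subseteq> V" "B1 \<noteq> {}" "B2 \<noteq> {}" "\<And>x y. x \<in> B1 \<Longrightarrow> y \<in> B2 \<Longrightarrow> E x y"
    and A: "A = V - (B1 \<union> B2)"
  shows "connected_set V E A"
proof (cases "A = {}")
  case True
  then show ?thesis by (simp add: connected_set_def)
next
  case False
  have "B1 \<inter> B2 = {}" using B(5) by fastforce
  then have "B1 \<noteq> B1 \<union> B2" using B(4) by blast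
  then have "\<not> connected_set V (cE V E) (B1 \<union> B2)"
    using C.connected_setD[of "B1 \<union> B2" B1] B by (auto 4 3 simp: cE_def)
  moreover have "A \<union> (B1 \<union> B2) = V" "A \<inter> (B1 \<union> B2) = {}" "B1 \<union> B2 \<noteq> {}" using A B by auto
  ultimately show ?thesis using ns[of A "B1 \<union> B2"] False unfolding skew_partition_def by blast
qed

lemma connected_pair: "connected_set V E {u, v} \<Longrightarrow> u \<noteq> v \<Longrightarrow> E u v"
  using connected_setD[of "{u, v}" "{u}"] by auto

text \<open>A split with all edges across cannot cut through a member of the family, and it cannot
  separate a member from \<open>f\<close>, which has a nonneighbour in each.\<close>

lemma anticonnected_join:
  assumes "\<And>C. C \<in> \<C> \<Longrightarrow> anticonnected V E C" "\<And>C. C \<in> \<C> \<Longrightarrow> \<not> Ycomplete E C f" "\<And>C. C \<in> \<C> \<Longrightarrow> f \<notin> C"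
  shows "anticonnected V E (insert f (\<Union>\<C>))"
  unfolding anticonnected_def
proof (intro allI impI)
  let ?D = "insert f (\<Union>\<C>)"
  fix S assume S: "S \<subseteq> ?D" "S \<noteq> {}" "S \<noteq> ?D"
  show "\<exists>u\<in>S. \<exists>v\<in>?D - S. \<not> E u v"
  proof (rule ccontr)
    assume "\<not> ?thesis"
    then have all: "E u v" if "u \<in> S" "v \<in> ?D" "v \<notin> S" for u v using that by blast
    have d: "C \<inter> S = {} \<or> C \<subseteq> S" if C: "C \<in> \<C>" for C
    proof (rule ccontr)
      assume "\<not> ?thesis"
      then have "\<exists>u\<in>C \<inter> S. \<exists>v\<in>C - (C \<inter> S). \<not> E u v"
        using assms(1)[OF C, unfolded anticonnected_def, rule_format, of "C \<inter> S"] by blast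
      then show False using all C by blast
    qed
    have nC: "\<exists>c\<in>C. \<not> E f c" if "C \<in> \<C>" for C using assms(2)[OF that] by (auto simp: Ycomplete_def)
    show False
    proof (cases "f \<in> S")
      case True
      have "C \<subseteq> S" if C: "C \<in> \<C>" for C
      proof (rule ccontr)
        assume "\<not> C \<subseteq> S"
        then have "C \<inter> S = {}" using d[OF C] by blast
        then show False using nC[OF C] all[OF True] C by blast
      qed
      then show False using S(1,3) True by blast
    next
      case False
      then obtain C where C: "C \<in> \<C>" "C \<inter> S \<noteq> {}" using S(1,2) by blast
      then have "C \<subseteq> S" using d by blast
      then show False using nC[OF C(1)] all[of _ f] False edge_sym by blast
    qed
  qed
qed

lemma no_skew_dichotomy:
  assumes ns: "\<And>A B. \<not> skew_partition V E A B"
  shows "complete_graph V E \<or> bipartite V E"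
proof (rule ccontr)
  assume contr: "\<not> ?thesis"
  then obtain a b c where abc: "E a b" "E b c" "E a c" using triangle_free_bipartite by blast
  define fam where "fam \<X> \<longleftrightarrow> \<X> \<subseteq> Pow V \<and> card \<X> \<ge> 3 \<and> (\<forall>X\<in>\<X>. X \<noteq> {} \<and> anticonnected V E X) \<and>
     (\<forall>X\<in>\<X>. \<forall>Y\<in>\<X>. X \<noteq> Y \<longrightarrow> (\<forall>x\<in>X. \<forall>y\<in>Y. E x y))" for \<X>
  have abc': "E b a" "E c b" "E c a" using abc edge_sym by auto
  have "a \<noteq> b" "b \<noteq> c" "a \<noteq> c" using abc by auto
  then have "card {{a}, {b}, {c}} = 3" by simp
  moreover have "anticonnected V E {x}" for x by (auto simp: anticonnected_def subset_singleton_iff)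
  ultimately have "fam {{a}, {b}, {c}}" unfolding fam_def using abc abc' edge_in_V by auto
  moreover have "\<forall>\<X>. fam \<X> \<longrightarrow> card (\<Union>\<X>) < Suc (card V)"
    unfolding fam_def using finite_V by (auto simp: less_Suc_eq_le intro!: card_mono)
  ultimately obtain \<X> where famX: "fam \<X>" and max: "\<And>\<Y>. fam \<Y> \<Longrightarrow> card (\<Union>\<Y>) \<le> card (\<Union>\<X>)"
    using ex_has_greatest_nat[of fam "{{a}, {b}, {c}}" "\<lambda>\<X>. card (\<Union>\<X>)" "Suc (card V)"] by blast
  have fam: "\<X> \<subseteq> Pow V" "card \<X> \<ge> 3" "\<forall>X\<in>\<X>. X \<noteq> {} \<and> anticonnected V E X"
    "\<forall>X\<in>\<X>. \<forall>Y\<in>\<X>. X \<noteq> Y \<longrightarrow> (\<forall>x\<in>X. \<forall>y\<in>Y. E x y)" using famX by (simp_all add: fam_def)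
  have XV: "\<Union>\<X> \<subseteq> V" using fam(1) by blast
  have finX: "finite \<X>" using finite_subset[OF fam(1)] finite_V by simp
  have X: "X \<noteq> {}" "anticonnected V E X" "X \<subseteq> V" if "X \<in> \<X>" for X using fam(1,3) that by auto
  have XY: "E x y" if "X \<in> \<X>" "Y \<in> \<X>" "X \<noteq> Y" "x \<in> X" "y \<in> Y" for X Y x y using fam(4) that by blast
  have XYd: "X \<inter> Y = {}" if "X \<in> \<X>" "Y \<in> \<X>" "X \<noteq> Y" for X Y
    using XY[OF that] edge_irrefl by blast
  have third: "\<exists>X Y. X \<in> \<X> \<and> Y \<in> \<X> \<and> X \<noteq> A \<and> Y \<noteq> A \<and> X \<noteq> Y" for A
  proof -
    have "card (\<X> - {A}) \<ge> 2" using fam(2) finX by (cases "A \<in> \<X>") auto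
    then obtain T where "T \<subseteq> \<X> - {A}" "card T = 2" by (meson obtain_subset_with_card_n)
    then show ?thesis by (auto simp: card_2_iff)
  qed
  define F where "F = V - \<Union>\<X>"
  \<comment> \<open>The members with a nonneighbour of \<open>f\<close> merge with \<open>f\<close>
    into \<open>D\<close>. Together with the members in \<open>I\<close>, at least two of them, this
    is again a family of three or more sets, and its union has gained \<open>f\<close>.\<close>
  have two: False if f: "f \<in> F" and AB: "A \<in> \<X>" "B \<in> \<X>" "A \<noteq> B" "Ycomplete E A f" "Ycomplete E B f" for f A B
  proof -
    define I where "I = {C \<in> \<X>. Ycomplete E C f}"
    define D where "D = insert f (\<Union>(\<X> - I))"
    have fX: "f \<notin> \<Union>\<X>" "f \<in> V" using f by (auto simp: F_def)
    have D: "anticonnected V E D" unfolding D_def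
      by (rule anticonnected_join) (use X fX in \<open>auto simp: I_def\<close>)
    have "D \<notin> I" using fX by (auto simp: D_def I_def)
    have finI: "finite I" "I \<subseteq> \<X>" using finX by (auto simp: I_def)
    have "{A, B} \<subseteq> I" using AB by (auto simp: I_def)
    then have "card I \<ge> 2" using AB(3) card_mono[OF finI(1), of "{A, B}"] by simp
    then have i2: "card (insert D I) \<ge> 3" using \<open>D \<notin> I\<close> finI by simp
    have ID: "E x y" "E y x" if CI: "C \<in> I" "x \<in> C" and yD: "y \<in> D" for C x y
    proof -
      have C: "C \<in> \<X>" "E f x" using CI by (auto simp: I_def Ycomplete_def)
      have "E x y"
      proof (cases "y = f")
        case True
        then show ?thesis using C edge_sym by blast
      next
        case False
        then obtain C' where "C' \<in> \<X> - I" "y \<in> C'" using yD by (auto simp: D_def)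
        then show ?thesis using XY[OF C(1), of C' x y] CI by blast
      qed
      then show "E x y" "E y x" using edge_sym by auto
    qed
    have i1: "insert D I \<subseteq> Pow V" using fX XV finI by (auto simp: D_def)
    have "D \<noteq> {}" by (simp add: D_def)
    have i3: "\<forall>A\<in>insert D I. A \<noteq> {} \<and> anticonnected V E A"
      using D \<open>D \<noteq> {}\<close> X finI(2) by blast
    have "E x y" if "A \<in> insert D I" "B \<in> insert D I" "A \<noteq> B" "x \<in> A" "y \<in> B" for A B x y
      using that ID XY[of A B x y] finI(2) by blast
    then have i4: "\<forall>A\<in>insert D I. \<forall>B\<in>insert D I. A \<noteq> B \<longrightarrow> (\<forall>x\<in>A. \<forall>y\<in>B. E x y)" by blast
    have "fam (insert D I)" unfolding fam_def by (rule conjI[OF i1 conjI[OF i2 conjI[OF i3 i4]]])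
    then have "card (\<Union>(insert D I)) \<le> card (\<Union>\<X>)" by (rule max)
    moreover have "\<Union>(insert D I) = insert f (\<Union>\<X>)" using finI by (auto simp: D_def)
    moreover have "finite (\<Union>\<X>)" using XV finite_V finite_subset by blast
    ultimately show False using fX by simp
  qed
  show False
  proof (cases "F = {}")
    case True
    obtain u v where uv: "u \<in> V" "v \<in> V" "u \<noteq> v" "\<not> E u v" using contr by (auto simp: complete_graph_def)
    have VX: "V = \<Union>\<X>" using True XV by (auto simp: F_def)
    obtain A where A: "A \<in> \<X>" "u \<in> A" using uv VX by blast
    have vA: "v \<in> A" using A uv VX XY by blast
    obtain B D where BD: "B \<in> \<X>" "D \<in> \<X>" "B \<noteq> A" "D \<noteq> A" "B \<noteq> D" using third[of A] by blast
    have d: "B \<inter> A = {}" "D \<inter> A = {}" "B \<inter> D = {}" using XYd BD A by auto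
    obtain d where "d \<in> D" using X(1)[OF BD(2)] by blast
    \<comment> \<open>All vertices but \<open>u\<close> and \<open>v\<close> are deleted.
      \<open>B\<close> is complete to the others, and \<open>d\<close> shows that there are
      some.\<close>
    have "connected_set V E {u, v}"
    proof (rule no_skew_connected[OF ns, of B "V - {u, v} - B"])
      show "V - {u, v} - B \<noteq> {}" using \<open>d \<in> D\<close> d A vA X(3)[OF BD(2)] by blast
      show "E x y" if "x \<in> B" "y \<in> V - {u, v} - B" for x y
        using that VX XY[OF BD(1)] by blast
      show "{u, v} = V - (B \<union> (V - {u, v} - B))" using uv A vA d by blast
    qed (use X BD in auto)
    then show False using connected_pair uv by blast
  next
    case False
    have FV: "F \<subseteq> V" "\<And>X. X \<in> \<X> \<Longrightarrow> X \<inter> F = {}" by (auto simp: F_def)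
    have conF: "connected_set V E F"
    proof -
      obtain B D where BD: "B \<in> \<X>" "D \<in> \<X>" "B \<noteq> D" using third by blast
      show ?thesis
      proof (rule no_skew_connected[OF ns, of B "\<Union>(\<X> - {B})"])
        show "\<Union>(\<X> - {B}) \<noteq> {}" using BD X(1) by blast
        show "E x y" if "x \<in> B" "y \<in> \<Union>(\<X> - {B})" for x y using that XY BD by blast
        show "F = V - (B \<union> \<Union>(\<X> - {B}))" using BD by (auto simp: F_def)
      qed (use X BD XV in auto)
    qed
    \<comment> \<open>\<open>?M\<close> is what remains of \<open>F\<close> without the vertices
      complete to \<open>Y\<close>. It is connected and sees every vertex of \<open>X\<close>, so
      \<open>complete_vertex_exists\<close> applies, with \<open>w\<close> from a third set as
      spectator.\<close>
    have Z: "\<exists>f\<in>F. Ycomplete E X f" if XX: "X \<in> \<X>" for X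
    proof -
      obtain Y W where YW: "Y \<in> \<X>" "W \<in> \<X>" "Y \<noteq> X" "W \<noteq> X" "Y \<noteq> W" using third[of X] by blast
      obtain w where w: "w \<in> W" using X(1)[OF YW(2)] by blast
      have dd: "X \<inter> Y = {}" "X \<inter> W = {}" "Y \<inter> W = {}" using XYd XX YW by auto
      let ?Z = "{f \<in> F. Ycomplete E Y f}"
      let ?M = "F - ?Z"
      have YO: "E y v" if "y \<in> Y" "v \<in> \<Union>(\<X> - {Y}) \<union> ?Z" for y v
        using that XY[OF YW(1)] edge_sym unfolding Ycomplete_def by blast
      have part: "F \<inter> \<Union>\<X> = {}" "V = F \<union> \<Union>\<X>" using XV by (auto simp: F_def)
      \<comment> \<open>If all of \<open>F\<close> were complete to \<open>Y\<close>, then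
        \<open>Y\<close> would be complete to the rest of the graph, and everything except a
        nonadjacent pair \<open>f\<close>, \<open>x\<close> could be deleted.\<close>
      have Mne: "?M \<noteq> {}"
      proof
        assume "?M = {}"
        then have FZ: "F \<subseteq> ?Z" by blast
        obtain f where f: "f \<in> F" using False by blast
        then have "\<not> Ycomplete E X f" using two[OF f XX YW(1)] YW(3) FZ by blast
        then obtain x where x: "x \<in> X" "\<not> E f x" by (auto simp: Ycomplete_def)
        have fx: "f \<in> V" "x \<in> V" "f \<noteq> x" "f \<notin> Y" "x \<notin> Y" "w \<noteq> f" "w \<noteq> x" "w \<notin> Y" "w \<in> V"
          using f x(1) w FV(1) FV(2)[OF XX] FV(2)[OF YW(1)] FV(2)[OF YW(2)] X(3)[OF XX] X(3)[OF YW(2)] dd by auto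
        have "connected_set V E {f, x}"
        proof (rule no_skew_connected[OF ns, of Y "V - {f, x} - Y"])
          show "V - {f, x} - Y \<noteq> {}" using fx by blast
          show "E y v" if "y \<in> Y" "v \<in> V - {f, x} - Y" for y v
            using that part FZ by (intro YO) auto
          show "{f, x} = V - (Y \<union> (V - {f, x} - Y))" using fx by blast
        qed (use X YW in auto)
        then show False using connected_pair fx(3) x(2) by blast
      qed
      have conM: "connected_set V E ?M"
      proof (rule no_skew_connected[OF ns, of Y "\<Union>(\<X> - {Y}) \<union> ?Z"])
        show "\<Union>(\<X> - {Y}) \<union> ?Z \<noteq> {}" using w YW by blast
        show "?M = V - (Y \<union> (\<Union>(\<X> - {Y}) \<union> ?Z))" using part YW(1) by blast
      qed (use X YW XV FV YO in auto)
      \<comment> \<open>Keeping \<open>x\<close> in addition to \<open>?M\<close> still leaves a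
        connected set, as \<open>Y\<close> and the other deleted vertices are complete to each
        other.\<close>
      have nb: "\<exists>m\<in>?M. E x m" if x: "x \<in> X" for x
      proof -
        have xX: "x \<in> \<Union>(\<X> - {Y})" "x \<notin> Y" "x \<notin> F" "x \<in> V" "w \<noteq> x" 
          using x XX YW(3) dd FV(2)[OF XX] X(3)[OF XX] w by auto
        have "connected_set V E (insert x ?M)"
        proof (rule no_skew_connected[OF ns, of Y "(\<Union>(\<X> - {Y}) \<union> ?Z) - {x}"])
          show "(\<Union>(\<X> - {Y}) \<union> ?Z) - {x} \<noteq> {}" using w YW xX by blast
          show "insert x ?M = V - (Y \<union> ((\<Union>(\<X> - {Y}) \<union> ?Z) - {x}))" using part YW(1) xX by blast
        qed (use X YW XV FV YO in auto)
        then have "\<exists>u\<in>{x}. \<exists>v\<in>insert x ?M - {x}. E u v"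
          using Mne xX(3) by (intro connected_setD) auto
        then show ?thesis by blast
      qed
      have "\<exists>m\<in>?M. Ycomplete E X m"
      proof (rule complete_vertex_exists[OF X(2,3)[OF YW(1)] X(2,3,1)[OF XX] _ _ _ conM])
        show "Ycomplete E Y x" if "x \<in> X" for x using XY[OF XX YW(1)] YW(3) that by (auto simp: Ycomplete_def)
        show "Ycomplete E Y w" using XY[OF YW(2,1)] YW(5) w by (auto simp: Ycomplete_def)
        show "Ycomplete E X w" using XY[OF YW(2) XX] YW(4) w by (auto simp: Ycomplete_def)
        show "?M \<subseteq> V" "?M \<inter> X = {}" "?M \<inter> Y = {}" "w \<notin> ?M" using FV XX YW w by blast+
      qed (use nb in auto)
      then show ?thesis by blast
    qed
    obtain X1 where X1: "X1 \<in> \<X>" using third by blast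
    obtain X2 X3 where X23: "X2 \<in> \<X>" "X3 \<in> \<X>" "X2 \<noteq> X1" "X3 \<noteq> X1" "X2 \<noteq> X3" using third[of X1] by blast
    have tr: "triad X1 X2 X3 F"
      unfolding triad_def
    proof (intro conjI ballI)
      fix A assume "A \<in> {X1, X2, X3}"
      then have "A \<in> \<X>" using X1 X23 by auto
      then show "A \<subseteq> V" "A \<noteq> {}" "anticonnected V E A" "A \<inter> F = {}" using X FV by auto
    qed (use FV(1) X1 X23 XY two in blast)+
    show False by (rule triad_contradiction[OF tr conF Z[OF X1] Z[OF X23(1)] Z[OF X23(2)]])
  qed
qed

end

theorem theorem24p1:
  fixes V :: "'a set" and E :: "'a \<Rightarrow> 'a \<Rightarrow> bool"
  assumes "graph V E" and "F11 V E"
  shows "complete_graph V E \<or> bipartite V E \<or> (\<exists>A B. balanced_skew_partition V E A B)"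
proof -
  interpret F11_graph V E
    using assms by unfold_locales
  show ?thesis
    using balanced_skew_partition_exists no_skew_dichotomy by blast
qed

end
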